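(* Let $\mathfrak{g}$ be a Lie algebra and $\Sigma$ a subgroup of its outer automorphism group $\mathrm{Out}(\mathfrak{g})$. Assume that $\mathfrak{g}$ is reductive, with canonical decomposition $$\mathfrak{g}=\mathfrak{z}\oplus\mathfrak{g}',\qquad \mathfrak{g}'=\mathfrak{g}_1^\Sigma\oplus\ldots\oplus\mathfrak{g}_r^\Sigma$$ into its center $\mathfrak{z}$, its derived algebra $\mathfrak{g}'$ and its $\Sigma$-simple ideals $\mathfrak{g}_1^\Sigma,\ldots,\mathfrak{g}_r^\Sigma$. Let $\mathfrak{m}$ be a $\Sigma$-quasiprimitive subalgebra of $\mathfrak{g}$ containing $\mathfrak{z}$, and let $\mathfrak{m}'=\mathfrak{m}\cap\mathfrak{g}'$, so that $\mathfrak{m}=\mathfrak{z}\oplus\mathfrak{m}'$. Then one of the following two alternatives holds. 1. ($\Sigma$-simple type) $\mathfrak{m}'$ is the direct sum of all $\Sigma$-simple ideals of $\mathfrak{g}$ except one, say $\mathfrak{g}_i^\Sigma$, plus a $\Sigma$-primitive subalgebra $\mathfrak{m}_i^\Sigma$ of $\mathfrak{g}_i^\Sigma$: $$\mathfrak{m}'=\mathfrak{g}_1^\Sigma\oplus\ldots\oplus\mathfrak{g}_{i-1}^\Sigma\oplus\mathfrak{m}_i^\Sigma\oplus\mathfrak{g}_{i+1}^\Sigma\oplus\ldots\oplus\mathfrak{g}_r^\Sigma.$$ 2. ($\Sigma$-diagonal type) $\mathfrak{m}'$ is the direct sum of all $\Sigma$-simple ideals of $\mathfrak{g}$ except two isomorphic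 ones, say $\mathfrak{g}_i^\Sigma$ and $\mathfrak{g}_j^\Sigma$, with the ``diagonal'' subalgebra $\mathfrak{g}_{ij}^\Sigma$ of $\mathfrak{g}_i^\Sigma\oplus\mathfrak{g}_j^\Sigma$: $$\mathfrak{m}'=\bigoplus_{k\neq i,j}\mathfrak{g}_k^\Sigma\oplus\mathfrak{g}_{ij}^\Sigma,$$ where ``diagonal'' means that under suitable $\Sigma$-equivariant isomorphisms $\mathfrak{g}_i^\Sigma\cong\mathfrak{g}_s^\Sigma$ and $\mathfrak{g}_j^\Sigma\cong\mathfrak{g}_s^\Sigma$, the subalgebra $\mathfrak{g}_{ij}^\Sigma$ corresponds to $\mathrm{diag}\,\mathfrak{g}_s^\Sigma=\{(X,X)\mid X\in\mathfrak{g}_s^\Sigma\}\subset\mathfrak{g}_s^\Sigma\oplus\mathfrak{g}_s^\Sigma$. In this case, $\mathfrak{m}$ is a maximal $\Sigma$-invariant subalgebra of $\mathfrak{g}$. Moreover, $\mathfrak{m}$ is a maximal $\Sigma$-invariant ideal of $\mathfrak{g}$ if and only if $\mathfrak{m}$ is of $\Sigma$-simple type and $\mathfrak{m}_i^\Sigma=\{0\}$; in all other cases, $\mathfrak{m}$ is self-normalizing.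
   Context: All Lie algebras are finite-dimensional. $\mathrm{Inn}(\mathfrak{g})$ is the group of inner automorphisms ($=\mathrm{Ad}(G_0)$ for a connected Lie group $G_0$ with Lie algebra $\mathfrak{g}$), $\mathrm{Out}(\mathfrak{g})=\mathrm{Aut}(\mathfrak{g})/\mathrm{Inn}(\mathfrak{g})$. For a subgroup $\Sigma\subset\mathrm{Out}(\mathfrak{g})$, $\mathrm{Aut}_\Sigma(\mathfrak{g})$ is the inverse image of $\Sigma$ in $\mathrm{Aut}(\mathfrak{g})$, and for a subalgebra $\mathfrak{h}$, $\mathrm{Aut}_\Sigma(\mathfrak{g},\mathfrak{h})=\{\phi\in\mathrm{Aut}_\Sigma(\mathfrak{g})\mid\phi(\mathfrak{h})=\mathfrak{h}\}$. $\mathfrak{h}$ is $\Sigma$-invariant if every $\sigma\in\Sigma$ has a representative $\phi\in\mathrm{Aut}(\mathfrak{g})$ with $\phi(\mathfrak{h})=\mathfrak{h}$, i.e. if $\mathrm{Aut}_\Sigma(\mathfrak{g},\mathfrak{h})$ maps onto $\Sigma$. Maximal $\Sigma$-invariant subalgebras (ideals) are the maximal elements among proper $\Sigma$-invariant subalgebras (ideals). A $\Sigma$-quasiprimitive subalgebra of $\mathfrak{g}$ is a proper $\Sigma$-invariant subalgebra $\mathfrak{m}$ such that any $\mathrm{Aut}_\Sigma(\mathfrak{g},\mathfrak{m})$-invariant subalgebra $\tilde{\mathfrak{m}}$ with $\mathfrak{m}\subset\tilde{\mathfrak{m}}\subset\mathfrak{g}$ equals $\mathfrak{m}$ or $\mathfrak{g}$.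 A $\Sigma$-primitive subalgebra is a $\Sigma$-quasiprimitive subalgebra containing no non-trivial proper $\Sigma$-invariant ideal of $\mathfrak{g}$. A Lie algebra with a group $\Sigma$ of outer automorphisms is $\Sigma$-simple if it is not abelian and contains no non-trivial proper $\Sigma$-invariant ideal. The $\Sigma$-simple ideals of a reductive $\mathfrak{g}$ are the sums of the simple ideals belonging to one $\Sigma$-orbit. Since each $\mathfrak{g}_i^\Sigma$ is a $\Sigma$-invariant ideal, restriction gives a homomorphism $\Sigma\to\mathrm{Out}(\mathfrak{g}_i^\Sigma)$, and ``$\Sigma$-primitive subalgebra of $\mathfrak{g}_i^\Sigma$'' refers to the image of $\Sigma$ under this homomorphism. $\Sigma$-equivariance of an isomorphism between two such ideals refers to the induced $\Sigma$-actions (homomorphisms of $\Sigma$ to the outer automorphism groups). A subalgebra is self-normalizing if it equals its normalizer in $\mathfrak{g}$. A Lie algebra is reductive if it is the direct sum of its center and a semisimple ideal. *)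

theory Defs
  imports "HOL-Analysis.Analysis" "HOL-Algebra.Bij" "HOL-Algebra.Generated_Groups"
begin

section \<open>Finite-dimensional Lie algebras over the real or complex numbers\<close>

text \<open>
  A Lie algebra is given by a carrier inside an ambient Euclidean space, a scalar multiplication and
  a bracket, so that a subalgebra is again a Lie algebra after replacing the carrier. The class
  \<open>real_normed_field\<close> has, up to isomorphism, only the two instances of the real and the complex
  numbers (Gelfand-Mazur), so \<open>'k\<close> ranges over these two ground fields. Finite-dimensionality is
  built into \<open>'v\<close>; as \<open>lsmul\<close> extends the real scalar multiplication, it holds over \<open>'k\<close> as well.
  The norm on \<open>'v\<close> only serves to make sense of the exponential series of \<open>ad X\<close>, and the inner
  product is not assumed to be related to the bracket.
\<close>

record ('k, 'v) lie_alg =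
  lcarr :: "'v set"
  lsmul :: "'k \<Rightarrow> 'v \<Rightarrow> 'v"
  lbr :: "'v \<Rightarrow> 'v \<Rightarrow> 'v"

locale lie_algebra = vector_space "lsmul L"
  for L :: "('k::real_normed_field, 'v::euclidean_space) lie_alg" +
  assumes lsmul_of_real: "lsmul L (of_real c) x = c *\<^sub>R x"
    and carrier_subspace: "module.subspace (lsmul L) (lcarr L)"
    and br_closed: "\<lbrakk>x \<in> lcarr L; y \<in> lcarr L\<rbrakk> \<Longrightarrow> lbr L x y \<in> lcarr L"
    and br_add_left: "\<lbrakk>x \<in> lcarr L; y \<in> lcarr L; z \<in> lcarr L\<rbrakk>
      \<Longrightarrow> lbr L (x + y) z = lbr L x z + lbr L y z"
    and br_add_right: "\<lbrakk>x \<in> lcarr L; y \<in> lcarr L; z \<in> lcarr L\<rbrakk>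
      \<Longrightarrow> lbr L x (y + z) = lbr L x y + lbr L x z"
    and br_smul_left: "\<lbrakk>x \<in> lcarr L; y \<in> lcarr L\<rbrakk>
      \<Longrightarrow> lbr L (lsmul L a x) y = lsmul L a (lbr L x y)"
    and br_smul_right: "\<lbrakk>x \<in> lcarr L; y \<in> lcarr L\<rbrakk>
      \<Longrightarrow> lbr L x (lsmul L a y) = lsmul L a (lbr L x y)"
    and br_self: "x \<in> lcarr L \<Longrightarrow> lbr L x x = 0"
    and jacobi: "\<lbrakk>x \<in> lcarr L; y \<in> lcarr L; z \<in> lcarr L\<rbrakk>
      \<Longrightarrow> lbr L x (lbr L y z) + lbr L y (lbr L z x) + lbr L z (lbr L x y) = 0"

definition on_carrier :: "('k, 'v) lie_alg \<Rightarrow> 'v set \<Rightarrow> ('k, 'v) lie_alg" where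
  "on_carrier L H = L\<lparr>lcarr := H\<rparr>"

definition lie_subalgebra ::
    "'v set \<Rightarrow> ('k::real_normed_field, 'v::euclidean_space) lie_alg \<Rightarrow> bool" where
  "lie_subalgebra H L \<longleftrightarrow> module.subspace (lsmul L) H \<and> H \<subseteq> lcarr L \<and>
     (\<forall>x\<in>H. \<forall>y\<in>H. lbr L x y \<in> H)"

definition lie_ideal ::
    "'v set \<Rightarrow> ('k::real_normed_field, 'v::euclidean_space) lie_alg \<Rightarrow> bool" where
  "lie_ideal I L \<longleftrightarrow> module.subspace (lsmul L) I \<and> I \<subseteq> lcarr L \<and>
     (\<forall>x\<in>lcarr L. \<forall>y\<in>I. lbr L x y \<in> I)"

definition lie_center ::
    "('k::real_normed_field, 'v::euclidean_space) lie_alg \<Rightarrow> 'v set" where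
  "lie_center L = {x \<in> lcarr L. \<forall>y\<in>lcarr L. lbr L x y = 0}"

definition lie_normalizer ::
    "('k::real_normed_field, 'v::euclidean_space) lie_alg \<Rightarrow> 'v set \<Rightarrow> 'v set" where
  "lie_normalizer L H = {x \<in> lcarr L. \<forall>y\<in>H. lbr L x y \<in> H}"

definition self_normalizing ::
    "('k::real_normed_field, 'v::euclidean_space) lie_alg \<Rightarrow> 'v set \<Rightarrow> bool" where
  "self_normalizing L H \<longleftrightarrow> lie_normalizer L H = H"

definition bracket_span ::
    "('k::real_normed_field, 'v::euclidean_space) lie_alg \<Rightarrow> 'v set \<Rightarrow> 'v set" where
  "bracket_span L H = module.span (lsmul L) {lbr L x y |x y. x \<in> H \<and> y \<in> H}"

abbreviation lie_derived ::
    "('k::real_normed_field, 'v::euclidean_space) lie_alg \<Rightarrow> 'v set" where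
  "lie_derived L \<equiv> bracket_span L (lcarr L)"

definition lie_solvable ::
    "('k::real_normed_field, 'v::euclidean_space) lie_alg \<Rightarrow> bool" where
  "lie_solvable L \<longleftrightarrow> (\<exists>n. (bracket_span L ^^ n) (lcarr L) = {0})"

definition lie_semisimple ::
    "('k::real_normed_field, 'v::euclidean_space) lie_alg \<Rightarrow> bool" where
  "lie_semisimple L \<longleftrightarrow> (\<forall>I. lie_ideal I L \<and> lie_solvable (on_carrier L I) \<longrightarrow> I = {0})"

definition lie_abelian ::
    "('k::real_normed_field, 'v::euclidean_space) lie_alg \<Rightarrow> bool" where
  "lie_abelian L \<longleftrightarrow> (\<forall>x\<in>lcarr L. \<forall>y\<in>lcarr L. lbr L x y = 0)"

definition lie_simple ::
    "('k::real_normed_field, 'v::euclidean_space) lie_alg \<Rightarrow> bool" where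
  "lie_simple L \<longleftrightarrow> \<not> lie_abelian L \<and> (\<forall>I. lie_ideal I L \<longrightarrow> I = {0} \<or> I = lcarr L)"

definition internal_sum2 :: "'v::ab_group_add set \<Rightarrow> 'v set \<Rightarrow> 'v set \<Rightarrow> bool" where
  "internal_sum2 V A B \<longleftrightarrow> V = {a + b |a b. a \<in> A \<and> b \<in> B} \<and> A \<inter> B = {0}"

definition internal_sum :: "'v::ab_group_add set \<Rightarrow> 'i set \<Rightarrow> ('i \<Rightarrow> 'v set) \<Rightarrow> bool" where
  "internal_sum V K W \<longleftrightarrow>
     V = {\<Sum>k\<in>K. x k |x. \<forall>k\<in>K. x k \<in> W k} \<and>
     (\<forall>x. (\<forall>k\<in>K. x k \<in> W k) \<and> (\<Sum>k\<in>K. x k) = 0 \<longrightarrow> (\<forall>k\<in>K. x k = 0))"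

definition lie_reductive ::
    "('k::real_normed_field, 'v::euclidean_space) lie_alg \<Rightarrow> bool" where
  "lie_reductive L \<longleftrightarrow>
     (\<exists>S. lie_ideal S L \<and> lie_semisimple (on_carrier L S) \<and>
        internal_sum2 (lcarr L) (lie_center L) S)"

section \<open>Inner and outer automorphisms\<close>

definition lie_iso ::
    "('v \<Rightarrow> 'v) \<Rightarrow> ('k::real_normed_field, 'v::euclidean_space) lie_alg
      \<Rightarrow> ('k, 'v) lie_alg \<Rightarrow> bool" where
  "lie_iso f L M \<longleftrightarrow> bij_betw f (lcarr L) (lcarr M) \<and>
     (\<forall>x\<in>lcarr L. \<forall>y\<in>lcarr L. f (x + y) = f x + f y) \<and>
     (\<forall>a. \<forall>x\<in>lcarr L. f (lsmul L a x) = lsmul M a (f x)) \<and>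
     (\<forall>x\<in>lcarr L. \<forall>y\<in>lcarr L. f (lbr L x y) = lbr M (f x) (f y))"

text \<open>As in \<open>BijGroup\<close>, automorphisms are \<open>undefined\<close> outside the carrier.\<close>

definition lie_Aut ::
    "('k::real_normed_field, 'v::euclidean_space) lie_alg \<Rightarrow> ('v \<Rightarrow> 'v) monoid" where
  "lie_Aut L = (BijGroup (lcarr L))\<lparr>carrier := {\<phi> \<in> Bij (lcarr L). lie_iso \<phi> L L}\<rparr>"

definition exp_ad ::
    "('k::real_normed_field, 'v::euclidean_space) lie_alg \<Rightarrow> 'v \<Rightarrow> 'v \<Rightarrow> 'v" where
  "exp_ad L X = (\<lambda>Y\<in>lcarr L. \<Sum>n. (lbr L X ^^ n) Y /\<^sub>R fact n)"

text \<open>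
  For a connected Lie group with Lie algebra \<open>L\<close>, the elements \<open>exp X\<close> generate the group and
  \<open>Ad (exp X) = exp (ad X)\<close>; hence \<open>Ad\<close> of the group is the following subgroup.
\<close>

definition lie_Inn ::
    "('k::real_normed_field, 'v::euclidean_space) lie_alg \<Rightarrow> ('v \<Rightarrow> 'v) set" where
  "lie_Inn L = generate (lie_Aut L) (exp_ad L ` lcarr L)"

definition lie_Out ::
    "('k::real_normed_field, 'v::euclidean_space) lie_alg \<Rightarrow> ('v \<Rightarrow> 'v) set monoid" where
  "lie_Out L = lie_Aut L Mod lie_Inn L"

definition Aut_over ::
    "('k::real_normed_field, 'v::euclidean_space) lie_alg \<Rightarrow> ('v \<Rightarrow> 'v) set set
      \<Rightarrow> ('v \<Rightarrow> 'v) set" where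
  "Aut_over L \<Sigma> = {\<phi> \<in> carrier (lie_Aut L). lie_Inn L #>\<^bsub>lie_Aut L\<^esub> \<phi> \<in> \<Sigma>}"

definition Aut_over_stab ::
    "('k::real_normed_field, 'v::euclidean_space) lie_alg \<Rightarrow> ('v \<Rightarrow> 'v) set set
      \<Rightarrow> 'v set \<Rightarrow> ('v \<Rightarrow> 'v) set" where
  "Aut_over_stab L \<Sigma> H = {\<phi> \<in> Aut_over L \<Sigma>. \<phi> ` H = H}"

section \<open>Invariant, quasiprimitive and primitive subalgebras\<close>

text \<open>An element of \<open>\<Sigma>\<close> is a coset, whose elements are its representatives.\<close>

definition Sigma_invariant :: "('v \<Rightarrow> 'v) set set \<Rightarrow> 'v set \<Rightarrow> bool" where
  "Sigma_invariant \<Sigma> H \<longleftrightarrow> (\<forall>\<sigma>\<in>\<Sigma>. \<exists>\<phi>\<in>\<sigma>. \<phi> ` H = H)"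

definition maximal_Sigma_invariant_subalgebra ::
    "('k::real_normed_field, 'v::euclidean_space) lie_alg \<Rightarrow> ('v \<Rightarrow> 'v) set set
      \<Rightarrow> 'v set \<Rightarrow> bool" where
  "maximal_Sigma_invariant_subalgebra L \<Sigma> H \<longleftrightarrow>
     lie_subalgebra H L \<and> Sigma_invariant \<Sigma> H \<and> H \<noteq> lcarr L \<and>
     (\<forall>K. lie_subalgebra K L \<and> Sigma_invariant \<Sigma> K \<and> K \<noteq> lcarr L \<and> H \<subseteq> K \<longrightarrow> K = H)"

definition maximal_Sigma_invariant_ideal ::
    "('k::real_normed_field, 'v::euclidean_space) lie_alg \<Rightarrow> ('v \<Rightarrow> 'v) set set
      \<Rightarrow> 'v set \<Rightarrow> bool" where
  "maximal_Sigma_invariant_ideal L \<Sigma> I \<longleftrightarrow>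
     lie_ideal I L \<and> Sigma_invariant \<Sigma> I \<and> I \<noteq> lcarr L \<and>
     (\<forall>J. lie_ideal J L \<and> Sigma_invariant \<Sigma> J \<and> J \<noteq> lcarr L \<and> I \<subseteq> J \<longrightarrow> J = I)"

definition Sigma_quasiprimitive ::
    "('k::real_normed_field, 'v::euclidean_space) lie_alg \<Rightarrow> ('v \<Rightarrow> 'v) set set
      \<Rightarrow> 'v set \<Rightarrow> bool" where
  "Sigma_quasiprimitive L \<Sigma> m \<longleftrightarrow>
     lie_subalgebra m L \<and> m \<noteq> lcarr L \<and> Sigma_invariant \<Sigma> m \<and>
     (\<forall>H. lie_subalgebra H L \<and> m \<subseteq> H \<and> (\<forall>\<phi>\<in>Aut_over_stab L \<Sigma> m. \<phi> ` H = H)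
        \<longrightarrow> H = m \<or> H = lcarr L)"

definition Sigma_primitive ::
    "('k::real_normed_field, 'v::euclidean_space) lie_alg \<Rightarrow> ('v \<Rightarrow> 'v) set set
      \<Rightarrow> 'v set \<Rightarrow> bool" where
  "Sigma_primitive L \<Sigma> m \<longleftrightarrow>
     Sigma_quasiprimitive L \<Sigma> m \<and>
     (\<forall>I. lie_ideal I L \<and> Sigma_invariant \<Sigma> I \<and> I \<subseteq> m \<longrightarrow> I = {0} \<or> I = lcarr L)"

section \<open>\<open>\<Sigma>\<close>-simple ideals and the induced actions on them\<close>

text \<open>
  Inner automorphisms preserve ideals, so the \<open>\<Sigma>\<close>-orbit of an ideal is its orbit under
  \<open>Aut_over L \<Sigma>\<close>.
\<close>

definition Sigma_simple_ideals ::
    "('k::real_normed_field, 'v::euclidean_space) lie_alg \<Rightarrow> ('v \<Rightarrow> 'v) set set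
      \<Rightarrow> 'v set set" where
  "Sigma_simple_ideals L \<Sigma> =
     {module.span (lsmul L) (\<Union>\<phi>\<in>Aut_over L \<Sigma>. \<phi> ` S) |S.
        lie_ideal S L \<and> lie_simple (on_carrier L S)}"

text \<open>
  The homomorphism from \<open>\<Sigma>\<close> to the outer automorphism group of a \<open>\<Sigma>\<close>-invariant ideal \<open>I\<close>. All
  representatives of \<open>\<sigma>\<close> restrict to automorphisms of \<open>I\<close>; for \<open>L\<close> reductive they all have the
  same class, so that the union is over equal cosets.
\<close>

definition Out_restrict ::
    "('k::real_normed_field, 'v::euclidean_space) lie_alg \<Rightarrow> 'v set
      \<Rightarrow> ('v \<Rightarrow> 'v) set \<Rightarrow> ('v \<Rightarrow> 'v) set" where
  "Out_restrict L I \<sigma> =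
     (\<Union>\<phi>\<in>\<sigma>. lie_Inn (on_carrier L I) #>\<^bsub>lie_Aut (on_carrier L I)\<^esub> restrict \<phi> I)"

text \<open>The isomorphism of outer automorphism groups induced by an isomorphism \<open>f\<close> from \<open>L\<close> to \<open>M\<close>.\<close>

definition Out_transport ::
    "('v \<Rightarrow> 'v) \<Rightarrow> ('k::real_normed_field, 'v::euclidean_space) lie_alg
      \<Rightarrow> ('k, 'v) lie_alg \<Rightarrow> ('v \<Rightarrow> 'v) set \<Rightarrow> ('v \<Rightarrow> 'v) set" where
  "Out_transport f L M \<sigma> =
     (\<lambda>\<phi>. restrict (f \<circ> \<phi> \<circ> inv_into (lcarr L) f) (lcarr M)) ` \<sigma>"

definition equivariant_iso ::
    "('v \<Rightarrow> 'v) set set \<Rightarrow> ('v \<Rightarrow> 'v)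
      \<Rightarrow> ('k::real_normed_field, 'v::euclidean_space) lie_alg
      \<Rightarrow> (('v \<Rightarrow> 'v) set \<Rightarrow> ('v \<Rightarrow> 'v) set)
      \<Rightarrow> ('k, 'v) lie_alg \<Rightarrow> (('v \<Rightarrow> 'v) set \<Rightarrow> ('v \<Rightarrow> 'v) set) \<Rightarrow> bool" where
  "equivariant_iso \<Sigma> f L \<rho> M \<tau> \<longleftrightarrow>
     lie_iso f L M \<and> (\<forall>\<sigma>\<in>\<Sigma>. Out_transport f L M (\<rho> \<sigma>) = \<tau> \<sigma>)"

text \<open>
  \<open>D\<close> is the diagonal subalgebra of \<open>A \<oplus> B\<close> for suitable equivariant isomorphisms of \<open>A\<close> and \<open>B\<close>
  with a Lie algebra \<open>M\<close> on which \<open>\<Sigma>\<close> acts by outer automorphisms through \<open>\<tau>\<close>; an element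
  \<open>a + b\<close> of \<open>A \<oplus> B\<close> corresponds to the pair \<open>(f a, h b)\<close>.
\<close>

definition Sigma_diagonal ::
    "('k::real_normed_field, 'v::euclidean_space) lie_alg \<Rightarrow> ('v \<Rightarrow> 'v) set set
      \<Rightarrow> 'v set \<Rightarrow> 'v set \<Rightarrow> 'v set \<Rightarrow> bool" where
  "Sigma_diagonal L \<Sigma> A B D \<longleftrightarrow>
     lie_subalgebra D L \<and> D \<subseteq> {a + b |a b. a \<in> A \<and> b \<in> B} \<and>
     (\<exists>(M :: ('k, 'v) lie_alg) \<tau> f h.
        lie_algebra M \<and> \<tau> \<in> hom ((lie_Out L)\<lparr>carrier := \<Sigma>\<rparr>) (lie_Out M) \<and>
        equivariant_iso \<Sigma> f (on_carrier L A) (Out_restrict L A) M \<tau> \<and>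
        equivariant_iso \<Sigma> h (on_carrier L B) (Out_restrict L B) M \<tau> \<and>
        {(f a, h b) |a b. a \<in> A \<and> b \<in> B \<and> a + b \<in> D} = {(x, x) |x. x \<in> lcarr M})"

section \<open>The two types of quasiprimitive subalgebras\<close>

text \<open>Here \<open>g 1, \<dots>, g r\<close> are the \<open>\<Sigma>\<close>-simple ideals and \<open>m'\<close> is the intersection of the
  subalgebra with the derived algebra.\<close>

definition Sigma_simple_type ::
    "('k::real_normed_field, 'v::euclidean_space) lie_alg \<Rightarrow> ('v \<Rightarrow> 'v) set set
      \<Rightarrow> nat \<Rightarrow> (nat \<Rightarrow> 'v set) \<Rightarrow> 'v set \<Rightarrow> nat \<Rightarrow> 'v set \<Rightarrow> bool" where
  "Sigma_simple_type L \<Sigma> r g m' i mi \<longleftrightarrow>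
     i \<in> {1..r} \<and>
     Sigma_primitive (on_carrier L (g i)) (Out_restrict L (g i) ` \<Sigma>) mi \<and>
     internal_sum m' {1..r} (g(i := mi))"

definition Sigma_diagonal_type ::
    "('k::real_normed_field, 'v::euclidean_space) lie_alg \<Rightarrow> ('v \<Rightarrow> 'v) set set
      \<Rightarrow> nat \<Rightarrow> (nat \<Rightarrow> 'v set) \<Rightarrow> 'v set \<Rightarrow> nat \<Rightarrow> nat \<Rightarrow> 'v set \<Rightarrow> bool" where
  "Sigma_diagonal_type L \<Sigma> r g m' i j gij \<longleftrightarrow>
     i \<in> {1..r} \<and> j \<in> {1..r} \<and> i \<noteq> j \<and>
     Sigma_diagonal L \<Sigma> (g i) (g j) gij \<and>
     internal_sum m' ({1..r} - {j}) (g(i := gij))"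

end

theory Submission
  imports Defs
begin

text \<open>
  Let \<open>A\<close> be the group of automorphisms over \<open>\<Sigma>\<close> that preserve \<open>m\<close>. It maps onto \<open>\<Sigma>\<close>, and every
  \<open>A\<close>-invariant subalgebra above \<open>m\<close> is \<open>m\<close> or the whole algebra. Inner automorphisms preserve
  ideals, so an \<open>A\<close>-invariant ideal is invariant under all automorphisms over \<open>\<Sigma>\<close>; if it lies
  in a summand \<open>g i\<close>, then it is \<open>{0}\<close> or \<open>g i\<close> (\<open>g_simple\<close>).

  As \<open>m\<close> is proper and contains the center, some \<open>g i\<close> is not contained in \<open>m\<close>, and \<open>m + g i\<close> is
  the whole algebra (\<open>supplement\<close>). If all other summands lie in \<open>m\<close>, then \<open>m\<close> is of simple type
  with component \<open>m \<inter> g i\<close> (\<open>simple_type\<close>). Otherwise let \<open>g j\<close> be another summand not contained in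
  \<open>m\<close>. Then \<open>m \<inter> g i\<close> is normalized by \<open>m\<close> and centralized by \<open>g j\<close>, so it is an ideal and therefore
  zero, and likewise \<open>m \<inter> g j = {0}\<close>. Since \<open>m\<close> is supplemented by \<open>g i\<close> and by \<open>g j\<close>, its
  intersection with \<open>g i + g j\<close> is the graph of an isomorphism, which is equivariant because \<open>A\<close>
  preserves the graph. A third summand not contained in \<open>m\<close> would centralize the graph and
  turn it into an ideal; its brackets with \<open>g i\<close> would lie in \<open>m \<inter> g i = {0}\<close>, so that \<open>g i\<close> would
  be abelian (\<open>others_in_m\<close>). Hence \<open>m\<close> is of diagonal type (\<open>diagonal_type\<close>).

  A \<open>\<Sigma>\<close>-invariant subalgebra \<open>K\<close> above an \<open>m\<close> of diagonal type meets \<open>g i\<close> in an ideal, as the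
  diagonal projects onto \<open>g i\<close>. If the ideal is zero, then \<open>K = m\<close>; otherwise \<open>K\<close> contains \<open>g i\<close>, hence
  \<open>g j\<close>, hence everything (\<open>diagonal_maximal\<close>). The normalizer of \<open>m\<close> is \<open>A\<close>-invariant, so \<open>m\<close> is
  self-normalizing or an ideal, and in the latter case a maximal \<open>\<Sigma>\<close>-invariant one. It is an ideal
  exactly when it is of simple type with zero component (\<open>maximal_ideal_iff\<close>).

  The group theory behind this rests on three facts about \<open>exp (ad X)\<close>: it is an automorphism, it
  preserves ideals, and it is natural under isomorphisms. They make the inner automorphisms a normal
  subgroup and let outer automorphisms be restricted to the \<open>g i\<close>, on which the algebra acts by inner
  derivations.
\<close>

section \<open>The exponential series of a linear map\<close>

text \<open>Square and triangular partial sums differ by at most a constant times the corresponding difference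
  for the series of norms, so the statement follows from the one for real series.\<close>

lemma (in bounded_bilinear) Cauchy_product_sums:
  fixes x :: "nat \<Rightarrow> 'a" and y :: "nat \<Rightarrow> 'b"
  assumes x: "summable (\<lambda>k. norm (x k))" "x sums X"
    and y: "summable (\<lambda>k. norm (y k))" "y sums Y"
  shows "(\<lambda>k. \<Sum>i\<le>k. prod (x i) (y (k - i))) sums prod X Y"
proof -
  let ?S1 = "\<lambda>n::nat. {..<n} \<times> {..<n}"
  let ?S2 = "\<lambda>n::nat. {(i,j). i + j < n}"
  let ?g = "\<lambda>(i,j). prod (x i) (y j)"
  let ?f = "\<lambda>(i,j). norm (x i) * norm (y j)"
  obtain K where K: "\<And>a b. norm (prod a b) \<le> norm a * norm b * K"
    using bounded by blast
  have sub: "?S2 n \<subseteq> ?S1 n" for n by auto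
  have fin: "finite (?S1 n)" "finite (?S2 n)" for n
    using finite_subset[OF sub] by auto
  have g1: "(\<lambda>n. sum ?g (?S1 n)) \<longlonglongrightarrow> prod X Y"
  proof -
    have "(\<lambda>n. prod (\<Sum>k<n. x k) (\<Sum>k<n. y k)) \<longlonglongrightarrow> prod X Y"
      using x(2) y(2) unfolding sums_def by (rule tendsto)
    moreover have "prod (\<Sum>k<n. x k) (\<Sum>k<n. y k) = sum ?g (?S1 n)" for n

      by (simp only: sum_left, simp only: sum_right, simp only: sum.cartesian_product)
    ultimately show ?thesis by simp
  qed
  have "(\<lambda>n. sum ?f (?S1 n)) \<longlonglongrightarrow> (\<Sum>k. norm (x k)) * (\<Sum>k. norm (y k))"
  proof -
    have "(\<lambda>n. (\<Sum>k<n. norm (x k)) * (\<Sum>k<n. norm (y k)))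
        \<longlonglongrightarrow> (\<Sum>k. norm (x k)) * (\<Sum>k. norm (y k))"
      by (intro tendsto_mult summable_LIMSEQ x y)
    then show ?thesis by (simp add: sum_product sum.cartesian_product)
  qed
  moreover have "(\<lambda>n. sum ?f (?S2 n)) \<longlonglongrightarrow> (\<Sum>k. norm (x k)) * (\<Sum>k. norm (y k))"
    using Series.Cauchy_product_sums[of "\<lambda>k. norm (x k)" "\<lambda>k. norm (y k)"] x y
    by (simp add: sums_def sum.triangle_reindex)
  ultimately have "(\<lambda>n. sum ?f (?S1 n) - sum ?f (?S2 n)) \<longlonglongrightarrow> 0"
    using tendsto_diff by fastforce
  then have 0: "(\<lambda>n. K * (sum ?f (?S1 n) - sum ?f (?S2 n))) \<longlonglongrightarrow> 0"
    using tendsto_mult_right_zero by blast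
  have bd: "norm (sum ?g (?S1 n) - sum ?g (?S2 n)) \<le> K * (sum ?f (?S1 n) - sum ?f (?S2 n))" for n
  proof -
    have "norm (sum ?g (?S1 n) - sum ?g (?S2 n)) = norm (sum ?g (?S1 n - ?S2 n))"
      by (simp only: sum_diff[OF fin(1) sub])
    also have "\<dots> \<le> (\<Sum>p\<in>?S1 n - ?S2 n. K * ?f p)"
      by (rule sum_norm_le) (use K in \<open>auto simp: mult_ac\<close>)
    also have "\<dots> = K * (sum ?f (?S1 n) - sum ?f (?S2 n))"
      by (simp only: sum_diff[OF fin(1) sub] sum_distrib_left[symmetric])
    finally show ?thesis .
  qed
  have "(\<lambda>n. sum ?g (?S1 n) - sum ?g (?S2 n)) \<longlonglongrightarrow> 0"
    by (rule Lim_null_comparison[OF _ 0]) (use bd in simp)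
  from tendsto_diff[OF g1 this] have "(\<lambda>n. sum ?g (?S2 n)) \<longlonglongrightarrow> prod X Y" by simp
  then show ?thesis by (simp add: sums_def sum.triangle_reindex)
qed

text \<open>The exponential of an everywhere defined linear map. For \<open>D\<close> an extension of \<open>ad X\<close> from the carrier
  to the ambient space, it agrees with \<open>exp_ad\<close> on the carrier.\<close>

definition exp_op :: "('v::euclidean_space \<Rightarrow> 'v) \<Rightarrow> 'v \<Rightarrow> 'v" where
  "exp_op D y = (\<Sum>n. (D ^^ n) y /\<^sub>R fact n)"

lemma funpow_norm_le:
  fixes D :: "'v::real_normed_vector \<Rightarrow> 'v"
  assumes "\<And>y. norm (D y) \<le> K * norm y" "K \<ge> 0"
  shows "norm ((D ^^ n) y) \<le> K ^ n * norm y"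
proof (induction n)
  case (Suc n)
  have "norm ((D ^^ Suc n) y) \<le> K * norm ((D ^^ n) y)" using assms by simp
  also have "\<dots> \<le> K * (K ^ n * norm y)" using Suc assms(2) mult_left_mono by blast
  finally show ?case by (simp add: mult.assoc)
qed simp

lemma bounded_linear_funpow:
  "bounded_linear (D :: 'v::real_normed_vector \<Rightarrow> 'v) \<Longrightarrow> bounded_linear (D ^^ n)"
proof (induction n)
  case 0
  then show ?case by (simp add: bounded_linear_ident id_def)
next
  case (Suc n)
  then show ?case using bounded_linear_compose[of D "D ^^ n"] by (simp only: funpow.simps o_def)
qed

lemma exp_op_norm_bound:
  fixes D :: "'v::euclidean_space \<Rightarrow> 'v"
  assumes "bounded_linear D"
  obtains K where "K \<ge> 0" "\<And>n y. norm ((D ^^ n) y /\<^sub>R fact n) \<le> (K ^ n /\<^sub>R fact n) * norm y"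
proof -
  obtain K where K: "K > 0" "\<And>y. norm (D y) \<le> norm y * K"
    using bounded_linear.pos_bounded[OF assms] by blast
  show ?thesis
  proof (rule that[of K])
    fix n y
    show "norm ((D ^^ n) y /\<^sub>R fact n) \<le> (K ^ n /\<^sub>R fact n) * norm y"
      using funpow_norm_le[of D K n y] K by (simp add: divide_simps mult_ac)
  qed (use K in simp)
qed

lemma exp_op_summable:
  fixes D :: "'v::euclidean_space \<Rightarrow> 'v"
  assumes "bounded_linear D"
  shows "summable (\<lambda>n. norm ((D ^^ n) y /\<^sub>R fact n))"
proof -
  obtain K where K: "K \<ge> 0" "\<And>n y. norm ((D ^^ n) y /\<^sub>R fact n) \<le> (K ^ n /\<^sub>R fact n) * norm y"
    using exp_op_norm_bound[OF assms] by blast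
  have "summable (\<lambda>n. (K ^ n /\<^sub>R fact n) * norm y)"
    by (rule summable_mult2[OF summable_exp_generic])
  then show ?thesis
    by (rule summable_comparison_test'[of _ 0]) (simp only: real_norm_def abs_norm_cancel K(2))
qed

lemma exp_op_sums:
  fixes D :: "'v::euclidean_space \<Rightarrow> 'v"
  assumes "bounded_linear D"
  shows "(\<lambda>n. (D ^^ n) y /\<^sub>R fact n) sums exp_op D y"
  unfolding exp_op_def
  by (rule summable_sums[OF summable_norm_cancel[OF exp_op_summable[OF assms]]])

lemma funpow_uminus:
  fixes D :: "'v::real_normed_vector \<Rightarrow> 'v"
  assumes "bounded_linear D"
  shows "((\<lambda>y. - D y) ^^ n) y = (-1) ^ n *\<^sub>R (D ^^ n) y"
  by (induction n)
     (auto simp: linear_scale[OF bounded_linear.linear[OF assms]])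

text \<open>The Cauchy product of the two series, for the bilinear map that applies an operator to a vector,
  consists of the terms \<open>(1 + (-1)) ^ k D ^ k y / k!\<close>.\<close>

lemma exp_op_neg:
  fixes D :: "'v::euclidean_space \<Rightarrow> 'v"
  assumes D: "bounded_linear D"
  shows "exp_op D (exp_op (\<lambda>y. - D y) y) = y"
proof -
  let ?F = "\<lambda>n. Blinfun (\<lambda>y. (D ^^ n) y /\<^sub>R fact n)"
  let ?c = "\<lambda>n. ((\<lambda>y. - D y) ^^ n) y /\<^sub>R fact n"
  let ?w = "exp_op (\<lambda>y. - D y) y"
  have blF: "bounded_linear (\<lambda>y. (D ^^ n) y /\<^sub>R fact n)" for n
    by (rule bounded_linear_const_scaleR[OF bounded_linear_funpow[OF D]])
  have F: "blinfun_apply (?F n) z = (D ^^ n) z /\<^sub>R fact n" for n z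
    by (simp only: bounded_linear_Blinfun_apply[OF blF])
  obtain K where K: "K \<ge> 0" "\<And>n y. norm ((D ^^ n) y /\<^sub>R fact n) \<le> (K ^ n /\<^sub>R fact n) * norm y"
    using exp_op_norm_bound[OF D] by blast
  have nF: "norm (?F n) \<le> K ^ n /\<^sub>R fact n" for n
    by (rule norm_blinfun_bound) (use K in \<open>simp_all only: F, simp_all\<close>)
  have sF: "summable (\<lambda>n. norm (?F n))"
    by (rule summable_comparison_test'[OF summable_exp_generic[of K], of 0])
       (simp only: real_norm_def abs_norm_cancel nF)
  obtain E where E: "?F sums E"
    using summable_norm_cancel[OF sF] summable_sums by blast
  have mD: "bounded_linear (\<lambda>y. - D y)" by (rule bounded_linear_minus[OF D])
  have "(\<lambda>k. \<Sum>i\<le>k. blinfun_apply (?F i) (?c (k - i))) sums blinfun_apply E ?w"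
    by (rule bounded_bilinear.Cauchy_product_sums[OF bounded_bilinear_blinfun_apply sF E
        exp_op_summable[OF mD] exp_op_sums[OF mD]])
  moreover have "(\<Sum>i\<le>k. blinfun_apply (?F i) (?c (k - i))) = (if k = 0 then y else 0)" for k
  proof -
    have "(\<Sum>i\<le>k. blinfun_apply (?F i) (?c (k - i)))
        = (\<Sum>i\<le>k. ((-1) ^ (k - i) * of_nat (k choose i) / fact k) *\<^sub>R (D ^^ k) y)"
    proof (rule sum.cong[OF refl])
      fix i assume i: "i \<in> {..k}"
      note Dil = bounded_linear.linear[OF bounded_linear_funpow[OF D, of i]]
      have "(D ^^ i) ((D ^^ (k - i)) y) = (D ^^ k) y"
        using i by (metis atMost_iff comp_apply funpow_add le_add_diff_inverse)
      then show "blinfun_apply (?F i) (?c (k - i))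
          = ((-1) ^ (k - i) * of_nat (k choose i) / fact k) *\<^sub>R (D ^^ k) y"
        using i unfolding F by (simp add: funpow_uminus[OF D] linear_scale[OF Dil] binomial_fact field_simps)
    qed
    also have "\<dots> = ((\<Sum>i\<le>k. of_nat (k choose i) * 1 ^ i * (-1) ^ (k - i)) / fact k) *\<^sub>R (D ^^ k) y"
      by (simp add: scaleR_sum_left sum_divide_distrib mult_ac)
    also have "(\<Sum>i\<le>k. of_nat (k choose i) * 1 ^ i * (-1) ^ (k - i)) = ((1 + (-1)) ^ k :: real)"
      by (rule binomial_ring[symmetric])
    finally show ?thesis by (cases k) auto
  qed
  ultimately have "(\<lambda>k::nat. if k = 0 then y else 0) sums blinfun_apply E ?w" by simp
  moreover have "(\<lambda>k::nat. if k = 0 then y else 0) sums y"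
    using sums_single[of 0 "\<lambda>_. y"] by simp
  ultimately have "blinfun_apply E ?w = y" by (rule sums_unique2)
  moreover have "(\<lambda>n. (D ^^ n) ?w /\<^sub>R fact n) sums blinfun_apply E ?w"
    using bounded_linear.sums[OF bounded_bilinear.bounded_linear_left
        [OF bounded_bilinear_blinfun_apply] E, of ?w]
    by (simp only: F)
  then have "exp_op D ?w = blinfun_apply E ?w"
    using exp_op_sums[OF D] sums_unique2 by blast
  ultimately show ?thesis by simp
qed

text \<open>The Leibniz rule in divided powers \<open>D ^ i / i!\<close>, which makes it the Cauchy product of the two
  exponential series.\<close>

lemma funpow_derivation:
  fixes B :: "'v::real_normed_vector \<Rightarrow> 'v \<Rightarrow> 'v"
  assumes B: "bounded_bilinear B" and D: "bounded_linear D"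
    and der: "\<And>x y. D (B x y) = B (D x) y + B x (D y)"
  shows "(D ^^ n) (B x y) /\<^sub>R fact n
    = (\<Sum>i\<le>n. B ((D ^^ i) x /\<^sub>R fact i) ((D ^^ (n - i)) y /\<^sub>R fact (n - i)))"
proof (induction n)
  case (Suc n)
  interpret B: bounded_bilinear B by (rule B)
  note Dl = bounded_linear.linear[OF D]
  define d where "d = (\<lambda>i x. (D ^^ i) x /\<^sub>R fact i)"
  have dSuc: "D (d i z) = of_nat (Suc i) *\<^sub>R d (Suc i) z" for i z
    by (simp add: d_def linear_scale[OF Dl] field_simps del: of_nat_Suc)
  have d0: "d 0 z = z" for z by (simp add: d_def)
  have "of_nat (Suc n) *\<^sub>R d (Suc n) (B x y) = D (\<Sum>i\<le>n. B (d i x) (d (n - i) y))"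
    using Suc by (simp only: dSuc[symmetric]) (simp add: d_def)
  also have "\<dots> = (\<Sum>i\<le>n. of_nat (Suc i) *\<^sub>R B (d (Suc i) x) (d (n - i) y))
      + (\<Sum>i\<le>n. of_nat (Suc (n - i)) *\<^sub>R B (d i x) (d (Suc (n - i)) y))"
    by (simp add: linear_sum[OF Dl] der dSuc B.scaleR_left B.scaleR_right sum.distrib del: of_nat_Suc)
  also have "(\<Sum>i\<le>n. of_nat (Suc i) *\<^sub>R B (d (Suc i) x) (d (n - i) y))
      = (\<Sum>i\<le>Suc n. of_nat i *\<^sub>R B (d i x) (d (Suc n - i) y))"
    by (subst sum.atMost_Suc_shift) (simp del: of_nat_Suc)
  also have "(\<Sum>i\<le>n. of_nat (Suc (n - i)) *\<^sub>R B (d i x) (d (Suc (n - i)) y))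
      = (\<Sum>i\<le>Suc n. of_nat (Suc n - i) *\<^sub>R B (d i x) (d (Suc n - i) y))"
    by (simp add: Suc_diff_le of_nat_diff add_diff_eq)
  also have "(\<Sum>i\<le>Suc n. of_nat i *\<^sub>R B (d i x) (d (Suc n - i) y))
      + (\<Sum>i\<le>Suc n. of_nat (Suc n - i) *\<^sub>R B (d i x) (d (Suc n - i) y))
      = (\<Sum>i\<le>Suc n. of_nat (Suc n) *\<^sub>R B (d i x) (d (Suc n - i) y))"
    unfolding sum.distrib[symmetric] scaleR_left_distrib[symmetric]
    by (intro sum.cong refl) (simp add: of_nat_diff)
  finally have "of_nat (Suc n) *\<^sub>R d (Suc n) (B x y)
      = of_nat (Suc n) *\<^sub>R (\<Sum>i\<le>Suc n. B (d i x) (d (Suc n - i) y))"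
    by (simp only: scaleR_sum_right)
  then have "d (Suc n) (B x y) = (\<Sum>i\<le>Suc n. B (d i x) (d (Suc n - i) y))"
    by (simp del: of_nat_Suc sum.atMost_Suc)
  then show ?case unfolding d_def .
qed simp

lemma exp_op_derivation:
  fixes D :: "'v::euclidean_space \<Rightarrow> 'v"
  assumes B: "bounded_bilinear B" and D: "bounded_linear D"
    and der: "\<And>x y. D (B x y) = B (D x) y + B x (D y)"
  shows "exp_op D (B x y) = B (exp_op D x) (exp_op D y)"
proof -
  have "(\<lambda>n. (D ^^ n) (B x y) /\<^sub>R fact n) sums B (exp_op D x) (exp_op D y)"
    unfolding funpow_derivation[OF assms]
    by (rule bounded_bilinear.Cauchy_product_sums[OF B]) (intro exp_op_summable exp_op_sums D)+
  then show ?thesis using exp_op_sums[OF D] sums_unique2 by blast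
qed

section \<open>Brackets and the exponential of \<open>ad X\<close>\<close>

lemma on_carrier_simps [simp]:
  "lcarr (on_carrier L H) = H" "lsmul (on_carrier L H) = lsmul L" "lbr (on_carrier L H) = lbr L"
  by (simp_all add: on_carrier_def)

context lie_algebra
begin

lemma carrier_0 [simp]: "0 \<in> lcarr L"
  using carrier_subspace by (rule subspace_0)

lemma carrier_add: "x \<in> lcarr L \<Longrightarrow> y \<in> lcarr L \<Longrightarrow> x + y \<in> lcarr L"
  using carrier_subspace by (rule subspace_add)

lemma carrier_smul: "x \<in> lcarr L \<Longrightarrow> lsmul L a x \<in> lcarr L"
  using carrier_subspace by (rule subspace_scale)

lemma carrier_neg: "x \<in> lcarr L \<Longrightarrow> - x \<in> lcarr L"
  using carrier_subspace by (rule subspace_neg)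

lemma subspace_scaleR: "subspace V \<Longrightarrow> x \<in> V \<Longrightarrow> c *\<^sub>R x \<in> V"
  using subspace_scale[of V x "of_real c"] by (simp add: lsmul_of_real)

lemma carrier_scaleR: "x \<in> lcarr L \<Longrightarrow> c *\<^sub>R x \<in> lcarr L"
  using subspace_scaleR carrier_subspace by blast

lemma subspace_imp_real: "subspace V \<Longrightarrow> Real_Vector_Spaces.subspace V"
  unfolding Real_Vector_Spaces.subspace_def
  using subspace_0 subspace_add subspace_scaleR by blast

lemma smul_scaleR: "lsmul L a (c *\<^sub>R x) = c *\<^sub>R lsmul L a x"
  by (simp only: lsmul_of_real[symmetric] scale_scale mult.commute)

lemma br_scaleR_left:
  "x \<in> lcarr L \<Longrightarrow> y \<in> lcarr L \<Longrightarrow> lbr L (c *\<^sub>R x) y = c *\<^sub>R lbr L x y"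
  by (simp only: lsmul_of_real[symmetric] br_smul_left)

lemma br_scaleR_right:
  "x \<in> lcarr L \<Longrightarrow> y \<in> lcarr L \<Longrightarrow> lbr L x (c *\<^sub>R y) = c *\<^sub>R lbr L x y"
  by (simp only: lsmul_of_real[symmetric] br_smul_right)

lemma br_zero_left [simp]: "y \<in> lcarr L \<Longrightarrow> lbr L 0 y = 0"
  using br_scaleR_left[of 0 y 0] by simp

lemma br_zero_right [simp]: "y \<in> lcarr L \<Longrightarrow> lbr L y 0 = 0"
  using br_scaleR_right[of y 0 0] by simp

lemma br_minus_right: "x \<in> lcarr L \<Longrightarrow> y \<in> lcarr L \<Longrightarrow> lbr L x (- y) = - lbr L x y"
  using br_scaleR_right[of x y "-1"] by simp

lemma br_anti:
  assumes "x \<in> lcarr L" "y \<in> lcarr L"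
  shows "lbr L y x = - lbr L x y"
proof -
  have "lbr L x (x + y) + lbr L y (x + y) = 0"
    using assms br_add_left[of x y "x + y"] br_self[of "x + y"] by (simp add: carrier_add)
  then have "lbr L x y + lbr L y x = 0"
    using assms by (simp add: br_add_right br_self)
  then show ?thesis by (simp add: add_eq_0_iff)
qed

lemma br_derivation:
  assumes "x \<in> lcarr L" "y \<in> lcarr L" "z \<in> lcarr L"
  shows "lbr L x (lbr L y z) = lbr L (lbr L x y) z + lbr L y (lbr L x z)"
proof -
  have "lbr L z (lbr L x y) = - lbr L (lbr L x y) z"
    using assms by (intro br_anti br_closed)
  moreover have "lbr L y (lbr L z x) = - lbr L y (lbr L x z)"
    using assms by (simp add: br_anti[of x z] br_minus_right br_closed)
  ultimately have "lbr L x (lbr L y z) - lbr L y (lbr L x z) - lbr L (lbr L x y) z = 0"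
    using jacobi[OF assms] by simp
  then show ?thesis by (simp add: algebra_simps)
qed

lemma carrier_projection:
  obtains P where "Real_Vector_Spaces.linear P" "\<And>v. P v \<in> lcarr L"
    "\<And>v. v \<in> lcarr L \<Longrightarrow> P v = v"
proof -
  have "\<exists>P. range P \<subseteq> lcarr L \<and> Real_Vector_Spaces.linear P \<and> (\<forall>v\<in>lcarr L. P (id v) = v)"
    by (rule real_vector.linear_exists_left_inverse_on
        [OF _ subspace_imp_real[OF carrier_subspace]]) (auto intro: linearI)
  then show ?thesis using that by auto
qed

text \<open>The axioms constrain the bracket on the carrier only. Composed with a projection onto the carrier,
  it becomes a continuous bilinear map of the ambient space, to which the lemmas on the exponential
  series apply.\<close>

lemma bracket_extension:
  obtains B where "bounded_bilinear B"
    "\<And>x y. x \<in> lcarr L \<Longrightarrow> y \<in> lcarr L \<Longrightarrow> B x y = lbr L x y"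
    "\<And>x y. B x y \<in> lcarr L"
    "\<And>X x y. X \<in> lcarr L \<Longrightarrow> B X (B x y) = B (B X x) y + B x (B X y)"
proof -
  obtain P where P: "Real_Vector_Spaces.linear P" "\<And>v. P v \<in> lcarr L"
    "\<And>v. v \<in> lcarr L \<Longrightarrow> P v = v"
    using carrier_projection by blast
  define B where "B = (\<lambda>x y. lbr L (P x) (P y))"
  note Padd = linear_add[OF P(1)] and Psc = linear_scale[OF P(1)]
  have "Real_Vector_Spaces.linear (\<lambda>y. B x y)" for x
    unfolding B_def by (rule linearI) (simp only: Padd Psc P(2) br_add_right br_scaleR_right)+
  moreover have "Real_Vector_Spaces.linear (\<lambda>x. B x y)" for y
    unfolding B_def by (rule linearI) (simp only: Padd Psc P(2) br_add_left br_scaleR_left)+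
  ultimately have bil: "bounded_bilinear B"
    unfolding bilinear_conv_bounded_bilinear[symmetric] bilinear_def by blast
  show ?thesis
  proof (rule that[OF bil])
    fix x y
    show "B x y \<in> lcarr L" unfolding B_def by (intro br_closed P(2))
    show "B x y = lbr L x y" if "x \<in> lcarr L" "y \<in> lcarr L"
      using that by (simp only: B_def P(3))
    show "B X (B x y) = B (B X x) y + B x (B X y)" if "X \<in> lcarr L" for X
      using that br_derivation[of X "P x" "P y"] by (simp only: B_def P(2,3) br_closed)
  qed
qed

lemma exp_ad_conv_exp_op:
  assumes B: "\<And>x y. x \<in> lcarr L \<Longrightarrow> y \<in> lcarr L \<Longrightarrow> B x y = lbr L x y"
    and "X \<in> lcarr L" "Y \<in> lcarr L"
  shows "exp_ad L X Y = exp_op (B X) Y" "(B X ^^ n) Y = (lbr L X ^^ n) Y"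
    "(lbr L X ^^ n) Y \<in> lcarr L"
proof -
  have *: "(lbr L X ^^ n) Y \<in> lcarr L" for n
    by (induction n) (use assms in \<open>auto intro: br_closed\<close>)
  have **: "(B X ^^ n) Y = (lbr L X ^^ n) Y" for n
    by (induction n) (use assms * in auto)
  from * ** show "(lbr L X ^^ n) Y \<in> lcarr L" "(B X ^^ n) Y = (lbr L X ^^ n) Y" by auto
  show "exp_ad L X Y = exp_op (B X) Y"
    using assms by (simp add: exp_ad_def exp_op_def **)
qed

lemma exp_ad_sums:
  assumes "X \<in> lcarr L" "Y \<in> lcarr L"
  shows "(\<lambda>n. (lbr L X ^^ n) Y /\<^sub>R fact n) sums exp_ad L X Y"
proof -
  obtain B where B: "bounded_bilinear B"
    "\<And>x y. x \<in> lcarr L \<Longrightarrow> y \<in> lcarr L \<Longrightarrow> B x y = lbr L x y"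
    "\<And>x y. B x y \<in> lcarr L"
    "\<And>X x y. X \<in> lcarr L \<Longrightarrow> B X (B x y) = B (B X x) y + B x (B X y)"
    by (rule bracket_extension) (rule that)
  note D = bounded_bilinear.bounded_linear_right[OF B(1), of X]
  show ?thesis
    using exp_op_sums[OF D, of Y]
    by (simp add: exp_ad_conv_exp_op[of B, OF B(2) assms])
qed

text \<open>The carrier is finite-dimensional over the reals, so its subspaces are topologically closed; those
  stable under \<open>ad X\<close> contain the sum of the exponential series.\<close>

lemma exp_ad_subspace:
  assumes V: "subspace V" "V \<subseteq> lcarr L" and X: "X \<in> lcarr L"
    and inv: "\<And>y. y \<in> V \<Longrightarrow> lbr L X y \<in> V" and Y: "Y \<in> V"
  shows "exp_ad L X Y \<in> V"
proof -
  have n: "(lbr L X ^^ n) Y \<in> V" for n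
    by (induction n) (simp_all add: Y inv)
  have lim: "(\<lambda>n. \<Sum>k<n. (lbr L X ^^ k) Y /\<^sub>R fact k) \<longlonglongrightarrow> exp_ad L X Y"
    using exp_ad_sums[OF X subsetD[OF V(2) Y]] by (simp only: sums_def)
  have mem: "(\<Sum>k<m. (lbr L X ^^ k) Y /\<^sub>R fact k) \<in> V" for m
    by (rule subspace_sum[OF V(1)]) (rule subspace_scaleR[OF V(1) n])
  show ?thesis
    by (rule closed_sequentially[OF closed_subspace[OF subspace_imp_real[OF V(1)]] _ lim]) (rule mem)
qed

lemma exp_ad_closed: "X \<in> lcarr L \<Longrightarrow> Y \<in> lcarr L \<Longrightarrow> exp_ad L X Y \<in> lcarr L"
  by (rule exp_ad_subspace[OF carrier_subspace order.refl]) (auto intro: br_closed)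

lemma exp_ad_neg:
  assumes "X \<in> lcarr L" "Y \<in> lcarr L"
  shows "exp_ad L X (exp_ad L (- X) Y) = Y"
proof -
  obtain B where B: "bounded_bilinear B"
    "\<And>x y. x \<in> lcarr L \<Longrightarrow> y \<in> lcarr L \<Longrightarrow> B x y = lbr L x y"
    "\<And>x y. B x y \<in> lcarr L"
    "\<And>X x y. X \<in> lcarr L \<Longrightarrow> B X (B x y) = B (B X x) y + B x (B X y)"
    by (rule bracket_extension) (rule that)
  have eq: "exp_ad L X Y = exp_op (B X) Y" if "X \<in> lcarr L" "Y \<in> lcarr L" for X Y
    by (rule exp_ad_conv_exp_op(1)) (use B(2) that in auto)
  have mX: "- X \<in> lcarr L" using assms(1) by (rule carrier_neg)
  have "exp_op (B X) (exp_op (\<lambda>y. - B X y) Y) = Y"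
    by (rule exp_op_neg[OF bounded_bilinear.bounded_linear_right[OF B(1)]])
  moreover have "(\<lambda>y. - B X y) = B (- X)"
    using bounded_bilinear.minus_left[OF B(1)] by (intro ext) simp
  ultimately have "exp_op (B X) (exp_ad L (- X) Y) = Y"
    by (simp only: eq[OF mX assms(2)])
  then show ?thesis by (simp only: eq[OF assms(1) exp_ad_closed[OF mX assms(2)]])
qed

lemma exp_ad_br:
  assumes "X \<in> lcarr L" "x \<in> lcarr L" "y \<in> lcarr L"
  shows "exp_ad L X (lbr L x y) = lbr L (exp_ad L X x) (exp_ad L X y)"
proof -
  obtain B where B: "bounded_bilinear B"
    "\<And>x y. x \<in> lcarr L \<Longrightarrow> y \<in> lcarr L \<Longrightarrow> B x y = lbr L x y"
    "\<And>x y. B x y \<in> lcarr L"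
    "\<And>X x y. X \<in> lcarr L \<Longrightarrow> B X (B x y) = B (B X x) y + B x (B X y)"
    by (rule bracket_extension) (rule that)
  have "exp_op (B X) (B x y) = B (exp_op (B X) x) (exp_op (B X) y)"
    by (rule exp_op_derivation[OF B(1) bounded_bilinear.bounded_linear_right[OF B(1)] B(4)[OF assms(1)]])
  then have "exp_ad L X (B x y) = B (exp_ad L X x) (exp_ad L X y)"
    using assms by (simp add: exp_ad_conv_exp_op(1)[of B, OF B(2)] B(2) br_closed)
  then show ?thesis using assms by (simp add: B(2) exp_ad_closed)
qed

lemma exp_ad_add:
  assumes "X \<in> lcarr L" "x \<in> lcarr L" "y \<in> lcarr L"
  shows "exp_ad L X (x + y) = exp_ad L X x + exp_ad L X y"
proof -
  have "(lbr L X ^^ n) (x + y) = (lbr L X ^^ n) x + (lbr L X ^^ n) y" for n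
    by (induction n)
       (use assms in \<open>simp_all add: br_add_right exp_ad_conv_exp_op(3)[of "lbr L"]\<close>)
  then show ?thesis
    using sums_add[OF exp_ad_sums[OF assms(1,2)] exp_ad_sums[OF assms(1,3)]]
      exp_ad_sums[OF assms(1) carrier_add[OF assms(2,3)]] sums_unique2
    by (simp add: scaleR_add_right) blast
qed

text \<open>A linear map \<open>h\<close> on the carrier extends to a continuous one on the ambient space, which may be
  applied to the exponential series term by term.\<close>

lemma lie_hom_exp_ad:
  fixes M :: "('k, 'v) lie_alg"
  assumes M: "lie_algebra M" and h: "\<And>x. x \<in> lcarr L \<Longrightarrow> h x \<in> lcarr M"
    and add: "\<And>x y. x \<in> lcarr L \<Longrightarrow> y \<in> lcarr L \<Longrightarrow> h (x + y) = h x + h y"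
    and sc: "\<And>c x. x \<in> lcarr L \<Longrightarrow> h (c *\<^sub>R x) = c *\<^sub>R h x"
    and X: "X \<in> lcarr L" and X': "X' \<in> lcarr M"
    and br: "\<And>y. y \<in> lcarr L \<Longrightarrow> h (lbr L X y) = lbr M X' (h y)"
    and Y: "Y \<in> lcarr L"
  shows "h (exp_ad L X Y) = exp_ad M X' (h Y)"
proof -
  interpret M: lie_algebra M by (rule M)
  obtain P where P: "Real_Vector_Spaces.linear P" "\<And>v. P v \<in> lcarr L"
    "\<And>v. v \<in> lcarr L \<Longrightarrow> P v = v"
    using carrier_projection by blast
  have "Real_Vector_Spaces.linear (\<lambda>v. h (P v))"
    by (rule linearI) (simp_all add: linear_add[OF P(1)] linear_scale[OF P(1)] P(2) add sc)
  then have "bounded_linear (\<lambda>v. h (P v))" by (simp add: linear_conv_bounded_linear)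
  from bounded_linear.sums[OF this exp_ad_sums[OF X Y]]
  have "(\<lambda>n. h (P ((lbr L X ^^ n) Y /\<^sub>R fact n))) sums h (exp_ad L X Y)"
    by (simp add: P exp_ad_closed X Y)
  moreover have "h ((lbr L X ^^ n) Y) = (lbr M X' ^^ n) (h Y)" for n
    by (induction n) (simp_all add: br X Y exp_ad_conv_exp_op(3)[of "lbr L"])
  then have "h (P ((lbr L X ^^ n) Y /\<^sub>R fact n)) = (lbr M X' ^^ n) (h Y) /\<^sub>R fact n" for n
    by (simp add: P carrier_scaleR X Y exp_ad_conv_exp_op(3)[of "lbr L"] sc)
  ultimately have "(\<lambda>n. (lbr M X' ^^ n) (h Y) /\<^sub>R fact n) sums h (exp_ad L X Y)" by simp
  then show ?thesis using M.exp_ad_sums[OF X' h[OF Y]] sums_unique2 by blast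
qed

lemma exp_ad_smul:
  assumes "X \<in> lcarr L" "x \<in> lcarr L"
  shows "exp_ad L X (lsmul L a x) = lsmul L a (exp_ad L X x)"
  by (rule lie_hom_exp_ad[symmetric, OF lie_algebra_axioms])
     (use assms in \<open>auto simp: carrier_smul scale_right_distrib smul_scaleR br_smul_right\<close>)

lemma exp_ad_iso:
  assumes X: "X \<in> lcarr L"
  shows "lie_iso (exp_ad L X) L L"
proof -
  have mX: "- X \<in> lcarr L" by (rule carrier_neg[OF X])
  have "bij_betw (exp_ad L X) (lcarr L) (lcarr L)"
    by (rule bij_betwI[of _ _ _ "exp_ad L (- X)"])
       (use exp_ad_closed[OF X] exp_ad_closed[OF mX] exp_ad_neg[OF X] exp_ad_neg[OF mX] in auto)
  then show ?thesis
    unfolding lie_iso_def using X by (auto simp: exp_ad_add exp_ad_smul exp_ad_br)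
qed

end

lemma lie_isoD:
  assumes "lie_iso f L M"
  shows "bij_betw f (lcarr L) (lcarr M)" "inj_on f (lcarr L)" "f ` lcarr L = lcarr M"
    "x \<in> lcarr L \<Longrightarrow> f x \<in> lcarr M"
    "x \<in> lcarr L \<Longrightarrow> y \<in> lcarr L \<Longrightarrow> f (x + y) = f x + f y"
    "x \<in> lcarr L \<Longrightarrow> f (lsmul L a x) = lsmul M a (f x)"
    "x \<in> lcarr L \<Longrightarrow> y \<in> lcarr L \<Longrightarrow> f (lbr L x y) = lbr M (f x) (f y)"
  using assms unfolding lie_iso_def bij_betw_def by auto

lemma lie_iso_cong:
  assumes "lie_algebra L" "\<And>x. x \<in> lcarr L \<Longrightarrow> f x = f' x" "lie_iso f L M"
  shows "lie_iso f' L M"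
proof -
  interpret lie_algebra L by (rule assms(1))
  have "bij_betw f' (lcarr L) (lcarr M)"
    using assms(2) lie_isoD(1)[OF assms(3)] bij_betw_cong by metis
  then show ?thesis
    unfolding lie_iso_def
    by (simp add: assms(2)[symmetric] lie_isoD[OF assms(3)] carrier_add carrier_smul br_closed)
qed

lemma lie_iso_id: "lie_iso (\<lambda>x. x) L L"
  unfolding lie_iso_def by (simp add: bij_betw_def)

lemma lie_iso_comp:
  assumes f: "lie_iso f L M" and h: "lie_iso h M N"
  shows "lie_iso (\<lambda>x. h (f x)) L N"
  unfolding lie_iso_def
  using bij_betw_trans[OF lie_isoD(1)[OF f] lie_isoD(1)[OF h]]
  by (simp add: o_def lie_isoD[OF f] lie_isoD[OF h])

lemma lie_iso_inv:
  assumes L: "lie_algebra L" and f: "lie_iso f L M"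
  shows "lie_iso (inv_into (lcarr L) f) M L"
proof -
  interpret lie_algebra L by (rule L)
  let ?h = "inv_into (lcarr L) f"
  note f' = lie_isoD[OF f]
  have eq: "?h y = x" if "x \<in> lcarr L" "f x = y" for x y
    using that f'(2) by auto
  have ex: "?h y \<in> lcarr L" "f (?h y) = y" if "y \<in> lcarr M" for y
    using that f'(3) by (auto intro: inv_into_into f_inv_into_f)
  show ?thesis
    unfolding lie_iso_def
  proof (intro conjI ballI allI)
    show "bij_betw ?h (lcarr M) (lcarr L)" by (rule bij_betw_inv_into[OF f'(1)])
    fix x y a assume x: "x \<in> lcarr M"
    show "?h (lsmul M a x) = lsmul L a (?h x)"
      by (rule eq) (simp_all add: carrier_smul ex x f')
    assume y: "y \<in> lcarr M"
    show "?h (x + y) = ?h x + ?h y"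
      by (rule eq) (simp_all add: carrier_add ex x y f')
    show "?h (lbr M x y) = lbr L (?h x) (?h y)"
      by (rule eq) (simp_all add: br_closed ex x y f')
  qed
qed

lemma lie_iso_zero:
  assumes "lie_algebra L" "lie_iso f L M"
  shows "f 0 = 0"
proof -
  interpret lie_algebra L by (rule assms(1))
  show ?thesis using lie_isoD(5)[OF assms(2), of 0 0] by simp
qed

section \<open>The automorphism group\<close>

lemma carrier_Aut:
  "\<phi> \<in> carrier (lie_Aut L) \<longleftrightarrow> \<phi> \<in> extensional (lcarr L) \<and> lie_iso \<phi> L L"
  unfolding lie_Aut_def Bij_def lie_iso_def by auto

lemma carrier_Aut_Bij: "\<phi> \<in> carrier (lie_Aut L) \<Longrightarrow> \<phi> \<in> Bij (lcarr L)"
  unfolding lie_Aut_def by auto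

lemma Aut_mult:
  assumes "\<phi> \<in> carrier (lie_Aut L)" "\<psi> \<in> carrier (lie_Aut L)"
  shows "\<phi> \<otimes>\<^bsub>lie_Aut L\<^esub> \<psi> = compose (lcarr L) \<phi> \<psi>"
  using carrier_Aut_Bij[OF assms(1)] carrier_Aut_Bij[OF assms(2)]
  by (simp add: lie_Aut_def BijGroup_def)

lemma Aut_one: "\<one>\<^bsub>lie_Aut L\<^esub> = (\<lambda>x\<in>lcarr L. x)"
  by (simp add: lie_Aut_def BijGroup_def)

lemma Aut_eqI:
  assumes "\<phi> \<in> carrier (lie_Aut L)" "\<psi> \<in> carrier (lie_Aut L)"
    "\<And>x. x \<in> lcarr L \<Longrightarrow> \<phi> x = \<psi> x"
  shows "\<phi> = \<psi>"
  using assms unfolding carrier_Aut by (blast intro: extensionalityI)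

lemma restrict_in_Aut:
  "lie_algebra L \<Longrightarrow> lie_iso \<phi> L L \<Longrightarrow> restrict \<phi> (lcarr L) \<in> carrier (lie_Aut L)"
  unfolding carrier_Aut by (auto intro: lie_iso_cong[of L \<phi>])

text \<open>The automorphism of \<open>M\<close> that corresponds to the automorphism \<open>\<phi>\<close> of \<open>L\<close> under the isomorphism \<open>f\<close>.
  \<open>Out_transport\<close> is its image map on sets of automorphisms.\<close>

definition transport ::
    "('v \<Rightarrow> 'v) \<Rightarrow> ('k::real_normed_field, 'v::euclidean_space) lie_alg
      \<Rightarrow> ('k, 'v) lie_alg \<Rightarrow> ('v \<Rightarrow> 'v) \<Rightarrow> 'v \<Rightarrow> 'v" where
  "transport f L M \<phi> = restrict (f \<circ> \<phi> \<circ> inv_into (lcarr L) f) (lcarr M)"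

lemma transport_apply:
  assumes "lie_iso f L M" "x \<in> lcarr L"
  shows "transport f L M \<phi> (f x) = f (\<phi> x)"
  using assms lie_isoD[OF assms(1)] by (simp add: transport_def)

context lie_algebra
begin

lemma subgroup_Aut: "subgroup (carrier (lie_Aut L)) (BijGroup (lcarr L))"
proof (rule subgroup.intro)
  show "carrier (lie_Aut L) \<subseteq> carrier (BijGroup (lcarr L))"
    using carrier_Aut_Bij by (auto simp: BijGroup_def)
next
  fix \<phi> \<psi> assume a: "\<phi> \<in> carrier (lie_Aut L)" "\<psi> \<in> carrier (lie_Aut L)"
  have "lie_iso (\<lambda>x. \<phi> (\<psi> x)) L L"
    using a by (auto simp: carrier_Aut intro: lie_iso_comp)
  from restrict_in_Aut[OF lie_algebra_axioms this]
  show "\<phi> \<otimes>\<^bsub>BijGroup (lcarr L)\<^esub> \<psi> \<in> carrier (lie_Aut L)"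
    using carrier_Aut_Bij[OF a(1)] carrier_Aut_Bij[OF a(2)] by (simp add: BijGroup_def compose_def)
next
  show "\<one>\<^bsub>BijGroup (lcarr L)\<^esub> \<in> carrier (lie_Aut L)"
    using restrict_in_Aut[OF lie_algebra_axioms lie_iso_id] by (simp add: BijGroup_def)
next
  fix \<phi> assume a: "\<phi> \<in> carrier (lie_Aut L)"
  then have "lie_iso (inv_into (lcarr L) \<phi>) L L"
    by (simp add: carrier_Aut lie_iso_inv lie_algebra_axioms)
  from restrict_in_Aut[OF lie_algebra_axioms this]
  show "inv\<^bsub>BijGroup (lcarr L)\<^esub> \<phi> \<in> carrier (lie_Aut L)"
    by (simp add: inv_BijGroup[OF carrier_Aut_Bij[OF a]])
qed

lemma lie_Aut_eq: "lie_Aut L = (BijGroup (lcarr L))\<lparr>carrier := carrier (lie_Aut L)\<rparr>"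
  unfolding lie_Aut_def by simp

lemma group_Aut: "group (lie_Aut L)"
  by (subst lie_Aut_eq) (rule subgroup.subgroup_is_group[OF subgroup_Aut group_BijGroup])

lemma Aut_inv:
  assumes "\<phi> \<in> carrier (lie_Aut L)"
  shows "inv\<^bsub>lie_Aut L\<^esub> \<phi> = restrict (inv_into (lcarr L) \<phi>) (lcarr L)"
  using group.m_inv_consistent[OF group_BijGroup subgroup_Aut assms]
    inv_BijGroup[OF carrier_Aut_Bij[OF assms]] lie_Aut_eq by simp

lemma exp_ad_Aut: "X \<in> lcarr L \<Longrightarrow> exp_ad L X \<in> carrier (lie_Aut L)"
  unfolding carrier_Aut using exp_ad_iso by (simp add: exp_ad_def)

lemma exp_ad_inv:
  assumes "X \<in> lcarr L"
  shows "inv\<^bsub>lie_Aut L\<^esub> (exp_ad L X) = exp_ad L (- X)"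
proof (rule group.inv_equality[OF group_Aut])
  note mX = carrier_neg[OF assms]
  show "exp_ad L X \<in> carrier (lie_Aut L)" "exp_ad L (- X) \<in> carrier (lie_Aut L)"
    using assms mX by (auto intro: exp_ad_Aut)
  then show "exp_ad L (- X) \<otimes>\<^bsub>lie_Aut L\<^esub> exp_ad L X = \<one>\<^bsub>lie_Aut L\<^esub>"
    using exp_ad_neg[OF mX] by (auto simp: Aut_mult Aut_one compose_def intro!: restrict_ext)
qed

lemma subgroup_Inn: "subgroup (lie_Inn L) (lie_Aut L)"
  unfolding lie_Inn_def using exp_ad_Aut by (intro group.generate_is_subgroup[OF group_Aut]) auto

lemma Inn_Aut: "\<iota> \<in> lie_Inn L \<Longrightarrow> \<iota> \<in> carrier (lie_Aut L)"
  by (rule subgroup.mem_carrier[OF subgroup_Inn])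

text \<open>As \<open>exp (ad X)\<close> has the inverse \<open>exp (ad (-X))\<close>, inner automorphisms are products of
  exponentials.\<close>

lemma Inn_induct [consumes 1, case_names one exp mult]:
  assumes \<iota>: "\<iota> \<in> lie_Inn L"
    and one: "P (\<lambda>x\<in>lcarr L. x)"
    and exp: "\<And>X. X \<in> lcarr L \<Longrightarrow> P (exp_ad L X)"
    and mult: "\<And>\<iota> \<kappa>. \<iota> \<in> lie_Inn L \<Longrightarrow> \<kappa> \<in> lie_Inn L \<Longrightarrow> P \<iota> \<Longrightarrow> P \<kappa>
      \<Longrightarrow> P (compose (lcarr L) \<iota> \<kappa>)"
  shows "P \<iota>"
  using \<iota> unfolding lie_Inn_def
proof (induction rule: generate.induct)
  case one
  then show ?case using assms(2) by (simp only: Aut_one)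
next
  case (incl h)
  then show ?case using exp by auto
next
  case (inv h)
  then show ?case using exp by (auto simp: exp_ad_inv carrier_neg)
next
  case (eng h1 h2)
  then show ?case using mult[of h1 h2] Aut_mult Inn_Aut by (metis lie_Inn_def)
qed

lemma Inn_ideal_closed:
  assumes I: "lie_ideal I L" and "\<iota> \<in> lie_Inn L" "y \<in> I"
  shows "\<iota> y \<in> I"
  using assms(2,3)
proof (induction arbitrary: y rule: Inn_induct)
  case one
  then show ?case using I by (auto simp: lie_ideal_def)
next
  case (exp X)
  then show ?case
    using I by (intro exp_ad_subspace) (auto simp: lie_ideal_def)
next
  case (mult \<iota> \<kappa>)
  then show ?case using I by (auto simp: lie_ideal_def compose_def)
qed

lemma Inn_ideal:
  assumes I: "lie_ideal I L" and \<iota>: "\<iota> \<in> lie_Inn L"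
  shows "\<iota> ` I = I"
proof
  show "\<iota> ` I \<subseteq> I" using Inn_ideal_closed[OF assms] by auto
  show "I \<subseteq> \<iota> ` I"
  proof
    fix y assume y: "y \<in> I"
    then have yL: "y \<in> lcarr L" using I by (auto simp: lie_ideal_def)
    have "inv\<^bsub>lie_Aut L\<^esub> \<iota> \<in> lie_Inn L" using subgroup.m_inv_closed[OF subgroup_Inn \<iota>] .
    then have "(inv\<^bsub>lie_Aut L\<^esub> \<iota>) y \<in> I" using Inn_ideal_closed[OF I] y by blast
    moreover have "\<iota> ((inv\<^bsub>lie_Aut L\<^esub> \<iota>) y) = y"
      using yL Inn_Aut[OF \<iota>] lie_isoD(3)[of \<iota> L L]
      by (simp add: Aut_inv carrier_Aut f_inv_into_f)
    ultimately show "y \<in> \<iota> ` I" by force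
  qed
qed

lemma transport_Aut:
  assumes f: "lie_iso f L M" and M: "lie_algebra M" and \<phi>: "\<phi> \<in> carrier (lie_Aut L)"
  shows "transport f L M \<phi> \<in> carrier (lie_Aut M)"
proof -
  have "lie_iso (\<lambda>x. f (\<phi> (inv_into (lcarr L) f x))) M M"
    using lie_iso_comp[OF lie_iso_comp[OF lie_iso_inv[OF lie_algebra_axioms f]] f] \<phi>
    by (simp add: carrier_Aut)
  from restrict_in_Aut[OF M this] show ?thesis by (simp add: transport_def o_def)
qed

lemma transport_exp_ad:
  assumes f: "lie_iso f L M" and M: "lie_algebra M" and X: "X \<in> lcarr L"
  shows "transport f L M (exp_ad L X) = exp_ad M (f X)"
proof (rule Aut_eqI)
  interpret M: lie_algebra M by (rule M)
  show "transport f L M (exp_ad L X) \<in> carrier (lie_Aut M)"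
    by (rule transport_Aut[OF f M exp_ad_Aut[OF X]])
  show "exp_ad M (f X) \<in> carrier (lie_Aut M)"
    by (rule M.exp_ad_Aut[OF lie_isoD(4)[OF f X]])
  fix y assume "y \<in> lcarr M"
  then obtain x where x: "x \<in> lcarr L" "y = f x" using lie_isoD(3)[OF f] by auto
  have "f (exp_ad L X x) = exp_ad M (f X) (f x)"
  proof (rule lie_hom_exp_ad[OF M])
    fix c z assume "z \<in> lcarr L"
    then show "f (c *\<^sub>R z) = c *\<^sub>R f z"
      using lie_isoD(6)[OF f, of z "of_real c"] by (simp add: lsmul_of_real M.lsmul_of_real)
  qed (use x X lie_isoD[OF f] in auto)
  then show "transport f L M (exp_ad L X) y = exp_ad M (f X) y"
    using x by (simp add: transport_apply[OF f])
qed

lemma transport_hom: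
  assumes f: "lie_iso f L M" and M: "lie_algebra M"
  shows "group_hom (lie_Aut L) (lie_Aut M) (transport f L M)"
proof (intro group_hom.intro group_hom_axioms.intro group_Aut lie_algebra.group_Aut[OF M] homI)
  fix \<phi> \<psi> assume a: "\<phi> \<in> carrier (lie_Aut L)" "\<psi> \<in> carrier (lie_Aut L)"
  then show "transport f L M \<phi> \<in> carrier (lie_Aut M)" by (intro transport_Aut f M)
  have ab: "\<phi> \<otimes>\<^bsub>lie_Aut L\<^esub> \<psi> \<in> carrier (lie_Aut L)" using a group_Aut
    by (simp add: group.subgroup_self subgroup.m_closed)
  show "transport f L M (\<phi> \<otimes>\<^bsub>lie_Aut L\<^esub> \<psi>)
    = transport f L M \<phi> \<otimes>\<^bsub>lie_Aut M\<^esub> transport f L M \<psi>"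
  proof (rule Aut_eqI)
    show "transport f L M (\<phi> \<otimes>\<^bsub>lie_Aut L\<^esub> \<psi>) \<in> carrier (lie_Aut M)"
      by (rule transport_Aut[OF f M ab])
    show "transport f L M \<phi> \<otimes>\<^bsub>lie_Aut M\<^esub> transport f L M \<psi> \<in> carrier (lie_Aut M)"
      using group.is_monoid[OF lie_algebra.group_Aut[OF M]] transport_Aut[OF f M] a
      by (simp add: monoid.m_closed)
    fix y assume y: "y \<in> lcarr M"
    then obtain x where x: "x \<in> lcarr L" "y = f x" using lie_isoD(3)[OF f] by auto
    have "\<psi> x \<in> lcarr L" using a x lie_isoD(4)[of \<psi> L L] by (simp add: carrier_Aut)
    then show "transport f L M (\<phi> \<otimes>\<^bsub>lie_Aut L\<^esub> \<psi>) y
      = (transport f L M \<phi> \<otimes>\<^bsub>lie_Aut M\<^esub> transport f L M \<psi>) y"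
      using x y a by (simp add: transport_apply[OF f] Aut_mult transport_Aut[OF f M] compose_def)
  qed
qed

lemma transport_Inn:
  assumes f: "lie_iso f L M" and M: "lie_algebra M"
  shows "transport f L M ` lie_Inn L = lie_Inn M"
proof -
  have "transport f L M ` (exp_ad L ` lcarr L) = exp_ad M ` (f ` lcarr L)"
    using transport_exp_ad[OF f M] by (force simp: image_image)
  also have "f ` lcarr L = lcarr M" by (rule lie_isoD(3)[OF f])
  finally have "lie_Inn M = generate (lie_Aut M) (transport f L M ` (exp_ad L ` lcarr L))"
    by (simp add: lie_Inn_def)
  also have "\<dots> = transport f L M ` generate (lie_Aut L) (exp_ad L ` lcarr L)"
    using exp_ad_Aut by (intro group_hom.generate_img[OF transport_hom[OF f M]]) auto
  finally show ?thesis by (simp add: lie_Inn_def)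
qed

text \<open>Conjugation with \<open>\<phi>\<close> is transport along \<open>\<phi>\<close>.\<close>

lemma normal_Inn: "lie_Inn L \<lhd> lie_Aut L"
proof -
  interpret A: group "lie_Aut L" by (rule group_Aut)
  show ?thesis
    unfolding A.normal_inv_iff
  proof (intro conjI ballI subgroup_Inn)
    fix \<phi> \<iota> assume \<phi>: "\<phi> \<in> carrier (lie_Aut L)" and \<iota>: "\<iota> \<in> lie_Inn L"
    have f: "lie_iso \<phi> L L" using \<phi> by (simp add: carrier_Aut)
    note \<iota>' = Inn_Aut[OF \<iota>]
    note T = transport_Aut[OF f lie_algebra_axioms \<iota>']
    have "transport \<phi> L L \<iota> \<otimes>\<^bsub>lie_Aut L\<^esub> \<phi> = \<phi> \<otimes>\<^bsub>lie_Aut L\<^esub> \<iota>"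
    proof (rule Aut_eqI)
      fix x assume "x \<in> lcarr L"
      then show "(transport \<phi> L L \<iota> \<otimes>\<^bsub>lie_Aut L\<^esub> \<phi>) x = (\<phi> \<otimes>\<^bsub>lie_Aut L\<^esub> \<iota>) x"
        using \<phi> \<iota>' T by (simp add: Aut_mult compose_def transport_apply[OF f])
    qed (use T \<phi> \<iota>' in simp_all)
    then have "\<phi> \<otimes>\<^bsub>lie_Aut L\<^esub> \<iota> \<otimes>\<^bsub>lie_Aut L\<^esub> inv\<^bsub>lie_Aut L\<^esub> \<phi> = transport \<phi> L L \<iota>"
      using \<phi> T \<iota>' by (metis A.inv_solve_right A.m_closed)
    also have "\<dots> \<in> lie_Inn L" using transport_Inn[OF f lie_algebra_axioms] \<iota> by blast
    finally show "\<phi> \<otimes>\<^bsub>lie_Aut L\<^esub> \<iota> \<otimes>\<^bsub>lie_Aut L\<^esub> inv\<^bsub>lie_Aut L\<^esub> \<phi> \<in> lie_Inn L" .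
  qed
qed

lemma Out_transport_coset:
  assumes f: "lie_iso f L M" and M: "lie_algebra M" and \<phi>: "\<phi> \<in> carrier (lie_Aut L)"
  shows "Out_transport f L M (lie_Inn L #>\<^bsub>lie_Aut L\<^esub> \<phi>)
    = lie_Inn M #>\<^bsub>lie_Aut M\<^esub> transport f L M \<phi>"
proof -
  interpret T: group_hom "lie_Aut L" "lie_Aut M" "transport f L M" by (rule transport_hom[OF f M])
  have "Out_transport f L M (lie_Inn L #>\<^bsub>lie_Aut L\<^esub> \<phi>)
      = transport f L M ` (lie_Inn L #>\<^bsub>lie_Aut L\<^esub> \<phi>)"
    unfolding Out_transport_def transport_def ..
  also have "\<dots> = (\<Union>\<iota>\<in>lie_Inn L. {transport f L M \<iota> \<otimes>\<^bsub>lie_Aut M\<^esub> transport f L M \<phi>})"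
    unfolding r_coset_def using Inn_Aut \<phi> by (simp add: image_UN)
  also have "\<dots> = (\<Union>\<iota>\<in>transport f L M ` lie_Inn L. {\<iota> \<otimes>\<^bsub>lie_Aut M\<^esub> transport f L M \<phi>})" by simp
  finally show ?thesis by (simp add: transport_Inn[OF f M] r_coset_def)
qed

end

section \<open>Restriction to ideals\<close>

text \<open>An ideal \<open>I\<close> is called inner here if every \<open>ad x\<close> acts on \<open>I\<close> as \<open>ad a\<close> for some \<open>a\<close> in
  \<open>I\<close>, that is, if the algebra is the sum of \<open>I\<close> and its centralizer. Direct summands are inner.\<close>

definition inner_ideal ::
    "'v set \<Rightarrow> ('k::real_normed_field, 'v::euclidean_space) lie_alg \<Rightarrow> bool" where
  "inner_ideal I L \<longleftrightarrow> lie_ideal I L \<and>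
     (\<forall>x\<in>lcarr L. \<exists>a\<in>I. \<forall>y\<in>I. lbr L x y = lbr L a y)"

context lie_algebra
begin

lemma ideal_left: "lie_ideal I L \<Longrightarrow> x \<in> lcarr L \<Longrightarrow> y \<in> I \<Longrightarrow> lbr L x y \<in> I"
  by (simp add: lie_ideal_def)

lemma ideal_right:
  assumes "lie_ideal I L" "x \<in> I" "y \<in> lcarr L"
  shows "lbr L x y \<in> I"
proof -
  have "x \<in> lcarr L" "subspace I" "lbr L y x \<in> I" using assms by (auto simp: lie_ideal_def)
  then show ?thesis using br_anti[OF assms(3), of x] subspace_neg by simp
qed

lemma lie_ideal_imp_subalgebra: "lie_ideal I L \<Longrightarrow> lie_subalgebra I L"
  unfolding lie_ideal_def lie_subalgebra_def by blast

lemma lie_algebra_on_carrier: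
  assumes H: "lie_subalgebra H L"
  shows "lie_algebra (on_carrier L H)"
proof -
  have sub: "subspace H" "\<And>x. x \<in> H \<Longrightarrow> x \<in> lcarr L"
    and cl: "\<And>x y. x \<in> H \<Longrightarrow> y \<in> H \<Longrightarrow> lbr L x y \<in> H"
    using H by (auto simp: lie_subalgebra_def)
  show ?thesis
  proof (intro lie_algebra.intro lie_algebra_axioms.intro, goal_cases)
    case 1
    then show ?case using vector_space_axioms by simp
  next
    case 3
    then show ?case using sub(1) by simp
  next
    case (10 x y z)
    then show ?case using jacobi sub(2) by simp
  qed (use sub(2) cl in \<open>simp_all add: lsmul_of_real br_add_left br_add_right br_smul_left br_smul_right br_self\<close>)
qed

lemma restrict_Aut:
  assumes "\<phi> \<in> carrier (lie_Aut L)" "lie_subalgebra H L" "\<phi> ` H = H"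
  shows "restrict \<phi> H \<in> carrier (lie_Aut (on_carrier L H))"
proof -
  have H: "\<And>x. x \<in> H \<Longrightarrow> x \<in> lcarr L" using assms(2) by (auto simp: lie_subalgebra_def)
  have iso: "lie_iso \<phi> L L" using assms(1) by (simp add: carrier_Aut)
  have "inj_on \<phi> H" using lie_isoD(2)[OF iso] H by (auto intro: inj_on_subset)
  then have "lie_iso \<phi> (on_carrier L H) (on_carrier L H)"
    unfolding lie_iso_def bij_betw_def using assms(3) lie_isoD[OF iso] H by simp
  from restrict_in_Aut[OF lie_algebra_on_carrier[OF assms(2)] this] show ?thesis by simp
qed

lemma ideal_of_inner_ideal:
  assumes I: "inner_ideal I L" and J: "lie_ideal J (on_carrier L I)"
  shows "lie_ideal J L"
  unfolding lie_ideal_def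
proof (intro conjI ballI)
  show "subspace J" "J \<subseteq> lcarr L" using I J by (auto simp: lie_ideal_def inner_ideal_def)
  fix x y assume "x \<in> lcarr L" "y \<in> J"
  moreover have "J \<subseteq> I" using J by (simp add: lie_ideal_def)
  ultimately obtain a where "a \<in> I" "lbr L x y = lbr L a y"
    using I unfolding inner_ideal_def by blast
  then show "lbr L x y \<in> J" using J \<open>y \<in> J\<close> by (simp add: lie_ideal_def)
qed

lemma restrict_compose:
  assumes "\<phi> \<in> carrier (lie_Aut L)" "\<psi> \<in> carrier (lie_Aut L)"
    "lie_subalgebra H L" "\<phi> ` H = H" "\<psi> ` H = H"
  shows "restrict (\<phi> \<otimes>\<^bsub>lie_Aut L\<^esub> \<psi>) H
    = restrict \<phi> H \<otimes>\<^bsub>lie_Aut (on_carrier L H)\<^esub> restrict \<psi> H"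
proof -
  have H: "\<And>x. x \<in> H \<Longrightarrow> x \<in> lcarr L" using assms(3) by (auto simp: lie_subalgebra_def)
  show ?thesis
    unfolding Aut_mult[OF assms(1,2)]
      Aut_mult[OF restrict_Aut[OF assms(1,3,4)] restrict_Aut[OF assms(2,3,5)]]
    using H assms(5) by (auto simp: compose_def fun_eq_iff)
qed

lemma restrict_Inn:
  assumes I: "inner_ideal I L" and "\<iota> \<in> lie_Inn L"
  shows "restrict \<iota> I \<in> lie_Inn (on_carrier L I)"
proof -
  have sub: "lie_subalgebra I L" and id: "lie_ideal I L" and IL: "I \<subseteq> lcarr L"
    using I lie_ideal_imp_subalgebra by (auto simp: inner_ideal_def lie_ideal_def)
  interpret M: lie_algebra "on_carrier L I" by (rule lie_algebra_on_carrier[OF sub])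
  interpret S: subgroup "lie_Inn (on_carrier L I)" "lie_Aut (on_carrier L I)"
    by (rule M.subgroup_Inn)
  from assms(2) show ?thesis
  proof (induction rule: Inn_induct)
    case one
    have "restrict (\<lambda>x\<in>lcarr L. x) I = \<one>\<^bsub>lie_Aut (on_carrier L I)\<^esub>"
      using IL by (auto simp: Aut_one restrict_def fun_eq_iff)
    then show ?case using S.one_closed by (simp only:)
  next
    case (exp X)
    then obtain a where a: "a \<in> I" "\<And>y. y \<in> I \<Longrightarrow> lbr L X y = lbr L a y"
      using I unfolding inner_ideal_def by blast
    have "(lbr L X ^^ n) y = (lbr L a ^^ n) y \<and> (lbr L a ^^ n) y \<in> I" if "y \<in> I" for y n
      by (induction n) (use that a id IL in \<open>auto simp: lie_ideal_def\<close>)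
    then have "restrict (exp_ad L X) I = exp_ad (on_carrier L I) a"
      using IL by (auto simp: exp_ad_def restrict_def fun_eq_iff)
    then show ?case using a(1) by (auto simp: lie_Inn_def intro: generate.incl)
  next
    case (mult \<iota> \<kappa>)
    have "restrict (compose (lcarr L) \<iota> \<kappa>) I
        = restrict \<iota> I \<otimes>\<^bsub>lie_Aut (on_carrier L I)\<^esub> restrict \<kappa> I"
      using restrict_compose[OF Inn_Aut Inn_Aut sub Inn_ideal[OF id] Inn_ideal[OF id]] mult(1,2)
      by (simp add: Aut_mult Inn_Aut)
    then show ?case using S.m_closed[OF mult(3,4)] by (simp only:)
  qed
qed

lemma Inn_coset_cases:
  assumes "\<phi> \<in> carrier (lie_Aut L)" "\<psi> \<in> lie_Inn L #>\<^bsub>lie_Aut L\<^esub> \<phi>"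
  obtains \<iota> where "\<iota> \<in> lie_Inn L" "\<psi> = \<iota> \<otimes>\<^bsub>lie_Aut L\<^esub> \<phi>"
  using assms unfolding r_coset_def by blast

text \<open>As inner automorphisms restrict to inner automorphisms, the restriction of outer automorphisms to
  an inner ideal can be computed on any representative.\<close>

lemma Out_restrict_coset:
  assumes I: "inner_ideal I L" and \<phi>: "\<phi> \<in> carrier (lie_Aut L)" "\<phi> ` I = I"
  shows "Out_restrict L I (lie_Inn L #>\<^bsub>lie_Aut L\<^esub> \<phi>)
    = lie_Inn (on_carrier L I) #>\<^bsub>lie_Aut (on_carrier L I)\<^esub> restrict \<phi> I"
proof -
  have sub: "lie_subalgebra I L" and id: "lie_ideal I L"
    using I lie_ideal_imp_subalgebra by (auto simp: inner_ideal_def)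
  let ?M = "on_carrier L I"
  interpret M: lie_algebra ?M by (rule lie_algebra_on_carrier[OF sub])
  interpret AM: group "lie_Aut ?M" by (rule M.group_Aut)
  interpret A: group "lie_Aut L" by (rule group_Aut)
  note R = restrict_Aut[OF \<phi>(1) sub \<phi>(2)]
  have "lie_Inn ?M #>\<^bsub>lie_Aut ?M\<^esub> restrict \<psi> I = lie_Inn ?M #>\<^bsub>lie_Aut ?M\<^esub> restrict \<phi> I"
    if \<psi>: "\<psi> \<in> lie_Inn L #>\<^bsub>lie_Aut L\<^esub> \<phi>" for \<psi>
  proof -
    obtain \<iota> where \<iota>: "\<iota> \<in> lie_Inn L" "\<psi> = \<iota> \<otimes>\<^bsub>lie_Aut L\<^esub> \<phi>"
      using Inn_coset_cases[OF \<phi>(1) \<psi>] by blast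
    note RI = restrict_Inn[OF I \<iota>(1)]
    have "lie_Inn ?M #>\<^bsub>lie_Aut ?M\<^esub> restrict \<psi> I
        = lie_Inn ?M #>\<^bsub>lie_Aut ?M\<^esub> (restrict \<iota> I \<otimes>\<^bsub>lie_Aut ?M\<^esub> restrict \<phi> I)"
      using restrict_compose[OF Inn_Aut[OF \<iota>(1)] \<phi>(1) sub Inn_ideal[OF id \<iota>(1)] \<phi>(2)] \<iota>(2)
      by simp
    also have "\<dots> = (lie_Inn ?M #>\<^bsub>lie_Aut ?M\<^esub> restrict \<iota> I) #>\<^bsub>lie_Aut ?M\<^esub> restrict \<phi> I"
      using AM.coset_mult_assoc[OF _ M.Inn_Aut[OF RI] R] M.Inn_Aut by (simp add: subset_iff)
    also have "lie_Inn ?M #>\<^bsub>lie_Aut ?M\<^esub> restrict \<iota> I = lie_Inn ?M"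
      by (rule AM.coset_join2[OF M.Inn_Aut[OF RI] M.subgroup_Inn RI])
    finally show ?thesis .
  qed
  moreover have "\<phi> \<in> lie_Inn L #>\<^bsub>lie_Aut L\<^esub> \<phi>" by (rule A.rcos_self[OF \<phi>(1) subgroup_Inn])
  ultimately show ?thesis unfolding Out_restrict_def by blast
qed

lemma Aut_image_subspace:
  assumes "\<phi> \<in> carrier (lie_Aut L)" "subspace V" "V \<subseteq> lcarr L"
  shows "subspace (\<phi> ` V)"
proof -
  have f: "lie_iso \<phi> L L" using assms(1) by (simp add: carrier_Aut)
  have c: "\<And>x. x \<in> V \<Longrightarrow> x \<in> lcarr L" using assms(3) by blast
  show ?thesis
  proof (rule subspaceI)
    show "0 \<in> \<phi> ` V"
      using lie_iso_zero[OF lie_algebra_axioms f] subspace_0[OF assms(2)] by force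
    fix x y a
    assume "x \<in> \<phi> ` V"
    then obtain x' where x: "x' \<in> V" "x = \<phi> x'" by blast
    have "\<phi> (lsmul L a x') = lsmul L a x" using lie_isoD(6)[OF f] x c by simp
    then show "lsmul L a x \<in> \<phi> ` V" using subspace_scale[OF assms(2) x(1), of a] by force
    assume "y \<in> \<phi> ` V"
    then obtain y' where y: "y' \<in> V" "y = \<phi> y'" by blast
    have "\<phi> (x' + y') = x + y" using lie_isoD(5)[OF f] x y c by simp
    then show "x + y \<in> \<phi> ` V" using subspace_add[OF assms(2) x(1) y(1)] by force
  qed
qed

lemma subspace_br_preimage:
  assumes V: "subspace V" and x: "x \<in> lcarr L"
  shows "subspace {y \<in> lcarr L. lbr L x y \<in> V}"
  by (rule subspaceI)
     (simp_all add: x carrier_add carrier_smul br_add_right br_smul_right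
       subspace_0[OF V] subspace_add[OF V] subspace_scale[OF V])

lemma subspace_iso_preimage:
  assumes f: "lie_iso f L L" and V: "subspace V"
  shows "subspace {x \<in> lcarr L. f x \<in> V}"
  by (rule subspaceI)
     (simp_all add: lie_iso_zero[OF lie_algebra_axioms f] lie_isoD(5,6)[OF f] carrier_add
       carrier_smul subspace_0[OF V] subspace_add[OF V] subspace_scale[OF V])

lemma Aut_image_ideal:
  assumes \<phi>: "\<phi> \<in> carrier (lie_Aut L)" and I: "lie_ideal I L"
  shows "lie_ideal (\<phi> ` I) L"
  unfolding lie_ideal_def
proof (intro conjI ballI)
  have f: "lie_iso \<phi> L L" using \<phi> by (simp add: carrier_Aut)
  have IL: "I \<subseteq> lcarr L" using I by (simp add: lie_ideal_def)
  show "subspace (\<phi> ` I)" using Aut_image_subspace[OF \<phi>] I by (simp add: lie_ideal_def)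
  show "\<phi> ` I \<subseteq> lcarr L" using IL lie_isoD(4)[OF f] by blast
  fix x y assume "x \<in> lcarr L" "y \<in> \<phi> ` I"
  then obtain x' y' where x: "x' \<in> lcarr L" "x = \<phi> x'" and y: "y' \<in> I" "y = \<phi> y'"
    using lie_isoD(3)[OF f] by blast
  then have "\<phi> (lbr L x' y') = lbr L x y" using lie_isoD(7)[OF f] IL by auto
  moreover have "lbr L x' y' \<in> I" using I x y by (simp add: lie_ideal_def)
  ultimately show "lbr L x y \<in> \<phi> ` I" by force
qed

text \<open>Automorphisms in the same outer class act in the same way on ideals.\<close>

lemma Inn_coset_ideal:
  assumes "\<phi> \<in> carrier (lie_Aut L)" "\<psi> \<in> lie_Inn L #>\<^bsub>lie_Aut L\<^esub> \<phi>" and I: "lie_ideal I L"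
  shows "\<psi> ` I = \<phi> ` I"
proof -
  obtain \<iota> where \<iota>: "\<iota> \<in> lie_Inn L" "\<psi> = \<iota> \<otimes>\<^bsub>lie_Aut L\<^esub> \<phi>"
    using Inn_coset_cases[OF assms(1,2)] by blast
  have "\<psi> ` I = \<iota> ` (\<phi> ` I)"
    using I \<iota> assms(1) Inn_Aut by (auto simp: lie_ideal_def Aut_mult compose_def image_image)
  also have "\<dots> = \<phi> ` I" by (rule Inn_ideal[OF Aut_image_ideal[OF assms(1) I] \<iota>(1)])
  finally show ?thesis .
qed

end

section \<open>Groups of outer automorphisms\<close>

text \<open>The group \<open>Aut_over L \<Sigma>\<close> is the inverse image of \<open>\<Sigma>\<close> in the automorphism group. For ideals, being
  \<open>\<Sigma>\<close>-invariant means being preserved by all of it, not only by suitable representatives.\<close>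

locale lie_algebra_Sigma = lie_algebra L
  for L :: "('k::real_normed_field, 'v::euclidean_space) lie_alg" +
  fixes \<Sigma> :: "('v \<Rightarrow> 'v) set set"
  assumes subgroup_Sigma: "subgroup \<Sigma> (lie_Out L)"
begin

lemma Aut_over_Aut: "\<phi> \<in> Aut_over L \<Sigma> \<Longrightarrow> \<phi> \<in> carrier (lie_Aut L)"
  by (simp add: Aut_over_def)

lemma Aut_over_iso: "\<phi> \<in> Aut_over L \<Sigma> \<Longrightarrow> lie_iso \<phi> L L"
  by (simp add: Aut_over_def carrier_Aut)

lemma Sigma_coset:
  assumes "\<sigma> \<in> \<Sigma>" "\<phi> \<in> \<sigma>"
  shows "\<sigma> = lie_Inn L #>\<^bsub>lie_Aut L\<^esub> \<phi>" "\<phi> \<in> Aut_over L \<Sigma>"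
proof -
  interpret A: group "lie_Aut L" by (rule group_Aut)
  obtain \<psi> where \<psi>: "\<psi> \<in> carrier (lie_Aut L)" "\<sigma> = lie_Inn L #>\<^bsub>lie_Aut L\<^esub> \<psi>"
    using subgroup.mem_carrier[OF subgroup_Sigma assms(1)]
    by (auto simp: lie_Out_def carrier_FactGroup)
  then show 1: "\<sigma> = lie_Inn L #>\<^bsub>lie_Aut L\<^esub> \<phi>"
    using A.repr_independence[OF _ _ subgroup_Inn] assms(2) by metis
  have "\<phi> \<in> carrier (lie_Aut L)"
    using subgroup.elemrcos_carrier[OF subgroup_Inn group_Aut] \<psi> assms(2) by blast
  with 1 assms(1) show "\<phi> \<in> Aut_over L \<Sigma>" by (simp add: Aut_over_def)
qed

lemma subgroup_Aut_over: "subgroup (Aut_over L \<Sigma>) (lie_Aut L)"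
proof -
  interpret A: group "lie_Aut L" by (rule group_Aut)
  interpret N: normal "lie_Inn L" "lie_Aut L" by (rule normal_Inn)
  interpret S: subgroup \<Sigma> "lie_Out L" by (rule subgroup_Sigma)
  show ?thesis
  proof (rule A.subgroupI)
    show "Aut_over L \<Sigma> \<subseteq> carrier (lie_Aut L)" by (auto simp: Aut_over_def)
    have "lie_Inn L \<in> \<Sigma>" using S.one_closed by (simp add: lie_Out_def)
    then have "\<one>\<^bsub>lie_Aut L\<^esub> \<in> Aut_over L \<Sigma>"
      using A.coset_mult_one[of "lie_Inn L"] N.subset by (simp add: Aut_over_def)
    then show "Aut_over L \<Sigma> \<noteq> {}" by blast
  next
    fix \<phi> assume \<phi>: "\<phi> \<in> Aut_over L \<Sigma>"
    then have c: "lie_Inn L #>\<^bsub>lie_Aut L\<^esub> \<phi> \<in> \<Sigma>" "\<phi> \<in> carrier (lie_Aut L)"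
      by (auto simp: Aut_over_def)
    have "inv\<^bsub>lie_Out L\<^esub> (lie_Inn L #>\<^bsub>lie_Aut L\<^esub> \<phi>) = set_inv\<^bsub>lie_Aut L\<^esub> (lie_Inn L #>\<^bsub>lie_Aut L\<^esub> \<phi>)"
      unfolding lie_Out_def
      by (rule N.inv_FactGroup) (use c in \<open>auto simp: carrier_FactGroup\<close>)
    also have "\<dots> = lie_Inn L #>\<^bsub>lie_Aut L\<^esub> inv\<^bsub>lie_Aut L\<^esub> \<phi>" by (rule N.rcos_inv[OF c(2)])
    finally have "lie_Inn L #>\<^bsub>lie_Aut L\<^esub> inv\<^bsub>lie_Aut L\<^esub> \<phi> \<in> \<Sigma>" using S.m_inv_closed[OF c(1)] by simp
    then show "inv\<^bsub>lie_Aut L\<^esub> \<phi> \<in> Aut_over L \<Sigma>" using c by (simp add: Aut_over_def)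
  next
    fix \<phi> \<psi> assume "\<phi> \<in> Aut_over L \<Sigma>" "\<psi> \<in> Aut_over L \<Sigma>"
    then have c: "lie_Inn L #>\<^bsub>lie_Aut L\<^esub> \<phi> \<in> \<Sigma>" "\<phi> \<in> carrier (lie_Aut L)"
      "lie_Inn L #>\<^bsub>lie_Aut L\<^esub> \<psi> \<in> \<Sigma>" "\<psi> \<in> carrier (lie_Aut L)"
      by (auto simp: Aut_over_def)
    then have "lie_Inn L #>\<^bsub>lie_Aut L\<^esub> (\<phi> \<otimes>\<^bsub>lie_Aut L\<^esub> \<psi>) \<in> \<Sigma>"
      using S.m_closed[OF c(1,3)] N.rcos_sum[OF c(2,4)] by (simp add: lie_Out_def)
    then show "\<phi> \<otimes>\<^bsub>lie_Aut L\<^esub> \<psi> \<in> Aut_over L \<Sigma>" using c by (simp add: Aut_over_def)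
  qed
qed

lemma Aut_over_inverse:
  assumes "\<phi> \<in> Aut_over L \<Sigma>"
  obtains \<psi> where "\<psi> \<in> Aut_over L \<Sigma>" "\<And>x. x \<in> lcarr L \<Longrightarrow> \<phi> (\<psi> x) = x"
    "\<And>x. x \<in> lcarr L \<Longrightarrow> \<psi> (\<phi> x) = x"
proof (rule that[of "inv\<^bsub>lie_Aut L\<^esub> \<phi>"])
  show "inv\<^bsub>lie_Aut L\<^esub> \<phi> \<in> Aut_over L \<Sigma>"
    by (rule subgroup.m_inv_closed[OF subgroup_Aut_over assms])
  note iso = lie_isoD[OF Aut_over_iso[OF assms]]
  fix x assume "x \<in> lcarr L"
  then show "\<phi> ((inv\<^bsub>lie_Aut L\<^esub> \<phi>) x) = x" "(inv\<^bsub>lie_Aut L\<^esub> \<phi>) (\<phi> x) = x"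
    using iso(2-4) by (simp_all add: Aut_inv[OF Aut_over_Aut[OF assms]] f_inv_into_f)
qed

lemma invariant_if_subset:
  assumes "H \<subseteq> lcarr L" "\<And>\<phi> x. \<phi> \<in> Aut_over L \<Sigma> \<Longrightarrow> x \<in> H \<Longrightarrow> \<phi> x \<in> H"
    and \<phi>: "\<phi> \<in> Aut_over L \<Sigma>"
  shows "\<phi> ` H = H"
proof
  show "\<phi> ` H \<subseteq> H" using assms by blast
  obtain \<psi> where "\<psi> \<in> Aut_over L \<Sigma>" "\<And>x. x \<in> lcarr L \<Longrightarrow> \<phi> (\<psi> x) = x"
    by (rule Aut_over_inverse[OF \<phi>]) (rule that)
  then have "x = \<phi> (\<psi> x)" "\<psi> x \<in> H" if "x \<in> H" for x using assms(1,2) that by auto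
  then show "H \<subseteq> \<phi> ` H" by blast
qed

lemma invariant_ideal:
  assumes I: "lie_ideal I L" and "Sigma_invariant \<Sigma> I" and \<phi>: "\<phi> \<in> Aut_over L \<Sigma>"
  shows "\<phi> ` I = I"
proof -
  have "lie_Inn L #>\<^bsub>lie_Aut L\<^esub> \<phi> \<in> \<Sigma>" using \<phi> by (simp add: Aut_over_def)
  then obtain \<psi> where "\<psi> \<in> lie_Inn L #>\<^bsub>lie_Aut L\<^esub> \<phi>" "\<psi> ` I = I"
    using assms(2) unfolding Sigma_invariant_def by blast
  then show ?thesis using Inn_coset_ideal[OF Aut_over_Aut[OF \<phi>] _ I] by blast
qed

lemma Sigma_rep:
  assumes "\<sigma> \<in> \<Sigma>" "Sigma_invariant \<Sigma> H"
  obtains \<phi> where "\<phi> \<in> Aut_over_stab L \<Sigma> H" "\<phi> \<in> \<sigma>" "\<sigma> = lie_Inn L #>\<^bsub>lie_Aut L\<^esub> \<phi>"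
proof -
  obtain \<phi> where \<phi>: "\<phi> \<in> \<sigma>" "\<phi> ` H = H" using assms unfolding Sigma_invariant_def by blast
  note c = Sigma_coset[OF assms(1) \<phi>(1)]
  show ?thesis by (rule that[OF _ \<phi>(1) c(1)]) (simp add: Aut_over_stab_def c(2) \<phi>(2))
qed

lemma Sigma_invariant_if_stab:
  assumes "Sigma_invariant \<Sigma> H" "\<And>\<phi>. \<phi> \<in> Aut_over_stab L \<Sigma> H \<Longrightarrow> \<phi> ` K = K"
  shows "Sigma_invariant \<Sigma> K"
  unfolding Sigma_invariant_def using Sigma_rep[OF _ assms(1)] assms(2) by metis

lemma Aut_over_image_Int:
  assumes "\<phi> \<in> Aut_over L \<Sigma>" "H \<subseteq> lcarr L" "K \<subseteq> lcarr L"
  shows "\<phi> ` (H \<inter> K) = \<phi> ` H \<inter> \<phi> ` K"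
  using inj_on_image_Int[OF lie_isoD(2)[OF Aut_over_iso[OF assms(1)]] assms(2,3)] .

lemma Out_restrict_hom:
  assumes I: "inner_ideal I L" and inv: "\<And>\<phi>. \<phi> \<in> Aut_over L \<Sigma> \<Longrightarrow> \<phi> ` I = I"
  shows "Out_restrict L I \<in> hom ((lie_Out L)\<lparr>carrier := \<Sigma>\<rparr>) (lie_Out (on_carrier L I))"
proof (rule homI)
  let ?M = "on_carrier L I"
  have sub: "lie_subalgebra I L"
    using I lie_ideal_imp_subalgebra by (auto simp: inner_ideal_def)
  interpret M: lie_algebra ?M by (rule lie_algebra_on_carrier[OF sub])
  interpret N: normal "lie_Inn L" "lie_Aut L" by (rule normal_Inn)
  interpret NM: normal "lie_Inn ?M" "lie_Aut ?M" by (rule M.normal_Inn)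
  have rep: "\<exists>\<phi>\<in>Aut_over L \<Sigma>. \<sigma> = lie_Inn L #>\<^bsub>lie_Aut L\<^esub> \<phi>" if \<sigma>: "\<sigma> \<in> \<Sigma>" for \<sigma>
  proof -
    have "\<sigma> \<in> carrier (lie_Out L)" using subgroup.mem_carrier[OF subgroup_Sigma \<sigma>] .
    then obtain \<phi> where "\<phi> \<in> carrier (lie_Aut L)" "\<sigma> = lie_Inn L #>\<^bsub>lie_Aut L\<^esub> \<phi>"
      by (auto simp: lie_Out_def carrier_FactGroup)
    with \<sigma> show ?thesis by (auto simp: Aut_over_def)
  qed
  note R = restrict_Aut[OF Aut_over_Aut sub inv]
  note O = Out_restrict_coset[OF I Aut_over_Aut inv]
  fix \<sigma> assume "\<sigma> \<in> carrier ((lie_Out L)\<lparr>carrier := \<Sigma>\<rparr>)"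
  then obtain \<phi> where \<phi>: "\<phi> \<in> Aut_over L \<Sigma>" "\<sigma> = lie_Inn L #>\<^bsub>lie_Aut L\<^esub> \<phi>"
    using rep by auto
  show "Out_restrict L I \<sigma> \<in> carrier (lie_Out ?M)"
    unfolding \<phi>(2) O[OF \<phi>(1) \<phi>(1)] lie_Out_def carrier_FactGroup using R[OF \<phi>(1) \<phi>(1)] by blast
  fix \<tau> assume "\<tau> \<in> carrier ((lie_Out L)\<lparr>carrier := \<Sigma>\<rparr>)"
  then obtain \<psi> where \<psi>: "\<psi> \<in> Aut_over L \<Sigma>" "\<tau> = lie_Inn L #>\<^bsub>lie_Aut L\<^esub> \<psi>"
    using rep by auto
  have p: "\<phi> \<otimes>\<^bsub>lie_Aut L\<^esub> \<psi> \<in> Aut_over L \<Sigma>"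
    by (rule subgroup.m_closed[OF subgroup_Aut_over \<phi>(1) \<psi>(1)])
  have "Out_restrict L I (\<sigma> \<otimes>\<^bsub>lie_Out L\<^esub> \<tau>)
      = Out_restrict L I (lie_Inn L #>\<^bsub>lie_Aut L\<^esub> (\<phi> \<otimes>\<^bsub>lie_Aut L\<^esub> \<psi>))"
    using N.rcos_sum[OF Aut_over_Aut[OF \<phi>(1)] Aut_over_Aut[OF \<psi>(1)]] \<phi>(2) \<psi>(2)
    by (simp add: lie_Out_def)
  also have "\<dots> = lie_Inn ?M #>\<^bsub>lie_Aut ?M\<^esub>
      (restrict \<phi> I \<otimes>\<^bsub>lie_Aut ?M\<^esub> restrict \<psi> I)"
    unfolding O[OF p p]
    by (simp add: restrict_compose[OF Aut_over_Aut Aut_over_Aut sub inv inv] \<phi>(1) \<psi>(1))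
  also have "\<dots> = Out_restrict L I \<sigma> \<otimes>\<^bsub>lie_Out ?M\<^esub> Out_restrict L I \<tau>"
    using NM.rcos_sum[OF R[OF \<phi>(1) \<phi>(1)] R[OF \<psi>(1) \<psi>(1)]]
    unfolding \<phi>(2) \<psi>(2) O[OF \<phi>(1) \<phi>(1)] O[OF \<psi>(1) \<psi>(1)] by (simp add: lie_Out_def)
  finally show "Out_restrict L I (\<sigma> \<otimes>\<^bsub>(lie_Out L)\<lparr>carrier := \<Sigma>\<rparr>\<^esub> \<tau>)
      = Out_restrict L I \<sigma> \<otimes>\<^bsub>lie_Out ?M\<^esub> Out_restrict L I \<tau>" by simp
qed

section \<open>\<open>\<Sigma>\<close>-simple ideals\<close>

text \<open>The second alternative for \<open>I\<close> in the last statement amounts to \<open>I = {0}\<close> as soon as \<open>W\<close> is known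
  to have zero center, which is shown below for the summands of the derived algebra.\<close>

lemma Sigma_simple_ideals:
  assumes "W \<in> Sigma_simple_ideals L \<Sigma>"
  shows "lie_ideal W L" "W \<noteq> {0}" "\<phi> \<in> Aut_over L \<Sigma> \<Longrightarrow> \<phi> ` W = W"
    "lie_ideal I L \<Longrightarrow> (\<And>\<phi>. \<phi> \<in> Aut_over L \<Sigma> \<Longrightarrow> \<phi> ` I = I) \<Longrightarrow> I \<subseteq> W \<Longrightarrow>
      I = W \<or> (\<forall>x\<in>I. \<forall>y\<in>W. lbr L x y = 0)"
proof -
  obtain S where S: "lie_ideal S L" "lie_simple (on_carrier L S)"
    and W: "W = span (\<Union>\<phi>\<in>Aut_over L \<Sigma>. \<phi> ` S)"
    using assms unfolding Sigma_simple_ideals_def by blast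
  let ?U = "\<Union>\<phi>\<in>Aut_over L \<Sigma>. \<phi> ` S"
  have SL: "S \<subseteq> lcarr L" "subspace S" using S(1) by (auto simp: lie_ideal_def)
  have id: "lie_ideal (\<phi> ` S) L" if "\<phi> \<in> Aut_over L \<Sigma>" for \<phi>
    using Aut_image_ideal[OF Aut_over_Aut[OF that] S(1)] .
  have UL: "?U \<subseteq> lcarr L" using id by (auto simp: lie_ideal_def)
  have WL: "W \<subseteq> lcarr L" unfolding W by (rule span_minimal[OF UL carrier_subspace])
  have sW: "subspace W" unfolding W by (rule subspace_span)
  have UW: "?U \<subseteq> W" unfolding W by (rule span_superset)
  have linW: "lbr L x y \<in> V" if V: "subspace V" and y: "y \<in> W" and x: "x \<in> lcarr L"
    and U: "\<And>u. u \<in> ?U \<Longrightarrow> lbr L x u \<in> V" for x y V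
  proof -
    have "?U \<subseteq> {y \<in> lcarr L. lbr L x y \<in> V}" using U UL by blast
    then have "W \<subseteq> {y \<in> lcarr L. lbr L x y \<in> V}"
      unfolding W by (rule span_minimal[OF _ subspace_br_preimage[OF V x]])
    then show ?thesis using y by blast
  qed
  show ideal: "lie_ideal W L"
    unfolding lie_ideal_def
  proof (intro conjI ballI WL)
    show "subspace W" by (rule sW)
    fix x y assume xy: "x \<in> lcarr L" "y \<in> W"
    have "lbr L x u \<in> W" if u: "u \<in> ?U" for u
    proof -
      obtain \<phi> where \<phi>: "\<phi> \<in> Aut_over L \<Sigma>" "u \<in> \<phi> ` S" using u by blast
      then have "lbr L x u \<in> \<phi> ` S" using ideal_left[OF id xy(1)] by blast
      then show ?thesis using \<phi>(1) UW by blast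
    qed
    then show "lbr L x y \<in> W" by (rule linW[OF sW xy(2,1)])
  qed
  have "\<one>\<^bsub>lie_Aut L\<^esub> \<in> Aut_over L \<Sigma>" by (rule subgroup.one_closed[OF subgroup_Aut_over])
  moreover have "\<one>\<^bsub>lie_Aut L\<^esub> ` S = S" using SL(1) by (auto simp: Aut_one subset_iff)
  ultimately have SW: "S \<subseteq> W" using UW by blast
  have S0: "S \<noteq> {0}" using S(2) SL by (auto simp: lie_simple_def lie_abelian_def)
  then show "W \<noteq> {0}" using SW subspace_0[OF SL(2)] by blast
  have maps: "\<phi> x \<in> W" if \<phi>: "\<phi> \<in> Aut_over L \<Sigma>" and x: "x \<in> W" for \<phi> x
  proof -
    have "?U \<subseteq> {x \<in> lcarr L. \<phi> x \<in> W}"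
    proof
      fix u assume u: "u \<in> ?U"
      then obtain \<psi> s where s: "\<psi> \<in> Aut_over L \<Sigma>" "s \<in> S" "u = \<psi> s" by blast
      have "\<phi> \<otimes>\<^bsub>lie_Aut L\<^esub> \<psi> \<in> Aut_over L \<Sigma>"
        by (rule subgroup.m_closed[OF subgroup_Aut_over \<phi> s(1)])
      moreover have "(\<phi> \<otimes>\<^bsub>lie_Aut L\<^esub> \<psi>) s = \<phi> u"
        using s SL by (auto simp: Aut_mult Aut_over_Aut \<phi> compose_def)
      ultimately have "\<phi> u \<in> ?U" using s(2) by (metis UN_I image_eqI)
      then show "u \<in> {x \<in> lcarr L. \<phi> x \<in> W}" using u UL UW by blast
    qed
    then have "W \<subseteq> {x \<in> lcarr L. \<phi> x \<in> W}"
      by (subst (1) W) (rule span_minimal[OF _ subspace_iso_preimage[OF Aut_over_iso[OF \<phi>] sW]])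
    then show ?thesis using x by blast
  qed
  show "\<phi> ` W = W" if "\<phi> \<in> Aut_over L \<Sigma>"
    by (rule invariant_if_subset[OF WL _ that]) (rule maps)
  assume I: "lie_ideal I L" and inv: "\<And>\<phi>. \<phi> \<in> Aut_over L \<Sigma> \<Longrightarrow> \<phi> ` I = I" and IW: "I \<subseteq> W"
  have IL: "I \<subseteq> lcarr L" "subspace I" using I by (auto simp: lie_ideal_def)
  have "lie_ideal (I \<inter> S) (on_carrier L S)"
    using I S(1) SL by (auto simp: lie_ideal_def subspace_inter)
  then consider "I \<inter> S = {0}" | "I \<inter> S = S" using S(2) by (auto simp: lie_simple_def)
  then show "I = W \<or> (\<forall>x\<in>I. \<forall>y\<in>W. lbr L x y = 0)"
  proof cases
    case 1
    have "lbr L x y = 0" if x: "x \<in> I" and y: "y \<in> W" for x y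
    proof -
      have "lbr L x u \<in> {0}" if u: "u \<in> ?U" for u
      proof -
        obtain \<phi> where \<phi>: "\<phi> \<in> Aut_over L \<Sigma>" "u \<in> \<phi> ` S" using u by blast
        have xL: "x \<in> lcarr L" and uL: "u \<in> lcarr L" using x IL u UL by auto
        have "lbr L x u \<in> \<phi> ` S" by (rule ideal_left[OF id[OF \<phi>(1)] xL \<phi>(2)])
        moreover have "lbr L x u \<in> I" by (rule ideal_right[OF I x uL])
        ultimately have "lbr L x u \<in> \<phi> ` (I \<inter> S)"
          using Aut_over_image_Int[OF \<phi>(1) IL(1) SL(1)] inv[OF \<phi>(1)] by simp
        then show ?thesis
          using 1 lie_iso_zero[OF lie_algebra_axioms Aut_over_iso[OF \<phi>(1)]] by simp
      qed
      then show ?thesis using linW[of "{0}", OF _ y] x IL(1) by auto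
    qed
    then show ?thesis by blast
  next
    case 2
    then have "\<phi> ` S \<subseteq> I" if "\<phi> \<in> Aut_over L \<Sigma>" for \<phi> using inv[OF that] by blast
    then have "W \<subseteq> I" unfolding W by (intro span_minimal[OF _ IL(2)]) blast
    then show ?thesis using IW by blast
  qed
qed

end

context lie_algebra
begin

lemma subalgebra_sum_subspace:
  assumes A: "lie_subalgebra A L" and B: "lie_subalgebra B L"
    and AB: "\<And>a b. a \<in> A \<Longrightarrow> b \<in> B \<Longrightarrow> lbr L a b \<in> B"
  shows "lie_subalgebra {a + b |a b. a \<in> A \<and> b \<in> B} L"
  unfolding lie_subalgebra_def
proof (intro conjI ballI)
  have sub: "subspace A" "subspace B" "\<And>x. x \<in> A \<Longrightarrow> x \<in> lcarr L" "\<And>x. x \<in> B \<Longrightarrow> x \<in> lcarr L"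
    and cl: "\<And>x y. x \<in> A \<Longrightarrow> y \<in> A \<Longrightarrow> lbr L x y \<in> A" "\<And>x y. x \<in> B \<Longrightarrow> y \<in> B \<Longrightarrow> lbr L x y \<in> B"
    using A B by (auto simp: lie_subalgebra_def)
  show "subspace {a + b |a b. a \<in> A \<and> b \<in> B}" by (rule subspace_sums[OF sub(1,2)])
  show "{a + b |a b. a \<in> A \<and> b \<in> B} \<subseteq> lcarr L" using sub(3,4) carrier_add by blast
  fix x y assume "x \<in> {a + b |a b. a \<in> A \<and> b \<in> B}" "y \<in> {a + b |a b. a \<in> A \<and> b \<in> B}"
  then obtain a b c d where x: "a \<in> A" "b \<in> B" "x = a + b" and y: "c \<in> A" "d \<in> B" "y = c + d"
    by blast
  note c = sub(3)[OF x(1)] sub(4)[OF x(2)] sub(3)[OF y(1)] sub(4)[OF y(2)]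
  have "lbr L b c = - lbr L c b" by (rule br_anti[OF c(3,2)])
  then have 1: "lbr L b c \<in> B" using subspace_neg[OF sub(2) AB[OF y(1) x(2)]] by simp
  have "lbr L x y = lbr L a c + (lbr L a d + (lbr L b c + lbr L b d))"
    unfolding x(3) y(3) by (simp add: br_add_left br_add_right carrier_add c)
  moreover have "lbr L a d + (lbr L b c + lbr L b d) \<in> B"
    using 1 AB[OF x(1) y(2)] cl(2)[OF x(2) y(2)] by (intro subspace_add[OF sub(2)])
  ultimately show "lbr L x y \<in> {a + b |a b. a \<in> A \<and> b \<in> B}" using cl(1)[OF x(1) y(1)] by blast
qed

lemma image_sum_set:
  assumes f: "lie_iso \<phi> L L" and "A \<subseteq> lcarr L" "B \<subseteq> lcarr L" "\<phi> ` A = A" "\<phi> ` B = B"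
  shows "\<phi> ` {a + b |a b. a \<in> A \<and> b \<in> B} = {a + b |a b. a \<in> A \<and> b \<in> B}"
proof -
  have "\<phi> ` {a + b |a b. a \<in> A \<and> b \<in> B} = {\<phi> a + \<phi> b |a b. a \<in> A \<and> b \<in> B}"
  proof (intro equalityI subsetI)
    fix x assume "x \<in> \<phi> ` {a + b |a b. a \<in> A \<and> b \<in> B}"
    then obtain a b where "a \<in> A" "b \<in> B" "x = \<phi> (a + b)" by blast
    moreover from this have "\<phi> (a + b) = \<phi> a + \<phi> b"
      using assms(2,3) by (intro lie_isoD(5)[OF f]) auto
    ultimately show "x \<in> {\<phi> a + \<phi> b |a b. a \<in> A \<and> b \<in> B}" by blast
  next
    fix x assume "x \<in> {\<phi> a + \<phi> b |a b. a \<in> A \<and> b \<in> B}"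
    then obtain a b where ab: "a \<in> A" "b \<in> B" "x = \<phi> a + \<phi> b" by blast
    moreover from this have "\<phi> (a + b) = \<phi> a + \<phi> b"
      using assms(2,3) by (intro lie_isoD(5)[OF f]) auto
    ultimately have "x = \<phi> (a + b)" by simp
    then show "x \<in> \<phi> ` {a + b |a b. a \<in> A \<and> b \<in> B}" using ab by blast
  qed
  also have "\<dots> = {a + b |a b. a \<in> \<phi> ` A \<and> b \<in> \<phi> ` B}" by blast
  finally show ?thesis by (simp only: assms(4,5))
qed

lemma subspace_center: "subspace (lie_center L)"
  by (rule subspaceI)
     (auto simp: lie_center_def carrier_add carrier_smul br_add_left br_smul_left)

end

lemma internal_sum_single:
  assumes "internal_sum V K W" "finite K" "i \<in> K" "x \<in> W i" "\<And>k. k \<in> K \<Longrightarrow> 0 \<in> W k"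
  shows "x \<in> V"
proof -
  have "(\<Sum>k\<in>K. if k = i then x else 0) = x" using assms(2,3) by simp
  then have "\<exists>y. x = (\<Sum>k\<in>K. y k) \<and> (\<forall>k\<in>K. y k \<in> W k)"
    using assms(4,5) by (intro exI[of _ "\<lambda>k. if k = i then x else 0"]) auto
  then show ?thesis using assms(1) unfolding internal_sum_def by blast
qed

section \<open>The decomposition into \<open>\<Sigma>\<close>-simple ideals\<close>

text \<open>The ideals \<open>g 1, \<dots>, g r\<close> are assumed to be \<open>\<Sigma>\<close>-simple and to give, together with the center, a direct
  decomposition.\<close>

locale reductive_Sigma = lie_algebra_Sigma L \<Sigma>
  for L :: "('k::real_normed_field, 'v::euclidean_space) lie_alg" and \<Sigma> +
  fixes r :: nat and g :: "nat \<Rightarrow> 'v set"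
  assumes g_in: "i \<in> {1..r} \<Longrightarrow> g i \<in> Sigma_simple_ideals L \<Sigma>"
    and carrier_sum: "internal_sum2 (lcarr L) (lie_center L) (lie_derived L)"
    and derived_sum: "internal_sum (lie_derived L) {1..r} g"
begin

lemma g_ideal: "i \<in> {1..r} \<Longrightarrow> lie_ideal (g i) L"
  and g_nonzero: "i \<in> {1..r} \<Longrightarrow> g i \<noteq> {0}"
  and g_invariant: "i \<in> {1..r} \<Longrightarrow> \<phi> \<in> Aut_over L \<Sigma> \<Longrightarrow> \<phi> ` g i = g i"
  using Sigma_simple_ideals(1-3)[OF g_in] by auto

lemma g_subspace: "i \<in> {1..r} \<Longrightarrow> subspace (g i)"
  and g_carrier: "i \<in> {1..r} \<Longrightarrow> g i \<subseteq> lcarr L"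
  using g_ideal by (auto simp: lie_ideal_def)

lemma g_zero: "i \<in> {1..r} \<Longrightarrow> 0 \<in> g i"
  using subspace_0[OF g_subspace] .

lemma g_derived: "i \<in> {1..r} \<Longrightarrow> g i \<subseteq> lie_derived L"
  using internal_sum_single[OF derived_sum] g_zero by blast

lemma derived_decomposition:
  assumes "x \<in> lie_derived L"
  obtains y where "\<And>k. k \<in> {1..r} \<Longrightarrow> y k \<in> g k" "x = (\<Sum>k\<in>{1..r}. y k)"
  using assms derived_sum unfolding internal_sum_def by blast

lemma independent:
  assumes "\<And>k. k \<in> {1..r} \<Longrightarrow> y k \<in> g k" "(\<Sum>k\<in>{1..r}. y k) = 0" "k \<in> {1..r}"
  shows "y k = 0"
  using assms derived_sum unfolding internal_sum_def by blast

lemma carrier_decomposition: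
  assumes "x \<in> lcarr L"
  obtains z y where "z \<in> lie_center L" "\<And>k. k \<in> {1..r} \<Longrightarrow> y k \<in> g k" "x = z + (\<Sum>k\<in>{1..r}. y k)"
proof -
  obtain z d where z: "z \<in> lie_center L" "d \<in> lie_derived L" "x = z + d"
    using assms carrier_sum unfolding internal_sum2_def by blast
  obtain y where "\<And>k. k \<in> {1..r} \<Longrightarrow> y k \<in> g k" "d = (\<Sum>k\<in>{1..r}. y k)"
    by (rule derived_decomposition[OF z(2)]) (rule that)
  then show ?thesis using z that[of z y] by simp
qed

lemma carrier_subset:
  assumes V: "subspace V" "lie_center L \<subseteq> V" "\<And>k. k \<in> {1..r} \<Longrightarrow> g k \<subseteq> V"
  shows "lcarr L \<subseteq> V"
proof
  fix x assume "x \<in> lcarr L"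
  then obtain z y where x: "z \<in> lie_center L" "\<And>k. k \<in> {1..r} \<Longrightarrow> y k \<in> g k" "x = z + (\<Sum>k\<in>{1..r}. y k)"
    by (rule carrier_decomposition) (rule that)
  have "(\<Sum>k\<in>{1..r}. y k) \<in> V" by (rule subspace_sum[OF V(1)]) (use x(2) V(3) in blast)
  then show "x \<in> V" unfolding x(3) using x(1) V(2) subspace_add[OF V(1)] by blast
qed

lemma g_disjoint:
  assumes "i \<in> {1..r}" "j \<in> {1..r}" "i \<noteq> j" "x \<in> g i" "x \<in> g j"
  shows "x = 0"
proof -
  let ?y = "\<lambda>k. if k = i then x else if k = j then - x else 0"
  have "(\<Sum>k\<in>{1..r}. ?y k) = (\<Sum>k\<in>{1..r}. (if k = i then x else 0) + (if k = j then - x else 0))"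
    using assms(3) by (intro sum.cong) auto
  also have "\<dots> = 0" using assms(1,2) by (simp add: sum.distrib)
  finally have "(\<Sum>k\<in>{1..r}. ?y k) = 0" .
  moreover have "?y k \<in> g k" if "k \<in> {1..r}" for k
    using assms that g_zero[OF that] subspace_neg[OF g_subspace[OF assms(2)]] by auto
  ultimately have "?y i = 0" by (intro independent[of ?y i]) (use assms(1) in auto)
  then show ?thesis by simp
qed

lemma g_commute:
  assumes "i \<in> {1..r}" "j \<in> {1..r}" "i \<noteq> j" "x \<in> g i" "y \<in> g j"
  shows "lbr L x y = 0"
proof (rule g_disjoint[OF assms(1-3)])
  have "x \<in> lcarr L" "y \<in> lcarr L" using assms g_carrier by auto
  then show "lbr L x y \<in> g i" "lbr L x y \<in> g j"
    using ideal_right[OF g_ideal[OF assms(1)] assms(4)] g_ideal[OF assms(2)] assms(5)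
    by (auto simp: lie_ideal_def)
qed

lemma g_center:
  assumes i: "i \<in> {1..r}" and x: "x \<in> g i" and c: "\<And>y. y \<in> g i \<Longrightarrow> lbr L x y = 0"
  shows "x = 0"
proof -
  have xL: "x \<in> lcarr L" using i x g_carrier by blast
  have "lcarr L \<subseteq> {y \<in> lcarr L. lbr L x y \<in> {0}}"
  proof (rule carrier_subset[OF subspace_br_preimage[OF _ xL]])
    show "subspace {0}" by (rule subspace_single_0)
    show "lie_center L \<subseteq> {y \<in> lcarr L. lbr L x y \<in> {0}}"
      using xL br_anti[OF _ xL] by (auto simp: lie_center_def)
    show "g k \<subseteq> {y \<in> lcarr L. lbr L x y \<in> {0}}" if "k \<in> {1..r}" for k
      using c g_commute[OF i that _ x] g_carrier[OF that] by (cases "k = i") auto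
  qed
  then have "x \<in> lie_center L" using xL by (auto simp: lie_center_def)
  moreover have "x \<in> lie_derived L" using g_derived[OF i] x by blast
  ultimately show ?thesis using carrier_sum unfolding internal_sum2_def by blast
qed

lemma g_simple:
  assumes i: "i \<in> {1..r}" and I: "lie_ideal I L" "I \<subseteq> g i"
    and inv: "\<And>\<phi>. \<phi> \<in> Aut_over L \<Sigma> \<Longrightarrow> \<phi> ` I = I"
  shows "I = {0} \<or> I = g i"
proof (cases "I = g i")
  case False
  then have "\<forall>x\<in>I. \<forall>y\<in>g i. lbr L x y = 0"
    using Sigma_simple_ideals(4)[OF g_in[OF i] I(1) inv I(2)] by blast
  then have "\<forall>x\<in>I. x = 0" using g_center[OF i] I(2) by blast
  moreover have "0 \<in> I" using I(1) subspace_0 by (auto simp: lie_ideal_def)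
  ultimately show ?thesis by blast
qed simp

lemma g_inner:
  assumes i: "i \<in> {1..r}"
  shows "inner_ideal (g i) L"
proof -
  let ?V = "{x \<in> lcarr L. \<exists>a\<in>g i. \<forall>y\<in>g i. lbr L x y = lbr L a y}"
  have gL: "\<And>x. x \<in> g i \<Longrightarrow> x \<in> lcarr L" using g_carrier[OF i] by blast
  have "lcarr L \<subseteq> ?V"
  proof (rule carrier_subset)
    show "subspace ?V"
    proof (rule subspaceI)
      show "0 \<in> ?V" using g_zero[OF i] by auto
      fix x y c assume "x \<in> ?V"
      then obtain a where x: "x \<in> lcarr L" "a \<in> g i" "\<And>u. u \<in> g i \<Longrightarrow> lbr L x u = lbr L a u"
        by blast
      have "\<forall>u\<in>g i. lbr L (lsmul L c x) u = lbr L (lsmul L c a) u"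
        using x gL by (simp add: br_smul_left)
      then show "lsmul L c x \<in> ?V"
        using x(1) carrier_smul subspace_scale[OF g_subspace[OF i] x(2)] by blast
      assume "y \<in> ?V"
      then obtain b where y: "y \<in> lcarr L" "b \<in> g i" "\<And>u. u \<in> g i \<Longrightarrow> lbr L y u = lbr L b u"
        by blast
      have "\<forall>u\<in>g i. lbr L (x + y) u = lbr L (a + b) u"
        using x y gL by (simp add: br_add_left)
      then show "x + y \<in> ?V"
        using x(1) y(1) carrier_add subspace_add[OF g_subspace[OF i] x(2) y(2)] by blast
    qed
    have "\<forall>u\<in>g i. lbr L z u = lbr L 0 u" if "z \<in> lie_center L" for z
      using that gL by (auto simp: lie_center_def)
    then show "lie_center L \<subseteq> ?V" using g_zero[OF i] by (auto simp: lie_center_def)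
    show "g k \<subseteq> ?V" if k: "k \<in> {1..r}" for k
    proof (cases "k = i")
      case False
      then have "\<forall>u\<in>g i. lbr L x u = lbr L 0 u" if "x \<in> g k" for x
        using that g_commute[OF k i _ that] gL by simp
      then show ?thesis using g_zero[OF i] g_carrier[OF k] by blast
    qed (use gL in blast)
  qed
  then show ?thesis unfolding inner_ideal_def using g_ideal[OF i] by blast
qed

end

section \<open>Quasiprimitive subalgebras\<close>

text \<open>The group \<open>Aut_over_stab L \<Sigma> m\<close>, which maps onto \<open>\<Sigma>\<close>, is called the stabilizer here. Every
  stabilizer-invariant subalgebra above \<open>m\<close> is \<open>m\<close> or the whole algebra; the proofs below apply this to
  \<open>m + g i\<close>, to \<open>m + H\<close> for subalgebras \<open>H\<close> of \<open>g i\<close>, and to the normalizer of \<open>m\<close>.\<close>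

locale quasiprimitive = reductive_Sigma L \<Sigma> r g
  for L :: "('k::real_normed_field, 'v::euclidean_space) lie_alg" and \<Sigma> r g +
  fixes m :: "'v set"
  assumes quasi: "Sigma_quasiprimitive L \<Sigma> m" and center_m: "lie_center L \<subseteq> m"
begin

lemma m_subalgebra: "lie_subalgebra m L" and m_proper: "m \<noteq> lcarr L"
  and m_invariant: "Sigma_invariant \<Sigma> m"
  using quasi by (auto simp: Sigma_quasiprimitive_def)

lemma m_subspace: "subspace m" and m_carrier: "m \<subseteq> lcarr L"
  and m_br: "x \<in> m \<Longrightarrow> y \<in> m \<Longrightarrow> lbr L x y \<in> m"
  using m_subalgebra by (auto simp: lie_subalgebra_def)

lemma m_cases:
  assumes "lie_subalgebra H L" "m \<subseteq> H" "\<And>\<phi>. \<phi> \<in> Aut_over_stab L \<Sigma> m \<Longrightarrow> \<phi> ` H = H"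
  shows "H = m \<or> H = lcarr L"
  using quasi assms unfolding Sigma_quasiprimitive_def by blast

lemma stab_Aut_over: "\<phi> \<in> Aut_over_stab L \<Sigma> m \<Longrightarrow> \<phi> \<in> Aut_over L \<Sigma>"
  and stab_m: "\<phi> \<in> Aut_over_stab L \<Sigma> m \<Longrightarrow> \<phi> ` m = m"
  by (auto simp: Aut_over_stab_def)

lemma ideal_invariant_if_stab:
  assumes "lie_ideal I L" "\<And>\<phi>. \<phi> \<in> Aut_over_stab L \<Sigma> m \<Longrightarrow> \<phi> ` I = I" "\<phi> \<in> Aut_over L \<Sigma>"
  shows "\<phi> ` I = I"
  using invariant_ideal[OF assms(1) Sigma_invariant_if_stab[OF m_invariant assms(2)] assms(3)] .

lemma Sigma_rep_m:
  assumes "\<sigma> \<in> \<Sigma>"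
  shows "\<exists>\<phi>\<in>Aut_over_stab L \<Sigma> m. \<sigma> = lie_Inn L #>\<^bsub>lie_Aut L\<^esub> \<phi>"
  by (rule Sigma_rep[OF assms m_invariant]) blast

lemma stab_Int_g:
  assumes "i \<in> {1..r}" "\<phi> \<in> Aut_over_stab L \<Sigma> m"
  shows "\<phi> ` (m \<inter> g i) = m \<inter> g i"
  using Aut_over_image_Int[OF stab_Aut_over[OF assms(2)] m_carrier g_carrier[OF assms(1)]]
    g_invariant[OF assms(1) stab_Aut_over[OF assms(2)]] stab_m[OF assms(2)] by simp

text \<open>If \<open>g i\<close> is not contained in \<open>m\<close>, then \<open>m + g i\<close> is the whole algebra.\<close>

lemma supplement:
  assumes i: "i \<in> {1..r}" "\<not> g i \<subseteq> m" and x: "x \<in> lcarr L"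
  obtains a b where "a \<in> m" "b \<in> g i" "x = a + b"
proof -
  let ?H = "{a + b |a b. a \<in> m \<and> b \<in> g i}"
  have "lie_subalgebra ?H L"
    using g_ideal[OF i(1)] m_carrier
    by (intro subalgebra_sum_subspace m_subalgebra lie_ideal_imp_subalgebra) (auto simp: lie_ideal_def)
  moreover have "m \<subseteq> ?H" using g_zero[OF i(1)] by force
  moreover have "\<phi> ` ?H = ?H" if "\<phi> \<in> Aut_over_stab L \<Sigma> m" for \<phi>
    using that by (intro image_sum_set Aut_over_iso m_carrier g_carrier g_invariant i
      stab_Aut_over stab_m)
  ultimately have "?H = m \<or> ?H = lcarr L" by (rule m_cases)
  moreover have "g i \<subseteq> ?H" using subspace_0[OF m_subspace] by force
  ultimately have "?H = lcarr L" using i(2) by blast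
  then have "x \<in> ?H" using x by simp
  then show ?thesis using that by blast
qed

lemma ex_not_subset: "\<exists>i\<in>{1..r}. \<not> g i \<subseteq> m"
  using carrier_subset[OF m_subspace center_m] m_proper m_carrier by blast

lemma ideal_Int_g:
  assumes i: "i \<in> {1..r}" "\<not> g i \<subseteq> m" and id: "lie_ideal (m \<inter> g i) L"
  shows "m \<inter> g i = {0}"
  using g_simple[OF i(1) id _ ideal_invariant_if_stab[OF id stab_Int_g[OF i(1)]]] i(2) by blast

text \<open>If \<open>m\<close> contains neither \<open>g i\<close> nor \<open>g j\<close>, then \<open>m \<inter> g i\<close> is normalized by \<open>m\<close> and centralized by the
  supplement \<open>g j\<close>, hence an ideal.\<close>

lemma Int_g_zero:
  assumes i: "i \<in> {1..r}" "\<not> g i \<subseteq> m" and j: "j \<in> {1..r}" "\<not> g j \<subseteq> m" and "i \<noteq> j"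
  shows "m \<inter> g i = {0}"
proof (rule ideal_Int_g[OF i])
  show "lie_ideal (m \<inter> g i) L"
    unfolding lie_ideal_def
  proof (intro conjI ballI)
    show "subspace (m \<inter> g i)" by (rule subspace_inter[OF m_subspace g_subspace[OF i(1)]])
    show "m \<inter> g i \<subseteq> lcarr L" using m_carrier by blast
    fix x y assume x: "x \<in> lcarr L" and y: "y \<in> m \<inter> g i"
    obtain a b where ab: "a \<in> m" "b \<in> g j" "x = a + b" by (rule supplement[OF j x]) (rule that)
    have "lbr L x y = lbr L a y + lbr L b y"
      unfolding ab(3) using ab y m_carrier g_carrier[OF j(1)] by (intro br_add_left) auto
    also have "lbr L b y = 0" using g_commute[OF j(1) i(1)] assms(5) ab y by auto
    finally have "lbr L x y \<in> m" using m_br ab(1) y by simp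
    moreover have "lbr L x y \<in> g i" using g_ideal[OF i(1)] x y by (auto simp: lie_ideal_def)
    ultimately show "lbr L x y \<in> m \<inter> g i" by blast
  qed
qed

subsection \<open>The simple type\<close>

lemma component_in_m:
  assumes i: "i \<in> {1..r}" and others: "\<And>k. k \<in> {1..r} \<Longrightarrow> k \<noteq> i \<Longrightarrow> g k \<subseteq> m"
    and y: "\<And>k. k \<in> {1..r} \<Longrightarrow> y k \<in> g k" and z: "z \<in> lie_center L"
    and x: "z + (\<Sum>k\<in>{1..r}. y k) \<in> m"
  shows "y i \<in> m"
proof -
  have "(\<Sum>k\<in>{1..r}. y k) = y i + (\<Sum>k\<in>{1..r} - {i}. y k)" by (rule sum.remove) (use i in auto)
  then have "y i = z + (\<Sum>k\<in>{1..r}. y k) - z - (\<Sum>k\<in>{1..r} - {i}. y k)" by simp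
  also have "\<dots> \<in> m"
    using z center_m y others
    by (intro subspace_diff[OF m_subspace] subspace_sum[OF m_subspace] x) auto
  finally show ?thesis .
qed

text \<open>For a subalgebra \<open>H\<close> between \<open>m \<inter> g i\<close> and \<open>g i\<close> that is invariant as in the definition of
  quasiprimitivity, \<open>m + H\<close> is a stabilizer-invariant subalgebra: an element of \<open>m\<close> acts on \<open>H\<close> as its
  component in \<open>g i\<close>, which lies in \<open>m \<inter> g i\<close>.\<close>

lemma primitive_component:
  assumes i: "i \<in> {1..r}" "\<not> g i \<subseteq> m"
    and others: "\<And>k. k \<in> {1..r} \<Longrightarrow> k \<noteq> i \<Longrightarrow> g k \<subseteq> m"
  shows "Sigma_primitive (on_carrier L (g i)) (Out_restrict L (g i) ` \<Sigma>) (m \<inter> g i)"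
proof -
  let ?M = "on_carrier L (g i)" and ?S = "Out_restrict L (g i) ` \<Sigma>" and ?mi = "m \<inter> g i"
  have sub: "lie_subalgebra (g i) L" using g_ideal[OF i(1)] by (rule lie_ideal_imp_subalgebra)
  interpret M: lie_algebra ?M by (rule lie_algebra_on_carrier[OF sub])
  interpret AM: group "lie_Aut ?M" by (rule M.group_Aut)
  have R: "restrict \<phi> (g i) \<in> carrier (lie_Aut ?M)"
    "Out_restrict L (g i) (lie_Inn L #>\<^bsub>lie_Aut L\<^esub> \<phi>) = lie_Inn ?M #>\<^bsub>lie_Aut ?M\<^esub> restrict \<phi> (g i)"
    if "\<phi> \<in> Aut_over L \<Sigma>" for \<phi>
    using restrict_Aut[OF Aut_over_Aut[OF that] sub g_invariant[OF i(1) that]]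
      Out_restrict_coset[OF g_inner[OF i(1)] Aut_over_Aut[OF that] g_invariant[OF i(1) that]] by auto
  have im: "restrict \<phi> (g i) ` ?mi = ?mi" if \<phi>: "\<phi> \<in> Aut_over_stab L \<Sigma> m" for \<phi>
  proof -
    have "restrict \<phi> (g i) ` ?mi = \<phi> ` ?mi" by (intro image_cong) auto
    then show ?thesis by (simp only: stab_Int_g[OF i(1) \<phi>])
  qed
  have stab: "restrict \<phi> (g i) \<in> Aut_over_stab ?M ?S ?mi" if \<phi>: "\<phi> \<in> Aut_over_stab L \<Sigma> m" for \<phi>
  proof -
    note G = stab_Aut_over[OF \<phi>]
    have "lie_Inn L #>\<^bsub>lie_Aut L\<^esub> \<phi> \<in> \<Sigma>" using G by (simp add: Aut_over_def)
    then have "lie_Inn ?M #>\<^bsub>lie_Aut ?M\<^esub> restrict \<phi> (g i) \<in> ?S" unfolding R(2)[OF G, symmetric] by blast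
    then show ?thesis using R(1)[OF G] im[OF \<phi>] by (simp only: Aut_over_stab_def Aut_over_def mem_Collect_eq)
  qed
  have inv: "Sigma_invariant ?S ?mi"
    unfolding Sigma_invariant_def
  proof
    fix \<sigma>' assume "\<sigma>' \<in> ?S"
    then obtain \<sigma> where \<sigma>: "\<sigma> \<in> \<Sigma>" "\<sigma>' = Out_restrict L (g i) \<sigma>" by blast
    obtain \<phi> where \<phi>: "\<phi> \<in> Aut_over_stab L \<Sigma> m" "\<sigma> = lie_Inn L #>\<^bsub>lie_Aut L\<^esub> \<phi>"
      using Sigma_rep_m[OF \<sigma>(1)] by blast
    have "restrict \<phi> (g i) \<in> \<sigma>'"
      unfolding \<sigma>(2) \<phi>(2) R(2)[OF stab_Aut_over[OF \<phi>(1)]]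
      by (rule AM.rcos_self[OF R(1)[OF stab_Aut_over[OF \<phi>(1)]] M.subgroup_Inn])
    then show "\<exists>\<psi>\<in>\<sigma>'. \<psi> ` ?mi = ?mi" using im[OF \<phi>(1)] by blast
  qed
  have mi_sub: "lie_subalgebra ?mi ?M"
    using subspace_inter[OF m_subspace g_subspace[OF i(1)]] m_br sub by (auto simp: lie_subalgebra_def)
  have max: "H = ?mi \<or> H = g i"
    if H: "lie_subalgebra H ?M" "?mi \<subseteq> H" "\<And>\<phi>. \<phi> \<in> Aut_over_stab ?M ?S ?mi \<Longrightarrow> \<phi> ` H = H" for H
  proof -
    have Hg: "H \<subseteq> g i" and HL: "lie_subalgebra H L"
      using H(1) g_carrier[OF i(1)] by (auto simp: lie_subalgebra_def)
    then have HC: "H \<subseteq> lcarr L" "subspace H" by (auto simp: lie_subalgebra_def)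
    let ?N = "{a + b |a b. a \<in> m \<and> b \<in> H}"
    have br: "lbr L a b \<in> H" if ab: "a \<in> m" "b \<in> H" for a b
    proof -
      have "a \<in> lcarr L" using ab m_carrier by blast
      then obtain z y where a: "z \<in> lie_center L" "\<And>k. k \<in> {1..r} \<Longrightarrow> y k \<in> g k"
        "a = z + (\<Sum>k\<in>{1..r}. y k)" by (rule carrier_decomposition) (rule that)
      have yi: "y i \<in> H"
      proof -
        have "y i \<in> m"
          by (rule component_in_m[OF i(1) others a(2,1)]) (use ab(1) a(3) in simp_all)
        then show ?thesis using a(2)[OF i(1)] H(2) by blast
      qed
      have bL: "b \<in> lcarr L" "b \<in> g i" using ab(2) HC Hg by auto
      have "a - y i = z + (\<Sum>k\<in>{1..r} - {i}. y k)"
        unfolding a(3) using sum.remove[OF _ i(1), of y] by simp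
      also have "\<dots> \<in> {x \<in> lcarr L. lbr L b x \<in> {0}}"
      proof -
        note V = subspace_br_preimage[OF subspace_single_0 bL(1)]
        have "z \<in> {x \<in> lcarr L. lbr L b x \<in> {0}}"
          using a(1) bL br_anti[OF _ bL(1)] by (auto simp: lie_center_def)
        moreover have "(\<Sum>k\<in>{1..r} - {i}. y k) \<in> {x \<in> lcarr L. lbr L b x \<in> {0}}"
          using g_commute[OF i(1) _ _ bL(2) a(2)] a(2) g_carrier by (intro subspace_sum[OF V]) blast
        ultimately show ?thesis by (rule subspace_add[OF V])
      qed
      finally have 0: "a - y i \<in> lcarr L" "lbr L b (a - y i) = 0" by auto
      then have "lbr L (a - y i) b = 0" using br_anti[OF bL(1) 0(1)] by simp
      moreover have "lbr L (a - y i + y i) b = lbr L (a - y i) b + lbr L (y i) b"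
        using 0(1) bL(1) yi HC by (intro br_add_left) auto
      ultimately have "lbr L a b = lbr L (y i) b" by simp
      also have "\<dots> \<in> H" using yi ab(2) HL by (simp add: lie_subalgebra_def)
      finally show ?thesis .
    qed
    have "lie_subalgebra ?N L" by (rule subalgebra_sum_subspace[OF m_subalgebra HL br])
    moreover have "m \<subseteq> ?N" using subspace_0[OF HC(2)] by force
    moreover have "\<phi> ` ?N = ?N" if \<phi>: "\<phi> \<in> Aut_over_stab L \<Sigma> m" for \<phi>
    proof (rule image_sum_set[OF Aut_over_iso[OF stab_Aut_over[OF \<phi>]] m_carrier HC(1) stab_m[OF \<phi>]])
      have "restrict \<phi> (g i) ` H = H" using H(3) stab[OF \<phi>] by blast
      moreover have "restrict \<phi> (g i) ` H = \<phi> ` H" using Hg by (intro image_cong) auto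
      ultimately show "\<phi> ` H = H" by simp
    qed
    ultimately have "?N = m \<or> ?N = lcarr L" by (rule m_cases)
    then show ?thesis
    proof
      assume "?N = m"
      moreover have "b \<in> ?N" if "b \<in> H" for b
        using subspace_0[OF m_subspace] that by (metis (mono_tags, lifting) add_0 mem_Collect_eq)
      ultimately have "H \<subseteq> m" by blast
      then show ?thesis using H(2) Hg by blast
    next
      assume N: "?N = lcarr L"
      have "x \<in> H" if x: "x \<in> g i" for x
      proof -
        have "x \<in> ?N" using x g_carrier[OF i(1)] N by blast
        then obtain a b where ab: "a \<in> m" "b \<in> H" "x = a + b" by blast
        have "a = x - b" using ab(3) by simp
        then have "a \<in> g i" using subspace_diff[OF g_subspace[OF i(1)] x] ab(2) Hg by blast
        then have "a \<in> H" using ab(1) H(2) by blast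
        then show ?thesis unfolding ab(3) using ab(2) by (rule subspace_add[OF HC(2)])
      qed
      then show ?thesis using Hg by blast
    qed
  qed
  have prim: "J = {0} \<or> J = g i" if J: "lie_ideal J ?M" "Sigma_invariant ?S J" for J
  proof (rule g_simple[OF i(1) ideal_of_inner_ideal[OF g_inner[OF i(1)] J(1)]])
    show Jg: "J \<subseteq> g i" using J(1) by (simp add: lie_ideal_def)
    fix \<phi> assume \<phi>: "\<phi> \<in> Aut_over L \<Sigma>"
    then have "lie_Inn L #>\<^bsub>lie_Aut L\<^esub> \<phi> \<in> \<Sigma>" by (simp add: Aut_over_def)
    then have "lie_Inn ?M #>\<^bsub>lie_Aut ?M\<^esub> restrict \<phi> (g i) \<in> ?S" unfolding R(2)[OF \<phi>, symmetric] by blast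
    then obtain \<psi> where "\<psi> \<in> lie_Inn ?M #>\<^bsub>lie_Aut ?M\<^esub> restrict \<phi> (g i)" "\<psi> ` J = J"
      using bspec[OF J(2)[unfolded Sigma_invariant_def]] by blast
    then have "restrict \<phi> (g i) ` J = J" using M.Inn_coset_ideal[OF R(1)[OF \<phi>] _ J(1)] by metis
    moreover have "restrict \<phi> (g i) ` J = \<phi> ` J" using Jg by (intro image_cong) auto
    ultimately show "\<phi> ` J = J" by simp
  qed
  show ?thesis
    unfolding Sigma_primitive_def Sigma_quasiprimitive_def
    using mi_sub i(2) inv max prim by auto
qed

lemma simple_type:
  assumes i: "i \<in> {1..r}" "\<not> g i \<subseteq> m"
    and others: "\<And>k. k \<in> {1..r} \<Longrightarrow> k \<noteq> i \<Longrightarrow> g k \<subseteq> m"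
  shows "Sigma_simple_type L \<Sigma> r g (m \<inter> lie_derived L) i (m \<inter> g i)"
proof -
  let ?W = "g(i := m \<inter> g i)"
  have Wg: "?W k \<subseteq> g k" for k by simp
  have "m \<inter> lie_derived L = {\<Sum>k\<in>{1..r}. x k |x. \<forall>k\<in>{1..r}. x k \<in> ?W k}"
  proof (intro equalityI subsetI)
    fix x assume x: "x \<in> m \<inter> lie_derived L"
    then obtain y where y: "\<And>k. k \<in> {1..r} \<Longrightarrow> y k \<in> g k" "x = (\<Sum>k\<in>{1..r}. y k)"
      using derived_decomposition by (metis IntD2)
    have "0 \<in> lie_center L" by (rule subspace_0[OF subspace_center])
    then have "y i \<in> m" using component_in_m[OF i(1) others y(1), of 0] x y(2) by simp
    then have "\<forall>k\<in>{1..r}. y k \<in> ?W k" using y(1) i(1) by simp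
    then show "x \<in> {\<Sum>k\<in>{1..r}. x k |x. \<forall>k\<in>{1..r}. x k \<in> ?W k}" using y(2) by blast
  next
    fix x assume "x \<in> {\<Sum>k\<in>{1..r}. x k |x. \<forall>k\<in>{1..r}. x k \<in> ?W k}"
    then obtain y where y: "\<forall>k\<in>{1..r}. y k \<in> ?W k" "x = (\<Sum>k\<in>{1..r}. y k)" by blast
    have "y k \<in> m" if "k \<in> {1..r}" for k
      using bspec[OF y(1) that] others[OF that] by (auto split: if_splits)
    then have "x \<in> m" unfolding y(2) by (intro subspace_sum[OF m_subspace])
    moreover have "\<forall>k\<in>{1..r}. y k \<in> g k" using y(1) Wg by blast
    then have "x \<in> lie_derived L" using derived_sum y(2) unfolding internal_sum_def by blast
    ultimately show "x \<in> m \<inter> lie_derived L" by blast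
  qed
  moreover have "\<forall>k\<in>{1..r}. y k = 0"
    if "\<forall>k\<in>{1..r}. y k \<in> ?W k" "(\<Sum>k\<in>{1..r}. y k) = 0" for y
    using independent[of y] that Wg by blast
  ultimately have "internal_sum (m \<inter> lie_derived L) {1..r} ?W" unfolding internal_sum_def by blast
  then show ?thesis
    unfolding Sigma_simple_type_def using i primitive_component[OF i others] by blast
qed

end

context quasiprimitive
begin

subsection \<open>The diagonal type\<close>

context
  fixes i j :: nat
  assumes i: "i \<in> {1..r}" "\<not> g i \<subseteq> m" and j: "j \<in> {1..r}" "\<not> g j \<subseteq> m" and ij: "i \<noteq> j"
begin

text \<open>By \<open>partner\<close> and \<open>partner_unique\<close>, used also with \<open>i\<close> and \<open>j\<close> exchanged, the intersection of \<open>m\<close>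
  with \<open>g i + g j\<close> is the graph of a bijection between \<open>g j\<close> and \<open>g i\<close>.\<close>

lemma partner:
  assumes "a \<in> g i"
  obtains b where "b \<in> g j" "a + b \<in> m"
proof -
  obtain c b where "c \<in> m" "b \<in> g j" "a = c + b"
    by (rule supplement[OF j]) (use assms g_carrier[OF i(1)] that in blast)+
  then show ?thesis
    using that[of "- b"] subspace_neg[OF g_subspace[OF j(1)]] by simp
qed

text \<open>For a third \<open>g k\<close> not contained in \<open>m\<close>, the intersection of \<open>m\<close> with \<open>g i + g j\<close> would be normalized by
  \<open>m\<close> and centralized by the supplement \<open>g k\<close>. Its brackets with \<open>g i\<close> would then lie in
  \<open>m \<inter> g i = {0}\<close>, although it projects onto \<open>g i\<close>.\<close>

lemma others_in_m:
  assumes k: "k \<in> {1..r}" "k \<noteq> i" "k \<noteq> j"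
  shows "g k \<subseteq> m"
proof (rule ccontr)
  assume nk: "\<not> g k \<subseteq> m"
  have "a = 0" if a: "a \<in> g i" for a
  proof (rule g_center[OF i(1) a])
    fix x assume x: "x \<in> g i"
    obtain b where b: "b \<in> g j" "a + b \<in> m" by (rule partner[OF a]) (rule that)
    have L: "a \<in> lcarr L" "b \<in> lcarr L" "x \<in> lcarr L"
      using a b(1) x g_carrier[OF i(1)] g_carrier[OF j(1)] by auto
    obtain c d where cd: "c \<in> m" "d \<in> g k" "x = c + d"
      by (rule supplement[OF k(1) nk L(3)]) (rule that)
    have L': "c \<in> lcarr L" "d \<in> lcarr L" using cd m_carrier g_carrier[OF k(1)] by auto
    have "lbr L x (a + b) = lbr L c (a + b) + (lbr L d a + lbr L d b)"
      unfolding cd(3) using L L' by (simp add: br_add_left br_add_right carrier_add)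
    also have "lbr L d a = 0" using g_commute[OF k(1) i(1) k(2) cd(2) a] .
    also have "lbr L d b = 0" using g_commute[OF k(1) j(1) k(3) cd(2) b(1)] .
    finally have "lbr L x (a + b) \<in> m" using m_br[OF cd(1) b(2)] by simp
    moreover have "lbr L x (a + b) = lbr L x a"
      using L g_commute[OF i(1) j(1) ij x b(1)] by (simp add: br_add_right)
    moreover have "lbr L x a \<in> g i" by (rule ideal_right[OF g_ideal[OF i(1)] x L(1)])
    ultimately have "lbr L x a = 0" using Int_g_zero[OF i j ij] by auto
    then show "lbr L a x = 0" using br_anti[OF L(3) L(1)] by simp
  qed
  then show False using g_nonzero[OF i(1)] g_zero[OF i(1)] by blast
qed

lemma partner_unique:
  assumes "a \<in> g i" "a' \<in> g i" "a + b \<in> m" "a' + b \<in> m"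
  shows "a = a'"
proof -
  have "a - a' \<in> m" using subspace_diff[OF m_subspace assms(3,4)] by simp
  moreover have "a - a' \<in> g i" by (rule subspace_diff[OF g_subspace[OF i(1)] assms(1,2)])
  ultimately have "a - a' \<in> {0}" unfolding Int_g_zero[OF i j ij, symmetric] by (rule IntI)
  then show ?thesis by simp
qed

lemma not_ideal: "\<not> lie_ideal m L"
proof
  assume id: "lie_ideal m L"
  have "a = 0" if a: "a \<in> g i" for a
  proof (rule g_center[OF i(1) a])
    fix x assume x: "x \<in> g i"
    obtain b where b: "b \<in> g j" "a + b \<in> m" by (rule partner[OF a]) (rule that)
    have L: "a \<in> lcarr L" "b \<in> lcarr L" "x \<in> lcarr L"
      using a b(1) x g_carrier[OF i(1)] g_carrier[OF j(1)] by auto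
    have "lbr L x (a + b) \<in> m" by (rule ideal_left[OF id L(3) b(2)])
    moreover have "lbr L x (a + b) = lbr L x a"
      using L g_commute[OF i(1) j(1) ij x b(1)] by (simp add: br_add_right)
    moreover have "lbr L x a \<in> g i" by (rule ideal_right[OF g_ideal[OF i(1)] x L(1)])
    ultimately have "lbr L x a = 0" using Int_g_zero[OF i j ij] by auto
    then show "lbr L a x = 0" using br_anti[OF L(3) L(1)] by simp
  qed
  then show False using g_nonzero[OF i(1)] g_zero[OF i(1)] by blast
qed

end

text \<open>The graph is that of an isomorphism \<open>h\<close>. No sign is needed: \<open>Sigma_diagonal\<close> encodes the
  element \<open>a + b\<close> as a pair, so the diagonal consists of the \<open>h b + b\<close>.\<close>

lemma diagonal_isomorphism:
  assumes i: "i \<in> {1..r}" "\<not> g i \<subseteq> m" and j: "j \<in> {1..r}" "\<not> g j \<subseteq> m" and ij: "i \<noteq> j"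
  obtains h where "lie_iso h (on_carrier L (g j)) (on_carrier L (g i))"
    "\<And>a b. a \<in> g i \<Longrightarrow> b \<in> g j \<Longrightarrow> a + b \<in> m \<longleftrightarrow> a = h b"
proof -
  note ji = ij[symmetric]
  have ex: "\<exists>a. a \<in> g i \<and> a + b \<in> m" if "b \<in> g j" for b
    using partner[OF j i ji that] by (metis add.commute)
  define h where "h = (\<lambda>b. SOME a. a \<in> g i \<and> a + b \<in> m)"
  have h: "h b \<in> g i" "h b + b \<in> m" if "b \<in> g j" for b
    using someI_ex[OF ex[OF that]] by (auto simp: h_def)
  have hI: "a = h b" if "a \<in> g i" "b \<in> g j" "a + b \<in> m" for a b
    using partner_unique[OF i j ij that(1) h(1)[OF that(2)] that(3) h(2)[OF that(2)]] .
  have gi: "\<And>x. x \<in> g i \<Longrightarrow> x \<in> lcarr L" and gj: "\<And>x. x \<in> g j \<Longrightarrow> x \<in> lcarr L"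
    using g_carrier i(1) j(1) by auto
  note si = g_subspace[OF i(1)] and sj = g_subspace[OF j(1)]
  have "inj_on h (g j)"
  proof (rule inj_onI)
    fix b b' assume b: "b \<in> g j" "b' \<in> g j" "h b = h b'"
    then have "b + h b \<in> m" "b' + h b \<in> m" using h(2)[OF b(1)] h(2)[OF b(2)] by (simp_all add: add.commute)
    then show "b = b'" by (rule partner_unique[OF j i ji b(1,2)])
  qed
  moreover have "h ` g j = g i"
  proof
    show "h ` g j \<subseteq> g i" using h(1) by blast
    show "g i \<subseteq> h ` g j"
    proof
      fix a assume a: "a \<in> g i"
      obtain b where "b \<in> g j" "a + b \<in> m" by (rule partner[OF i j ij a]) (rule that)
      then show "a \<in> h ` g j" using hI[OF a] by blast
    qed
  qed
  moreover have "h (x + y) = h x + h y" if "x \<in> g j" "y \<in> g j" for x y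
  proof (rule hI[symmetric])
    show "h x + h y \<in> g i" "x + y \<in> g j" using that h(1) subspace_add[OF si] subspace_add[OF sj] by auto
    have "(h x + x) + (h y + y) \<in> m" by (intro subspace_add[OF m_subspace] h(2) that)
    then show "h x + h y + (x + y) \<in> m" by (simp add: algebra_simps)
  qed
  moreover have "h (lsmul L c x) = lsmul L c (h x)" if "x \<in> g j" for c x
  proof (rule hI[symmetric])
    show "lsmul L c (h x) \<in> g i" "lsmul L c x \<in> g j"
      using that h(1) subspace_scale[OF si] subspace_scale[OF sj] by auto
    show "lsmul L c (h x) + lsmul L c x \<in> m"
      using subspace_scale[OF m_subspace h(2)[OF that]] by (simp add: scale_right_distrib)
  qed
  moreover have "h (lbr L x y) = lbr L (h x) (h y)" if xy: "x \<in> g j" "y \<in> g j" for x y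
  proof (rule hI[symmetric])
    show "lbr L (h x) (h y) \<in> g i" "lbr L x y \<in> g j"
      using xy h(1) ideal_left[OF g_ideal[OF i(1)]] ideal_left[OF g_ideal[OF j(1)]] gi gj by auto
    have "lbr L (h x + x) (h y + y) \<in> m" by (intro m_br h(2) xy)
    moreover have "lbr L (h x + x) (h y + y) = lbr L (h x) (h y) + lbr L x y"
      using g_commute[OF i(1) j(1) ij h(1)[OF xy(1)] xy(2)] g_commute[OF j(1) i(1) ji xy(1) h(1)[OF xy(2)]]
        gi[OF h(1)[OF xy(1)]] gi[OF h(1)[OF xy(2)]] gj[OF xy(1)] gj[OF xy(2)]
      by (simp add: br_add_left br_add_right carrier_add)
    ultimately show "lbr L (h x) (h y) + lbr L x y \<in> m" by simp
  qed
  ultimately have "lie_iso h (on_carrier L (g j)) (on_carrier L (g i))"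
    unfolding lie_iso_def bij_betw_def by simp
  moreover have "a + b \<in> m \<longleftrightarrow> a = h b" if "a \<in> g i" "b \<in> g j" for a b
    using hI[OF that] h(2)[OF that(2)] by blast
  ultimately show ?thesis by (rule that)
qed

text \<open>Both ideals are identified with \<open>g i\<close>, by the identity and by \<open>h\<close>. The isomorphism \<open>h\<close> is
  equivariant because \<open>\<Sigma>\<close> has representatives in the stabilizer of \<open>m\<close>, and those preserve the graph
  of \<open>h\<close>.\<close>

lemma diagonal_component:
  assumes i: "i \<in> {1..r}" "\<not> g i \<subseteq> m" and j: "j \<in> {1..r}" "\<not> g j \<subseteq> m" and ij: "i \<noteq> j"
  shows "Sigma_diagonal L \<Sigma> (g i) (g j) (m \<inter> {a + b |a b. a \<in> g i \<and> b \<in> g j})"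
proof -
  let ?Mi = "on_carrier L (g i)" and ?Mj = "on_carrier L (g j)"
  let ?D = "m \<inter> {a + b |a b. a \<in> g i \<and> b \<in> g j}"
  let ?\<tau> = "Out_restrict L (g i)"
  obtain h where h: "lie_iso h ?Mj ?Mi" "\<And>a b. a \<in> g i \<Longrightarrow> b \<in> g j \<Longrightarrow> a + b \<in> m \<longleftrightarrow> a = h b"
    by (rule diagonal_isomorphism[OF assms]) (rule that)
  note subi = lie_ideal_imp_subalgebra[OF g_ideal[OF i(1)]]
  note subj = lie_ideal_imp_subalgebra[OF g_ideal[OF j(1)]]
  interpret Mi: lie_algebra ?Mi by (rule lie_algebra_on_carrier[OF subi])
  interpret Mj: lie_algebra ?Mj by (rule lie_algebra_on_carrier[OF subj])
  have D: "lie_subalgebra ?D L"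
  proof -
    have "lie_subalgebra {a + b |a b. a \<in> g i \<and> b \<in> g j} L"
      using g_commute[OF i(1) j(1) ij] g_zero[OF j(1)]
      by (intro subalgebra_sum_subspace subi subj) simp
    then show ?thesis
      unfolding lie_subalgebra_def using subspace_inter[OF m_subspace] m_br by (simp add: le_infI2)
  qed
  have h_in: "h b \<in> g i" if "b \<in> g j" for b using lie_isoD(4)[OF h(1)] that by simp
  have Ri: "Out_restrict L (g i) (lie_Inn L #>\<^bsub>lie_Aut L\<^esub> \<phi>) = lie_Inn ?Mi #>\<^bsub>lie_Aut ?Mi\<^esub> restrict \<phi> (g i)"
    "restrict \<phi> (g i) \<in> carrier (lie_Aut ?Mi)"
    and Rj: "Out_restrict L (g j) (lie_Inn L #>\<^bsub>lie_Aut L\<^esub> \<phi>) = lie_Inn ?Mj #>\<^bsub>lie_Aut ?Mj\<^esub> restrict \<phi> (g j)"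
    "restrict \<phi> (g j) \<in> carrier (lie_Aut ?Mj)"
    if "\<phi> \<in> Aut_over_stab L \<Sigma> m" for \<phi>
    using Out_restrict_coset[OF g_inner Aut_over_Aut g_invariant] stab_Aut_over[OF that] i(1) j(1)
      restrict_Aut[OF Aut_over_Aut subi g_invariant] restrict_Aut[OF Aut_over_Aut subj g_invariant]
    by auto
  have "equivariant_iso \<Sigma> (\<lambda>x. x) ?Mi ?\<tau> ?Mi ?\<tau>"
    unfolding equivariant_iso_def
  proof (intro conjI ballI lie_iso_id)
    fix \<sigma> assume "\<sigma> \<in> \<Sigma>"
    then obtain \<phi> where \<phi>: "\<phi> \<in> Aut_over_stab L \<Sigma> m" "\<sigma> = lie_Inn L #>\<^bsub>lie_Aut L\<^esub> \<phi>"
      using Sigma_rep_m by blast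
    have "transport (\<lambda>x. x) ?Mi ?Mi (restrict \<phi> (g i)) = restrict \<phi> (g i)"
    proof (rule Aut_eqI)
      show "transport (\<lambda>x. x) ?Mi ?Mi (restrict \<phi> (g i)) \<in> carrier (lie_Aut ?Mi)"
        by (rule Mi.transport_Aut[OF lie_iso_id Mi.lie_algebra_axioms Ri(2)[OF \<phi>(1)]])
      show "restrict \<phi> (g i) \<in> carrier (lie_Aut ?Mi)" by (rule Ri(2)[OF \<phi>(1)])
      fix x assume "x \<in> lcarr ?Mi"
      then show "transport (\<lambda>x. x) ?Mi ?Mi (restrict \<phi> (g i)) x = restrict \<phi> (g i) x"
        by (rule transport_apply[OF lie_iso_id])
    qed
    then show "Out_transport (\<lambda>x. x) ?Mi ?Mi (?\<tau> \<sigma>) = ?\<tau> \<sigma>"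
      unfolding \<phi>(2) Ri(1)[OF \<phi>(1)]
      using Mi.Out_transport_coset[OF lie_iso_id Mi.lie_algebra_axioms Ri(2)[OF \<phi>(1)]] by simp
  qed
  moreover have "equivariant_iso \<Sigma> h ?Mj (Out_restrict L (g j)) ?Mi ?\<tau>"
    unfolding equivariant_iso_def
  proof (intro conjI ballI h(1))
    fix \<sigma> assume "\<sigma> \<in> \<Sigma>"
    then obtain \<phi> where \<phi>: "\<phi> \<in> Aut_over_stab L \<Sigma> m" "\<sigma> = lie_Inn L #>\<^bsub>lie_Aut L\<^esub> \<phi>"
      using Sigma_rep_m by blast
    note G = stab_Aut_over[OF \<phi>(1)]
    have "transport h ?Mj ?Mi (restrict \<phi> (g j)) = restrict \<phi> (g i)"
    proof (rule Aut_eqI)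
      show "transport h ?Mj ?Mi (restrict \<phi> (g j)) \<in> carrier (lie_Aut ?Mi)"
        by (rule Mj.transport_Aut[OF h(1) Mi.lie_algebra_axioms Rj(2)[OF \<phi>(1)]])
      show "restrict \<phi> (g i) \<in> carrier (lie_Aut ?Mi)" by (rule Ri(2)[OF \<phi>(1)])
      fix x assume "x \<in> lcarr ?Mi"
      then obtain b where b: "b \<in> g j" "x = h b" using lie_isoD(3)[OF h(1)] by auto
      \<comment> \<open>\<open>\<phi>\<close> preserves \<open>m\<close>, hence the graph of \<open>h\<close>.\<close>
      have "h b + b \<in> m" using h(2)[OF h_in[OF b(1)] b(1)] by simp
      then have "\<phi> (h b + b) \<in> m" using stab_m[OF \<phi>(1)] by blast
      moreover have "\<phi> (h b + b) = \<phi> (h b) + \<phi> b"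
        using h_in[OF b(1)] b(1) g_carrier[OF i(1)] g_carrier[OF j(1)]
        by (intro lie_isoD(5)[OF Aut_over_iso[OF G]]) auto
      moreover have im: "\<phi> (h b) \<in> g i" "\<phi> b \<in> g j"
        using g_invariant[OF i(1) G] g_invariant[OF j(1) G] h_in[OF b(1)] b(1) by auto
      ultimately have "\<phi> (h b) = h (\<phi> b)" using h(2)[OF im] by simp
      moreover have "b \<in> lcarr ?Mj" using b(1) by simp
      ultimately show "transport h ?Mj ?Mi (restrict \<phi> (g j)) x = restrict \<phi> (g i) x"
        using transport_apply[OF h(1), of b] b h_in[OF b(1)] by simp
    qed
    then show "Out_transport h ?Mj ?Mi (Out_restrict L (g j) \<sigma>) = ?\<tau> \<sigma>"
      unfolding \<phi>(2) Ri(1)[OF \<phi>(1)] Rj(1)[OF \<phi>(1)]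
      using Mj.Out_transport_coset[OF h(1) Mi.lie_algebra_axioms Rj(2)[OF \<phi>(1)]] by simp
  qed
  moreover have "{((\<lambda>x. x) a, h b) |a b. a \<in> g i \<and> b \<in> g j \<and> a + b \<in> ?D} = {(x, x) |x. x \<in> lcarr ?Mi}"
  proof (intro equalityI subsetI)
    fix p assume "p \<in> {((\<lambda>x. x) a, h b) |a b. a \<in> g i \<and> b \<in> g j \<and> a + b \<in> ?D}"
    then show "p \<in> {(x, x) |x. x \<in> lcarr ?Mi}" using h(2) by auto
  next
    fix p assume "p \<in> {(x, x) |x. x \<in> lcarr ?Mi}"
    then obtain x where x: "x \<in> g i" "p = (x, x)" by auto
    then obtain b where b: "b \<in> g j" "x = h b" using lie_isoD(3)[OF h(1)] by auto
    then have "x + b \<in> ?D" using h(2)[OF x(1) b(1)] x(1) by blast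
    then show "p \<in> {((\<lambda>x. x) a, h b) |a b. a \<in> g i \<and> b \<in> g j \<and> a + b \<in> ?D}"
      using x b by blast
  qed
  ultimately have "lie_algebra ?Mi \<and> ?\<tau> \<in> hom ((lie_Out L)\<lparr>carrier := \<Sigma>\<rparr>) (lie_Out ?Mi) \<and>
      equivariant_iso \<Sigma> (\<lambda>x. x) ?Mi ?\<tau> ?Mi ?\<tau> \<and>
      equivariant_iso \<Sigma> h ?Mj (Out_restrict L (g j)) ?Mi ?\<tau> \<and>
      {((\<lambda>x. x) a, h b) |a b. a \<in> g i \<and> b \<in> g j \<and> a + b \<in> ?D} = {(x, x) |x. x \<in> lcarr ?Mi}"
    using Mi.lie_algebra_axioms Out_restrict_hom[OF g_inner[OF i(1)] g_invariant[OF i(1)]]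
    by (intro conjI)
  then have ex: "\<exists>(M :: ('k, 'v) lie_alg) \<tau> f h.
      lie_algebra M \<and> \<tau> \<in> hom ((lie_Out L)\<lparr>carrier := \<Sigma>\<rparr>) (lie_Out M) \<and>
      equivariant_iso \<Sigma> f ?Mi ?\<tau> M \<tau> \<and>
      equivariant_iso \<Sigma> h ?Mj (Out_restrict L (g j)) M \<tau> \<and>
      {(f a, h b) |a b. a \<in> g i \<and> b \<in> g j \<and> a + b \<in> ?D} = {(x, x) |x. x \<in> lcarr M}"
    by (intro exI)
  show ?thesis unfolding Sigma_diagonal_def by (intro conjI D ex) blast
qed

lemma diagonal_type:
  assumes i: "i \<in> {1..r}" "\<not> g i \<subseteq> m" and j: "j \<in> {1..r}" "\<not> g j \<subseteq> m" and ij: "i \<noteq> j"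
  shows "\<exists>D. Sigma_diagonal_type L \<Sigma> r g (m \<inter> lie_derived L) i j D"
proof -
  let ?D = "m \<inter> {a + b |a b. a \<in> g i \<and> b \<in> g j}"
  let ?K = "{1..r} - {j}"
  let ?W = "g(i := ?D)"
  have K: "{1..r} = insert i (insert j ({1..r} - {i, j}))" "?K = insert i ({1..r} - {i, j})"
    using i(1) j(1) ij by auto
  have sumK: "(\<Sum>k\<in>{1..r}. y k) = y i + y j + (\<Sum>k\<in>{1..r} - {i, j}. y k)"
    "(\<Sum>k\<in>?K. y k) = y i + (\<Sum>k\<in>{1..r} - {i, j}. y k)" for y :: "nat \<Rightarrow> 'v"
    by (subst K(1), use ij in \<open>simp add: add.assoc\<close>) (subst K(2), simp)
  have rest: "(\<Sum>k\<in>{1..r} - {i, j}. y k) \<in> m" if "\<And>k. k \<in> {1..r} - {i, j} \<Longrightarrow> y k \<in> g k" for y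
    using that others_in_m[OF i j ij] by (intro subspace_sum[OF m_subspace]) blast
  have "m \<inter> lie_derived L = {\<Sum>k\<in>?K. x k |x. \<forall>k\<in>?K. x k \<in> ?W k}"
  proof (intro equalityI subsetI)
    fix x assume x: "x \<in> m \<inter> lie_derived L"
    then obtain y where y: "\<And>k. k \<in> {1..r} \<Longrightarrow> y k \<in> g k" "x = (\<Sum>k\<in>{1..r}. y k)"
      using derived_decomposition by (metis IntD2)
    let ?y = "y(i := y i + y j)"
    have R: "(\<Sum>k\<in>{1..r} - {i, j}. y k) \<in> m" using y(1) by (intro rest) blast
    have "y i + y j = x - (\<Sum>k\<in>{1..r} - {i, j}. y k)" unfolding y(2) sumK(1) by simp
    also have "\<dots> \<in> m" using x R by (intro subspace_diff[OF m_subspace]) blast+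
    finally have "y i + y j \<in> ?D" using y(1) i(1) j(1) by blast
    then have "\<forall>k\<in>?K. ?y k \<in> ?W k" using y(1) by simp
    moreover have "x = (\<Sum>k\<in>?K. ?y k)" unfolding y(2) sumK by simp
    ultimately show "x \<in> {\<Sum>k\<in>?K. x k |x. \<forall>k\<in>?K. x k \<in> ?W k}" by blast
  next
    fix x assume "x \<in> {\<Sum>k\<in>?K. x k |x. \<forall>k\<in>?K. x k \<in> ?W k}"
    then obtain y where y: "\<And>k. k \<in> ?K \<Longrightarrow> y k \<in> ?W k" "x = (\<Sum>k\<in>?K. y k)" by blast
    have "i \<in> ?K" using i(1) ij by blast
    then have yi: "y i \<in> ?D" using y(1)[of i] by simp
    then obtain a b where ab: "a \<in> g i" "b \<in> g j" "y i = a + b" by blast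
    have yk: "y k \<in> g k" if "k \<in> {1..r} - {i, j}" for k using y(1)[of k] that by auto
    have "x \<in> m" unfolding y(2) sumK using yi rest[OF yk] by (intro subspace_add[OF m_subspace]) blast+
    moreover let ?y = "y(i := a, j := b)"
    have "x = (\<Sum>k\<in>{1..r}. ?y k)" unfolding y(2) sumK using ij ab(3) by simp
    moreover have "\<forall>k\<in>{1..r}. ?y k \<in> g k" using ab yk by auto
    ultimately show "x \<in> m \<inter> lie_derived L" using derived_sum unfolding internal_sum_def by blast
  qed
  moreover have "\<forall>k\<in>?K. y k = 0" if y: "\<forall>k\<in>?K. y k \<in> ?W k" "(\<Sum>k\<in>?K. y k) = 0" for y
  proof
    have "i \<in> ?K" using i(1) ij by blast
    then have "y i \<in> ?D" using bspec[OF y(1), of i] by simp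
    then obtain a b where ab: "a \<in> g i" "b \<in> g j" "y i = a + b" by blast
    let ?y = "y(i := a, j := b)"
    have yk: "y k \<in> g k" if "k \<in> {1..r} - {i, j}" for k using bspec[OF y(1), of k] that by auto
    have 0: "(\<Sum>k\<in>{1..r}. ?y k) = 0" using y(2) unfolding sumK using ij ab(3) by simp
    have "?y k \<in> g k" if "k \<in> {1..r}" for k using ab yk[of k] that by auto
    then have z: "?y k = 0" if "k \<in> {1..r}" for k using independent[of ?y, OF _ 0] that by blast
    fix k assume k: "k \<in> ?K"
    show "y k = 0"
    proof (cases "k = i")
      case True
      then show ?thesis using z[OF i(1)] z[OF j(1)] ij ab(3) by simp
    qed (use z[of k] k in simp)
  qed
  ultimately have "internal_sum (m \<inter> lie_derived L) ?K ?W" unfolding internal_sum_def by blast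
  then have "Sigma_diagonal_type L \<Sigma> r g (m \<inter> lie_derived L) i j ?D"
    unfolding Sigma_diagonal_type_def using diagonal_component[OF assms] i j ij by blast
  then show ?thesis by blast
qed

lemma simple_or_diagonal:
  "(\<exists>i mi. Sigma_simple_type L \<Sigma> r g (m \<inter> lie_derived L) i mi) \<or>
   (\<exists>i j D. Sigma_diagonal_type L \<Sigma> r g (m \<inter> lie_derived L) i j D)"
proof -
  obtain i where i: "i \<in> {1..r}" "\<not> g i \<subseteq> m" using ex_not_subset by blast
  show ?thesis
  proof (cases "\<exists>j\<in>{1..r}. j \<noteq> i \<and> \<not> g j \<subseteq> m")
    case True
    then show ?thesis using diagonal_type[OF i] by metis
  next
    case False
    then show ?thesis using simple_type[OF i] by blast
  qed
qed

text \<open>Maximality of \<open>m\<close> among all \<open>\<Sigma>\<close>-invariant subalgebras is not immediate from quasiprimitivity,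
  because the automorphisms that preserve a larger subalgebra \<open>K\<close> need not preserve \<open>m\<close>. But for the
  diagonal type, \<open>K \<inter> g i\<close> is an ideal, since the diagonal projects onto \<open>g i\<close>, and \<open>\<Sigma>\<close>-invariance
  of an ideal does not depend on the choice of representatives.\<close>

lemma diagonal_maximal:
  assumes diag: "Sigma_diagonal_type L \<Sigma> r g (m \<inter> lie_derived L) i j D"
  shows "maximal_Sigma_invariant_subalgebra L \<Sigma> m"
proof -
  have i: "i \<in> {1..r}" and j: "j \<in> {1..r}" and ij: "i \<noteq> j" and DD: "Sigma_diagonal L \<Sigma> (g i) (g j) D"
    and sum: "internal_sum (m \<inter> lie_derived L) ({1..r} - {j}) (g(i := D))"
    using diag unfolding Sigma_diagonal_type_def by auto
  obtain M :: "('k, 'v) lie_alg" and \<tau> f h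
    where "equivariant_iso \<Sigma> f (on_carrier L (g i)) (Out_restrict L (g i)) M \<tau>"
      "equivariant_iso \<Sigma> h (on_carrier L (g j)) (Out_restrict L (g j)) M \<tau>"
      and M3: "{(f a, h b) |a b. a \<in> g i \<and> b \<in> g j \<and> a + b \<in> D} = {(x, x) |x. x \<in> lcarr M}"
    using DD unfolding Sigma_diagonal_def by (elim conjE exE) (rule that)
  then have M: "lie_iso f (on_carrier L (g i)) M" "lie_iso h (on_carrier L (g j)) M"
    by (simp_all only: equivariant_iso_def)
  have D0: "0 \<in> D" using DD subspace_0 by (auto simp: Sigma_diagonal_def lie_subalgebra_def)
  have comp: "(g(i := D)) k \<subseteq> m" if "k \<in> {1..r} - {j}" for k
  proof
    fix x assume x: "x \<in> (g(i := D)) k"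
    have "x \<in> m \<inter> lie_derived L"
      by (rule internal_sum_single[where i = k and W = "g(i := D)", OF sum])
         (use that x g_zero D0 in auto)
    then show "x \<in> m" by blast
  qed
  have Dm: "D \<subseteq> m" using comp[of i] i ij by simp
  have others: "g k \<subseteq> m" if "k \<in> {1..r}" "k \<noteq> i" "k \<noteq> j" for k using comp[of k] that by simp
  have proj_i: "\<exists>b\<in>g j. a + b \<in> D" if a: "a \<in> g i" for a
  proof -
    have "f a \<in> lcarr M" using lie_isoD(4)[OF M(1)] a by simp
    then have "(f a, f a) \<in> {(f a, h b) |a b. a \<in> g i \<and> b \<in> g j \<and> a + b \<in> D}" unfolding M3 by blast
    then obtain a' b where ab: "f a = f a'" "a' \<in> g i" "b \<in> g j" "a' + b \<in> D" by blast
    then have "a = a'" using inj_onD[OF lie_isoD(2)[OF M(1)]] a by simp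
    then show ?thesis using ab by blast
  qed
  have proj_j: "\<exists>a\<in>g i. a + b \<in> D" if b: "b \<in> g j" for b
  proof -
    have "h b \<in> lcarr M" using lie_isoD(4)[OF M(2)] b by simp
    then have "(h b, h b) \<in> {(f a, h b) |a b. a \<in> g i \<and> b \<in> g j \<and> a + b \<in> D}" unfolding M3 by blast
    then obtain a b' where ab: "h b = h b'" "a \<in> g i" "b' \<in> g j" "a + b' \<in> D" by blast
    then have "b = b'" using inj_onD[OF lie_isoD(2)[OF M(2)]] b by simp
    then show ?thesis using ab by blast
  qed
  have "K = m" if K: "lie_subalgebra K L" "Sigma_invariant \<Sigma> K" "K \<noteq> lcarr L" "m \<subseteq> K" for K
  proof -
    have KL: "K \<subseteq> lcarr L" and Ks: "subspace K" and Kbr: "\<And>x y. x \<in> K \<Longrightarrow> y \<in> K \<Longrightarrow> lbr L x y \<in> K"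
      using K(1) by (auto simp: lie_subalgebra_def)
    have id: "lie_ideal (K \<inter> g i) L"
    proof (rule ideal_of_inner_ideal[OF g_inner[OF i]])
      have "lbr L x y \<in> K \<inter> g i" if x: "x \<in> g i" and y: "y \<in> K \<inter> g i" for x y
      proof -
        obtain b where b: "b \<in> g j" "x + b \<in> D" using proj_i[OF x] by blast
        have L: "x \<in> lcarr L" "y \<in> lcarr L" "b \<in> lcarr L"
          using x y b g_carrier[OF i] g_carrier[OF j] by auto
        have "lbr L (x + b) y \<in> K" using b(2) Dm K(4) y by (intro Kbr) auto
        moreover have "lbr L (x + b) y = lbr L x y"
          using L g_commute[OF j i _ b(1)] ij y by (simp add: br_add_left)
        ultimately show ?thesis using ideal_left[OF g_ideal[OF i] L(1)] y by auto
      qed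
      then show "lie_ideal (K \<inter> g i) (on_carrier L (g i))"
        unfolding lie_ideal_def by (simp add: subspace_inter[OF Ks g_subspace[OF i]])
    qed
    have "Sigma_invariant \<Sigma> (K \<inter> g i)"
    proof (rule Sigma_invariant_if_stab[OF K(2)])
      fix \<phi> assume "\<phi> \<in> Aut_over_stab L \<Sigma> K"
      then have \<phi>: "\<phi> \<in> Aut_over L \<Sigma>" "\<phi> ` K = K" by (auto simp: Aut_over_stab_def)
      show "\<phi> ` (K \<inter> g i) = K \<inter> g i"
        using Aut_over_image_Int[OF \<phi>(1) KL g_carrier[OF i]] g_invariant[OF i \<phi>(1)] \<phi>(2) by simp
    qed
    then have "K \<inter> g i = {0} \<or> K \<inter> g i = g i"
      using g_simple[OF i id] invariant_ideal[OF id] by blast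
    then show "K = m"
    proof
      assume 0: "K \<inter> g i = {0}"
      have "x \<in> m" if x: "x \<in> K" for x
      proof -
        have "x \<in> lcarr L" using x KL by blast
        then obtain z y where y: "z \<in> lie_center L" "\<And>k. k \<in> {1..r} \<Longrightarrow> y k \<in> g k"
          "x = z + (\<Sum>k\<in>{1..r}. y k)" by (rule carrier_decomposition) (rule that)
        let ?s = "z + (\<Sum>k\<in>{1..r} - {i, j}. y k)"
        have s: "?s \<in> m"
          using y(1) center_m others y(2) by (intro subspace_add[OF m_subspace] subspace_sum[OF m_subspace]) auto
        have "{1..r} = insert i (insert j ({1..r} - {i, j}))" using i j by auto
        then have "(\<Sum>k\<in>{1..r}. y k) = (\<Sum>k\<in>insert i (insert j ({1..r} - {i, j})). y k)" by simp
        also have "\<dots> = y i + y j + (\<Sum>k\<in>{1..r} - {i, j}. y k)" using ij by (simp add: add.assoc)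
        finally have xs: "x = y i + y j + ?s" using y(3) by (simp add: algebra_simps)
        then have "y i + y j = x - ?s" by simp
        then have yK: "y i + y j \<in> K" using subspace_diff[OF Ks x] s K(4) by auto
        obtain a where a: "a \<in> g i" "a + y j \<in> D" using proj_j[OF y(2)[OF j]] by blast
        have "y i - a = (y i + y j) - (a + y j)" by simp
        also have "\<dots> \<in> K" using yK a(2) Dm K(4) by (intro subspace_diff[OF Ks]) auto
        finally have "y i - a \<in> K \<inter> g i" using subspace_diff[OF g_subspace[OF i] y(2)[OF i] a(1)] by blast
        then have "y i - a = 0" using 0 by blast
        then have "y i = a" by simp
        then have "y i + y j \<in> m" using a(2) Dm by blast
        then show "x \<in> m" unfolding xs using s by (rule subspace_add[OF m_subspace])
      qed
      then show ?thesis using K(4) by blast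
    next
      assume "K \<inter> g i = g i"
      then have gi: "g i \<subseteq> K" by blast
      have gj: "g j \<subseteq> K"
      proof
        fix b assume "b \<in> g j"
        then obtain a where a: "a \<in> g i" "a + b \<in> D" using proj_j by blast
        have "b = (a + b) - a" by simp
        also have "\<dots> \<in> K" using a gi Dm K(4) by (intro subspace_diff[OF Ks]) auto
        finally show "b \<in> K" .
      qed
      have "lcarr L \<subseteq> K"
      proof (rule carrier_subset[OF Ks])
        show "lie_center L \<subseteq> K" using center_m K(4) by blast
        show "g k \<subseteq> K" if "k \<in> {1..r}" for k
          using gi gj others[OF that] K(4) by (cases "k = i"; cases "k = j") auto
      qed
      then show ?thesis using K(3) KL by blast
    qed
  qed
  then show ?thesis
    unfolding maximal_Sigma_invariant_subalgebra_def
    using m_subalgebra m_invariant m_proper by blast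
qed

subsection \<open>Ideals and normalizers\<close>

text \<open>An ideal that is a \<open>\<Sigma>\<close>-invariant subset is preserved by \<open>Aut_over L \<Sigma>\<close>, in particular by the
  stabilizer of \<open>m\<close>.\<close>

lemma ideal_imp_maximal:
  assumes id: "lie_ideal m L"
  shows "maximal_Sigma_invariant_ideal L \<Sigma> m"
  unfolding maximal_Sigma_invariant_ideal_def
proof (intro conjI allI impI id m_invariant m_proper)
  fix J assume J: "lie_ideal J L \<and> Sigma_invariant \<Sigma> J \<and> J \<noteq> lcarr L \<and> m \<subseteq> J"
  then have "J = m \<or> J = lcarr L"
    using invariant_ideal[of J] stab_Aut_over
    by (intro m_cases lie_ideal_imp_subalgebra) auto
  then show "J = m" using J by blast
qed

lemma maximal_ideal_iff:
  "maximal_Sigma_invariant_ideal L \<Sigma> m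
    \<longleftrightarrow> (\<exists>i mi. Sigma_simple_type L \<Sigma> r g (m \<inter> lie_derived L) i mi \<and> mi = {0})"
proof
  assume "maximal_Sigma_invariant_ideal L \<Sigma> m"
  then have id: "lie_ideal m L" by (simp add: maximal_Sigma_invariant_ideal_def)
  obtain i where i: "i \<in> {1..r}" "\<not> g i \<subseteq> m" using ex_not_subset by blast
  have "g k \<subseteq> m" if "k \<in> {1..r}" "k \<noteq> i" for k
    using not_ideal[OF i that(1)] that(2) id by blast
  then have "Sigma_simple_type L \<Sigma> r g (m \<inter> lie_derived L) i (m \<inter> g i)" by (rule simple_type[OF i])
  moreover have "lie_ideal (m \<inter> g i) L"
    unfolding lie_ideal_def
    using ideal_left[OF id] ideal_left[OF g_ideal[OF i(1)]] m_carrier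
      subspace_inter[OF m_subspace g_subspace[OF i(1)]] by blast
  then have "m \<inter> g i = {0}" by (rule ideal_Int_g[OF i])
  ultimately show "\<exists>i mi. Sigma_simple_type L \<Sigma> r g (m \<inter> lie_derived L) i mi \<and> mi = {0}" by blast
next
  assume "\<exists>i mi. Sigma_simple_type L \<Sigma> r g (m \<inter> lie_derived L) i mi \<and> mi = {0}"
  then obtain i where i: "i \<in> {1..r}"
    and sum: "internal_sum (m \<inter> lie_derived L) {1..r} (g(i := {0}))"
    unfolding Sigma_simple_type_def by blast
  have others: "g k \<subseteq> m" if k: "k \<in> {1..r}" "k \<noteq> i" for k
  proof
    fix x assume x: "x \<in> g k"
    have "x \<in> m \<inter> lie_derived L"
      by (rule internal_sum_single[where i = k and W = "g(i := {0})", OF sum])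
         (use k x g_zero in auto)
    then show "x \<in> m" by blast
  qed
  have "lbr L u x \<in> m" if u: "u \<in> lcarr L" and x: "x \<in> m" for u x
  proof -
    have xL: "x \<in> lcarr L" using x m_carrier by blast
    obtain z d where zd: "z \<in> lie_center L" "d \<in> lie_derived L" "x = z + d"
      using xL carrier_sum unfolding internal_sum2_def by blast
    have "d = x - z" using zd(3) by simp
    then have "d \<in> m \<inter> lie_derived L"
      using subspace_diff[OF m_subspace x] zd(1,2) center_m by blast
    then obtain y where y: "\<forall>k\<in>{1..r}. y k \<in> (g(i := {0})) k" "d = (\<Sum>k\<in>{1..r}. y k)"
      using sum unfolding internal_sum_def by blast
    note V = subspace_br_preimage[OF m_subspace u]
    have "y k \<in> {v \<in> lcarr L. lbr L u v \<in> m}" if k: "k \<in> {1..r}" for k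
    proof (cases "k = i")
      case True
      then have "y k = 0" using bspec[OF y(1) k] by simp
      then show ?thesis using u subspace_0[OF m_subspace] by simp
    next
      case False
      then have "y k \<in> g k" using bspec[OF y(1) k] by simp
      then show ?thesis
        using ideal_left[OF g_ideal[OF k] u] others[OF k False] g_carrier[OF k] by blast
    qed
    then have "d \<in> {v \<in> lcarr L. lbr L u v \<in> m}" unfolding y(2) by (rule subspace_sum[OF V])
    moreover have "z \<in> {v \<in> lcarr L. lbr L u v \<in> m}"
      using zd(1) u br_anti[OF _ u] subspace_0[OF m_subspace] by (auto simp: lie_center_def)
    ultimately have "x \<in> {v \<in> lcarr L. lbr L u v \<in> m}" unfolding zd(3) by (intro subspace_add[OF V])
    then show ?thesis by blast
  qed
  then have "lie_ideal m L" unfolding lie_ideal_def using m_subspace m_carrier by blast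
  then show "maximal_Sigma_invariant_ideal L \<Sigma> m" by (rule ideal_imp_maximal)
qed

lemma maximal_ideal_or_self_normalizing:
  "maximal_Sigma_invariant_ideal L \<Sigma> m \<or> self_normalizing L m"
proof -
  let ?N = "lie_normalizer L m"
  have mL: "\<And>x. x \<in> m \<Longrightarrow> x \<in> lcarr L" using m_carrier by blast
  have "lie_subalgebra ?N L"
    unfolding lie_subalgebra_def
  proof (intro conjI ballI)
    show "?N \<subseteq> lcarr L" by (auto simp: lie_normalizer_def)
    show "subspace ?N"
      by (rule subspaceI)
         (auto simp: lie_normalizer_def carrier_add carrier_smul br_add_left br_smul_left mL
           subspace_0[OF m_subspace] subspace_add[OF m_subspace] subspace_scale[OF m_subspace])
    fix x y assume x: "x \<in> ?N" and y: "y \<in> ?N"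
    then have L: "x \<in> lcarr L" "y \<in> lcarr L" by (auto simp: lie_normalizer_def)
    have "lbr L (lbr L x y) u \<in> m" if u: "u \<in> m" for u
    proof -
      have "lbr L x (lbr L y u) \<in> m" "lbr L y (lbr L x u) \<in> m"
        using x y u by (auto simp: lie_normalizer_def)
      moreover have "lbr L (lbr L x y) u = lbr L x (lbr L y u) - lbr L y (lbr L x u)"
        using br_derivation[OF L mL[OF u]] by simp
      ultimately show ?thesis using subspace_diff[OF m_subspace] by simp
    qed
    then show "lbr L x y \<in> ?N" using br_closed[OF L] by (simp add: lie_normalizer_def)
  qed
  moreover have "m \<subseteq> ?N" using m_br mL by (auto simp: lie_normalizer_def)
  moreover have "\<phi> ` ?N = ?N" if \<phi>: "\<phi> \<in> Aut_over_stab L \<Sigma> m" for \<phi>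
  proof -
    note iso = lie_isoD[OF Aut_over_iso[OF stab_Aut_over[OF \<phi>]]]
    have norm: "x \<in> ?N \<longleftrightarrow> \<phi> x \<in> ?N" if x: "x \<in> lcarr L" for x
    proof -
      have "(\<phi> (lbr L x u) \<in> m) = (lbr L x u \<in> m)" if "u \<in> m" for u
        using stab_m[OF \<phi>] iso(2) br_closed[OF x mL[OF that]] m_carrier
        by (metis inj_on_image_mem_iff)
      then have "(\<forall>u\<in>m. lbr L x u \<in> m) \<longleftrightarrow> (\<forall>u\<in>m. lbr L (\<phi> x) (\<phi> u) \<in> m)"
        using iso(7)[OF x mL] by auto
      also have "\<dots> \<longleftrightarrow> (\<forall>u\<in>\<phi> ` m. lbr L (\<phi> x) u \<in> m)" by blast
      finally show ?thesis using x iso(4)[OF x] stab_m[OF \<phi>] by (simp add: lie_normalizer_def)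
    qed
    have NL: "?N \<subseteq> lcarr L" by (auto simp: lie_normalizer_def)
    show ?thesis
    proof (intro equalityI subsetI)
      show "y \<in> ?N" if "y \<in> \<phi> ` ?N" for y using that norm NL by blast
      fix y assume y: "y \<in> ?N"
      then obtain x where "x \<in> lcarr L" "y = \<phi> x" using iso(3) NL by blast
      then show "y \<in> \<phi> ` ?N" using norm y by blast
    qed
  qed
  ultimately have "?N = m \<or> ?N = lcarr L" by (rule m_cases)
  then show ?thesis
  proof
    assume "?N = lcarr L"
    then have "lie_ideal m L"
      unfolding lie_ideal_def lie_normalizer_def using m_subspace m_carrier by blast
    then show ?thesis using ideal_imp_maximal by blast
  qed (simp add: self_normalizing_def)
qed

lemma m_decomposition: "internal_sum2 m (lie_center L) (m \<inter> lie_derived L)"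
  unfolding internal_sum2_def
proof
  show "m = {a + b |a b. a \<in> lie_center L \<and> b \<in> m \<inter> lie_derived L}"
  proof (intro equalityI subsetI)
    fix x assume x: "x \<in> m"
    then obtain z d where zd: "z \<in> lie_center L" "d \<in> lie_derived L" "x = z + d"
      using m_carrier carrier_sum unfolding internal_sum2_def by blast
    have "d = x - z" using zd(3) by simp
    then have "d \<in> m" using subspace_diff[OF m_subspace x] zd(1) center_m by blast
    then show "x \<in> {a + b |a b. a \<in> lie_center L \<and> b \<in> m \<inter> lie_derived L}" using zd by blast
  next
    fix x assume "x \<in> {a + b |a b. a \<in> lie_center L \<and> b \<in> m \<inter> lie_derived L}"
    then show "x \<in> m" using center_m subspace_add[OF m_subspace] by blast
  qed
  have "lie_center L \<inter> lie_derived L = {0}" using carrier_sum by (simp add: internal_sum2_def)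
  then show "lie_center L \<inter> (m \<inter> lie_derived L) = {0}" using subspace_0[OF m_subspace] by blast
qed

end

section \<open>The classification\<close>

theorem theorem5p7:
  fixes L :: "('k::real_normed_field, 'v::euclidean_space) lie_alg"
    and \<Sigma> :: "('v \<Rightarrow> 'v) set set"
    and r :: nat and g :: "nat \<Rightarrow> 'v set"
    and m m' :: "'v set"
  assumes "lie_algebra L"
    and "subgroup \<Sigma> (lie_Out L)"
    and "lie_reductive L"
    and "bij_betw g {1..r} (Sigma_simple_ideals L \<Sigma>)"
    and "internal_sum2 (lcarr L) (lie_center L) (lie_derived L)"
    and "internal_sum (lie_derived L) {1..r} g"
    and "Sigma_quasiprimitive L \<Sigma> m"
    and "lie_center L \<subseteq> m"
    and "m' = m \<inter> lie_derived L"
  shows "internal_sum2 m (lie_center L) m' \<and>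
    ((\<exists>i mi. Sigma_simple_type L \<Sigma> r g m' i mi) \<or>
     (\<exists>i j gij. Sigma_diagonal_type L \<Sigma> r g m' i j gij)) \<and>
    ((\<exists>i j gij. Sigma_diagonal_type L \<Sigma> r g m' i j gij)
       \<longrightarrow> maximal_Sigma_invariant_subalgebra L \<Sigma> m) \<and>
    (maximal_Sigma_invariant_ideal L \<Sigma> m
       \<longleftrightarrow> (\<exists>i mi. Sigma_simple_type L \<Sigma> r g m' i mi \<and> mi = {0})) \<and>
    (\<not> maximal_Sigma_invariant_ideal L \<Sigma> m \<longrightarrow> self_normalizing L m)"
proof -
  have "g i \<in> Sigma_simple_ideals L \<Sigma>" if "i \<in> {1..r}" for i
    using bij_betw_apply[OF assms(4) that] .
  then interpret quasiprimitive L \<Sigma> r g m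
    using assms
    by (intro quasiprimitive.intro reductive_Sigma.intro lie_algebra_Sigma.intro
      lie_algebra_Sigma_axioms.intro reductive_Sigma_axioms.intro quasiprimitive_axioms.intro)
  show ?thesis
    unfolding assms(9)
    using m_decomposition simple_or_diagonal diagonal_maximal maximal_ideal_iff
      maximal_ideal_or_self_normalizing by blast
qed

end
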